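(* Let $G$ be a group with finite generating set $X$. The following are equivalent: (1) $G$ has a solvable word problem; (2) $G$ admits a recursively enumerable presentation $G\cong\langle X\mid R\rangle$ and $G$ is in the class epiRE.
   Context: For a set $Y$, $Y^*$ denotes the set of all finite strings over $Y$, including the empty string. For a group $G$ and $Y\subseteq G$, and $w\in Y^*$, $g\in G$, write $w=_G g$ if the product in $G$ of the letters of $w$ equals $g$. $G$ has solvable word problem if there is an algorithm (Turing machine) which, given a word $w\in (X\cup X^{-1})^*$, decides whether $w=_G1_G$. For $R\subseteq (X\cup X^{-1})^*$, $G\cong\langle X\mid R\rangle$ means that the quotient of the free group $F_X$ by the normal closure of the image of $R$ is isomorphic to $G$. The presentation is recursively enumerable if there is a Turing machine which outputs (enumerates) the set $R$ of strings. A group $G$ is epiRE if there are a finite set $Y\subseteq G$ generating $G$ as a monoid and a recursively enumerable language $L\subseteq Y^*$ such that no $w\in L$ satisfies $w=_G 1_G$, and for every $h\in G\setminus\{1_G\}$ there is $w_h\in L$ with $w_h=_G h$. *)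

theory Defs
  imports "HOL-Algebra.Generated_Groups"
begin

subsection \<open>Deterministic multi-tape Turing machines\<close>

text \<open>
  Letters of the language under consideration are themselves tape symbols, so no encoding of
  words is involved. A machine may use finitely many auxiliary symbols, drawn from a countable
  supply. Tapes are infinite in both directions; a tape is a pair of its contents and the head
  position.
\<close>

datatype 'l symbol = Blank | Letter 'l | Aux nat

datatype move = MoveLeft | Stay | MoveRight

type_synonym 'l tape = "(int \<Rightarrow> 'l symbol) \<times> int"

fun read_symbol :: "'l tape \<Rightarrow> 'l symbol" where
  "read_symbol (f, p) = f p"

fun shift :: "move \<Rightarrow> int" where
  "shift MoveLeft = -1"
| "shift Stay = 0"
| "shift MoveRight = 1"

fun act :: "'l symbol \<times> move \<Rightarrow> 'l tape \<Rightarrow> 'l tape" where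
  "act (s, d) (f, p) = (f(p := s), p + shift d)"

record 'l tm =
  num_tapes :: nat
  states :: "nat set"
  tape_alphabet :: "'l symbol set"
  initial :: nat
  final :: "nat set"
  delta :: "nat \<Rightarrow> 'l symbol list \<Rightarrow> nat \<times> ('l symbol \<times> move) list"

text \<open>
  The transition function matters only on states and on lists of \<open>num_tapes M\<close> symbols of the
  tape alphabet; there it is a finite table.
\<close>

definition valid_tm :: "'l set \<Rightarrow> ('l, 'm) tm_scheme \<Rightarrow> bool" where
  "valid_tm A M \<longleftrightarrow>
     num_tapes M \<ge> 1 \<and>
     finite (states M) \<and> initial M \<in> states M \<and> final M \<subseteq> states M \<and>
     finite (tape_alphabet M) \<and> Blank \<in> tape_alphabet M \<and> Letter ` A \<subseteq> tape_alphabet M \<and>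
     (\<forall>q\<in>states M. \<forall>ss\<in>lists (tape_alphabet M). length ss = num_tapes M \<longrightarrow>
        fst (delta M q ss) \<in> states M \<and>
        length (snd (delta M q ss)) = num_tapes M \<and>
        fst ` set (snd (delta M q ss)) \<subseteq> tape_alphabet M)"

type_synonym 'l config = "nat \<times> 'l tape list"

definition step :: "('l, 'm) tm_scheme \<Rightarrow> 'l config \<Rightarrow> 'l config" where
  "step M = (\<lambda>(q, ts).
     if q \<in> final M then (q, ts)
     else let (q', as) = delta M q (map read_symbol ts) in (q', map2 act as ts))"

definition word_contents :: "'l list \<Rightarrow> int \<Rightarrow> 'l symbol" where
  "word_contents w = (\<lambda>i. if 0 \<le> i \<and> i < int (length w) then Letter (w ! nat i) else Blank)"

text \<open>The first tape (tape \<open>0\<close>) serves as input tape and as output tape.\<close>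

definition start_config :: "('l, 'm) tm_scheme \<Rightarrow> 'l list \<Rightarrow> 'l config" where
  "start_config M w =
     (initial M, (word_contents w, 0) # replicate (num_tapes M - 1) (word_contents [], 0))"

definition run :: "('l, 'm) tm_scheme \<Rightarrow> 'l list \<Rightarrow> nat \<Rightarrow> 'l config" where
  "run M w n = (step M ^^ n) (start_config M w)"

record 'l decider = "'l tm" +
  accepting :: "nat set"

definition decides :: "'l decider \<Rightarrow> 'l set \<Rightarrow> 'l list set \<Rightarrow> bool" where
  "decides M A L \<longleftrightarrow>
     valid_tm A M \<and> accepting M \<subseteq> final M \<and>
     (\<forall>w\<in>lists A. \<exists>n. fst (run M w n) \<in> final M \<and>
                      (fst (run M w n) \<in> accepting M \<longleftrightarrow> w \<in> L))"

definition decidable_language :: "'l set \<Rightarrow> 'l list set \<Rightarrow> bool" where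
  "decidable_language A L \<longleftrightarrow> L \<subseteq> lists A \<and> (\<exists>M. decides M A L)"

text \<open>
  An enumerator is started on empty tapes. Whenever it enters its printing state while the
  output tape holds exactly a word at the cells \<open>0, 1, \<dots>\<close> and blanks elsewhere, that word is
  output. It need not halt, and words may be output repeatedly and in any order.
\<close>

record 'l enumerator = "'l tm" +
  printing :: nat

definition outputs :: "'l enumerator \<Rightarrow> 'l list set" where
  "outputs M =
     {w. \<exists>n. fst (run M [] n) = printing M \<and> fst (snd (run M [] n) ! 0) = word_contents w}"

definition recursively_enumerable :: "'l set \<Rightarrow> 'l list set \<Rightarrow> bool" where
  "recursively_enumerable A L \<longleftrightarrow> L \<subseteq> lists A \<and> (\<exists>M. valid_tm A M \<and> outputs M = L)"



subsection \<open>Group words, free groups and presentations\<close>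

text \<open>
  \<open>Neg x\<close> is the formal inverse of the generator \<open>x\<close>. It is distinct from every \<open>Pos y\<close>, also
  when the inverse of \<open>x\<close> in the group happens to be a generator.
\<close>

datatype 'a letter = Pos 'a | Neg 'a

definition letters :: "'a set \<Rightarrow> 'a letter set" where
  "letters X = Pos ` X \<union> Neg ` X"

fun flip :: "'a letter \<Rightarrow> 'a letter" where
  "flip (Pos x) = Neg x"
| "flip (Neg x) = Pos x"

fun push_letter :: "'a letter \<Rightarrow> 'a letter list \<Rightarrow> 'a letter list" where
  "push_letter a [] = [a]"
| "push_letter a (b # w) = (if b = flip a then w else a # b # w)"

definition free_reduce :: "'a letter list \<Rightarrow> 'a letter list" where
  "free_reduce w = foldr push_letter w []"

definition freely_reduced :: "'a letter list \<Rightarrow> bool" where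
  "freely_reduced w \<longleftrightarrow> successively (\<lambda>a b. b \<noteq> flip a) w"

definition free_group :: "'a set \<Rightarrow> 'a letter list monoid" where
  "free_group X =
     \<lparr>carrier = {w \<in> lists (letters X). freely_reduced w},
      monoid.mult = (\<lambda>u v. free_reduce (u @ v)),
      one = []\<rparr>"

definition normal_closure :: "('a, 'm) monoid_scheme \<Rightarrow> 'a set \<Rightarrow> 'a set" where
  "normal_closure H S = \<Inter>{N. N \<lhd> H \<and> S \<subseteq> N}"

definition presented_group :: "'a set \<Rightarrow> 'a letter list set \<Rightarrow> 'a letter list set monoid" where
  "presented_group X R = free_group X Mod normal_closure (free_group X) (free_reduce ` R)"


subsection \<open>Word problem and the class epiRE\<close>

definition word_value :: "('a, 'm) monoid_scheme \<Rightarrow> 'a list \<Rightarrow> 'a" where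
  "word_value G w = foldr (\<lambda>x y. x \<otimes>\<^bsub>G\<^esub> y) w \<one>\<^bsub>G\<^esub>"

fun letter_value :: "('a, 'm) monoid_scheme \<Rightarrow> 'a letter \<Rightarrow> 'a" where
  "letter_value G (Pos x) = x"
| "letter_value G (Neg x) = inv\<^bsub>G\<^esub> x"

definition solvable_word_problem :: "('a, 'm) monoid_scheme \<Rightarrow> 'a set \<Rightarrow> bool" where
  "solvable_word_problem G X \<longleftrightarrow>
     decidable_language (letters X)
       {w \<in> lists (letters X). word_value G (map (letter_value G) w) = \<one>\<^bsub>G\<^esub>}"

definition has_re_presentation :: "('a, 'm) monoid_scheme \<Rightarrow> 'a set \<Rightarrow> bool" where
  "has_re_presentation G X \<longleftrightarrow>
     (\<exists>R. R \<subseteq> lists (letters X) \<and> recursively_enumerable (letters X) R \<and>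
          G \<cong> presented_group X R)"

definition epiRE :: "('a, 'm) monoid_scheme \<Rightarrow> bool" where
  "epiRE G \<longleftrightarrow>
     (\<exists>Y L. finite Y \<and> Y \<subseteq> carrier G \<and> word_value G ` lists Y = carrier G \<and>
        L \<subseteq> lists Y \<and> recursively_enumerable Y L \<and>
        (\<forall>w\<in>L. word_value G w \<noteq> \<one>\<^bsub>G\<^esub>) \<and>
        (\<forall>h\<in>carrier G - {\<one>\<^bsub>G\<^esub>}. \<exists>w\<in>L. word_value G w = h))"

end

theory Submission
  imports Defs "HOL-Library.Nat_Bijection"
begin

text \<open>
  If the words with value \<open>\<one>\<close> form a decidable set, this set is recursively enumerable, and it
  is a set of relators presenting the group, because it contains the whole kernel of the map from
  the free group. Its complement is recursively enumerable too; read over the finite set of all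
  generators and their inverses, it is a language that hits exactly the nontrivial elements.

  Conversely, let \<open>h\<close> be an isomorphism onto \<open>\<langle>X | R\<rangle>\<close>. Nothing says that \<open>h\<close> fixes the
  generators, so each letter \<open>a\<close> is first translated into a word representing \<open>h a\<close>; finitely
  many translations suffice. A word \<open>w\<close> has value \<open>\<one>\<close> iff its translation is freely equal to a
  product of conjugates of relators and inverted relators. It has another value iff it has the value
  of some \<open>v \<in> L\<close>, as no element of \<open>L\<close> is trivial, and again \<open>w = v\<close> is a matter of a product
  of conjugates, now for \<open>w v\<inverse>\<close>. Both kinds of certificates can be checked mechanically, and for
  every \<open>w\<close> exactly one kind exists; so a search through all certificates decides.

  No algorithm is programmed on a Turing machine directly. Computations are carried out by primitive
  recursive functions on encoded data, whose closure properties (\<open>pr_intros\<close>) make every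
  function in question visibly computable. Two bridges in the spirit of Kleene's normal form theorem
  connect them with machines. The state of any machine after \<open>n\<close> steps is a primitive
  recursive function of the input and \<open>n\<close> (\<open>pr_run_state\<close>; \<open>recursively_enumerable_imp_pr\<close>
  is the version for enumerators). In the other direction, the range of a primitive recursive
  function is recursively enumerable (\<open>recursively_enumerable_range\<close>) and an unbounded search with
  a primitive recursive test decides (\<open>decidable_language_search\<close>). The machines
  for these last two facts are compiled from register programs, each register being a tape
  whose head position is the value of the register.
\<close>

section \<open>Primitive recursive functions on encoded data\<close>

text \<open>
  Unary functions suffice because of the pairing \<open>prod_encode\<close>. Iteration of a function,
  with the start value and the number of rounds packed into the argument, takes the place of
  the usual scheme of primitive recursion: a counter can be carried along in a pair.
\<close>

inductive prim_rec :: "(nat \<Rightarrow> nat) \<Rightarrow> bool" where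
  prim_rec_zero: "prim_rec (\<lambda>n. 0)"
| prim_rec_Suc: "prim_rec Suc"
| prim_rec_fst: "prim_rec (\<lambda>n. fst (prod_decode n))"
| prim_rec_snd: "prim_rec (\<lambda>n. snd (prod_decode n))"
| prim_rec_pair: "prim_rec f \<Longrightarrow> prim_rec g \<Longrightarrow> prim_rec (\<lambda>n. prod_encode (f n, g n))"
| prim_rec_comp: "prim_rec f \<Longrightarrow> prim_rec g \<Longrightarrow> prim_rec (\<lambda>n. f (g n))"
| prim_rec_iter:
    "prim_rec f \<Longrightarrow> prim_rec (\<lambda>n. (f ^^ snd (prod_decode n)) (fst (prod_decode n)))"

lemma prim_rec_id: "prim_rec (\<lambda>n. n)"
  using prim_rec_pair[OF prim_rec_fst prim_rec_snd] by simp

text \<open>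
  Asking for bijections and not just injections makes every number the code of some object. This
  turns a search through all numbers into a search through all certificates, and frees
  functions on codes from treating invalid inputs.
\<close>

class encodable =
  fixes encode :: "'a \<Rightarrow> nat"
  assumes bij_encode: "bij encode"

definition decode :: "nat \<Rightarrow> 'a::encodable" where
  "decode = inv_into UNIV encode"

lemma decode_encode [simp]: "decode (encode x) = x"
  unfolding decode_def using bij_encode[where 'a = 'a] by (simp add: bij_def inv_into_f_f)

lemma encode_decode [simp]: "encode (decode n :: 'a::encodable) = n"
  unfolding decode_def using bij_encode[where 'a = 'a] by (simp add: bij_def f_inv_into_f)

lemma encode_inject [simp]: "encode x = encode y \<longleftrightarrow> x = y"
  by (metis decode_encode)

lemma decode_eqI: "encode x = n \<Longrightarrow> decode n = x"
  by auto

instantiation nat :: encodable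
begin
definition encode_nat :: "nat \<Rightarrow> nat" where "encode_nat n = n"
instance by standard (simp add: encode_nat_def bij_def inj_def surj_def)
end

instantiation int :: encodable
begin
definition encode_int :: "int \<Rightarrow> nat" where "encode_int = int_encode"
instance by standard (simp add: encode_int_def bij_int_encode)
end

instantiation prod :: (encodable, encodable) encodable
begin
definition encode_prod :: "'a \<times> 'b \<Rightarrow> nat" where
  "encode_prod p = prod_encode (encode (fst p), encode (snd p))"
instance
proof
  show "bij (encode :: 'a \<times> 'b \<Rightarrow> nat)"
  proof (rule bijI')
    show "(encode x = encode y) = (x = y)" for x y :: "'a \<times> 'b"
      by (cases x; cases y) (simp add: encode_prod_def)
    show "\<exists>x. n = encode (x :: 'a \<times> 'b)" for n
      by (rule exI[of _ "(decode (fst (prod_decode n)), decode (snd (prod_decode n)))"])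
        (simp add: encode_prod_def)
  qed
qed
end

instantiation list :: (encodable) encodable
begin
definition encode_list :: "'a list \<Rightarrow> nat" where
  "encode_list xs = list_encode (map encode xs)"
instance
proof
  have enc: "encode = list_encode \<circ> map (encode :: 'a \<Rightarrow> nat)"
    by (simp add: fun_eq_iff encode_list_def)
  have "bij (map (encode :: 'a \<Rightarrow> nat))"
    using bij_encode[where 'a = 'a] lists_image[of encode "UNIV :: 'a set"]
    by (simp add: bij_def list.inj_map)
  then show "bij (encode :: 'a list \<Rightarrow> nat)"
    unfolding enc by (intro bij_comp bij_list_encode)
qed
end

lemma encode_nat [simp]: "encode (n :: nat) = n" "decode n = (n :: nat)"
  by (simp_all add: encode_nat_def decode_eqI)

lemma encode_pair [simp]: "encode (x, y) = prod_encode (encode x, encode y)"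
  by (simp add: encode_prod_def)

lemma decode_pair: "decode n = (decode (fst (prod_decode n)), decode (snd (prod_decode n)))"
  by (rule decode_eqI) simp

lemma encode_Nil [simp]: "encode [] = 0"
  and encode_Cons [simp]: "encode (x # xs) = Suc (prod_encode (encode x, encode xs))"
  by (simp_all add: encode_list_def)

text \<open>
  Working with \<open>pr\<close> instead of \<open>prim_rec\<close> hides the codes: the rules collected
  in \<open>pr_intros\<close> follow the syntax of a function definition. A function with several
  arguments is treated as a function of a pair.
\<close>

definition pr :: "('a::encodable \<Rightarrow> 'b::encodable) \<Rightarrow> bool" where
  "pr f \<longleftrightarrow> prim_rec (\<lambda>n. encode (f (decode n)))"

named_theorems pr_intros

lemma pr_id [pr_intros]: "pr (\<lambda>x. x)"
  by (simp add: pr_def prim_rec_id)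

lemma pr_comp: "pr f \<Longrightarrow> pr g \<Longrightarrow> pr (\<lambda>x. f (g x))"
  unfolding pr_def using prim_rec_comp[of "\<lambda>n. encode (f (decode n))" "\<lambda>n. encode (g (decode n))"]
  by simp

lemma pr_encode [pr_intros]: "pr f \<Longrightarrow> pr (\<lambda>x. encode (f x))"
  and pr_decode [pr_intros]: "pr g \<Longrightarrow> pr (\<lambda>x. decode (g x) :: 'b::encodable)"
  by (simp_all add: pr_def)

lemma pr_Suc [pr_intros]: "pr f \<Longrightarrow> pr (\<lambda>x. Suc (f x))"
  unfolding pr_def using prim_rec_comp[OF prim_rec_Suc] by simp

lemma pr_const [pr_intros]: "pr (\<lambda>x. c)"
proof -
  have "prim_rec (\<lambda>x. n)" for n
    by (induction n) (use prim_rec_comp[OF prim_rec_Suc] in \<open>auto intro: prim_rec_zero\<close>)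
  then show ?thesis by (simp add: pr_def)
qed

lemma pr_Pair [pr_intros]: "pr f \<Longrightarrow> pr g \<Longrightarrow> pr (\<lambda>x. (f x, g x))"
  by (simp add: pr_def prim_rec_pair)

lemma pr_fst [pr_intros]:
  fixes f :: "'c::encodable \<Rightarrow> 'a::encodable \<times> 'b::encodable"
  assumes "pr f"
  shows "pr (\<lambda>x. fst (f x))"
proof (rule pr_comp[OF _ assms])
  show "pr (fst :: 'a \<times> 'b \<Rightarrow> 'a)"
    by (simp add: pr_def decode_pair prim_rec_fst)
qed

lemma pr_snd [pr_intros]:
  fixes f :: "'c::encodable \<Rightarrow> 'a::encodable \<times> 'b::encodable"
  assumes "pr f"
  shows "pr (\<lambda>x. snd (f x))"
proof (rule pr_comp[OF _ assms])
  show "pr (snd :: 'a \<times> 'b \<Rightarrow> 'b)"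
    by (simp add: pr_def decode_pair prim_rec_snd)
qed

lemma pr_uncurry:
  assumes "pr (\<lambda>p. f (fst p) (snd p))" "pr g" "pr h"
  shows "pr (\<lambda>x. f (g x) (h x))"
  using pr_comp[OF assms(1) pr_Pair[OF assms(2,3)]] by simp

lemma pr_case_prod [pr_intros]:
  assumes "pr (\<lambda>x. f x (fst (g x)) (snd (g x)))"
  shows "pr (\<lambda>x. case g x of (a, b) \<Rightarrow> f x a b)"
  using assms by (simp add: case_prod_beta)

lemma pr_funpow [pr_intros]:
  fixes f :: "'a::encodable \<Rightarrow> 'b::encodable \<Rightarrow> 'b"
  assumes f: "pr (\<lambda>p. f (fst p) (snd p))" and n: "pr n" and a: "pr a"
  shows "pr (\<lambda>x. (f x ^^ n x) (a x))"
proof -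
  define F where "F p = (fst p, f (fst p) (snd p))" for p :: "'a \<times> 'b"
  let ?G = "\<lambda>n. encode (F (decode n))"
  have "pr F"
    unfolding F_def by (intro pr_intros f)
  then have "prim_rec ?G"
    by (simp add: pr_def)
  then have "prim_rec (\<lambda>n. (?G ^^ snd (prod_decode n)) (fst (prod_decode n)))"
    by (rule prim_rec_iter)
  moreover have "(?G ^^ k) m = encode ((F ^^ k) (decode m))" for k m
    by (induction k arbitrary: m) (simp_all add: funpow_swap1)
  ultimately have "pr (\<lambda>p :: ('a \<times> 'b) \<times> nat. (F ^^ snd p) (fst p))"
    by (simp add: pr_def decode_pair)
  then have "pr (\<lambda>x. (F ^^ n x) (x, a x))"
    by (rule pr_uncurry) (intro pr_intros a n)+
  moreover have "(F ^^ k) (x, y) = (x, (f x ^^ k) y)" for k x y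
    by (induction k) (simp_all add: F_def)
  ultimately show ?thesis
    using pr_snd by fastforce
qed

lemma pr_if_zero:
  fixes n :: "'a::encodable \<Rightarrow> nat"
  assumes "pr n" "pr f" "pr g"
  shows "pr (\<lambda>x. if n x = 0 then f x else g x)"
proof -
  have eq: "(if k = 0 then a else b) = ((\<lambda>_. b) ^^ k) a" for k :: nat and a b
    by (induction k) auto
  show ?thesis
    unfolding eq by (intro pr_funpow assms pr_comp[OF assms(3)] pr_fst pr_id)
qed

lemma pr_pred: "pr (\<lambda>x. n x - Suc 0)" if "pr n"
proof -
  \<comment> \<open>Iteration can only count upwards; the predecessor is the value that the counter had one
      round earlier.\<close>
  let ?f = "\<lambda>p :: nat \<times> nat. (snd p, Suc (snd p))"
  have "(?f ^^ k) (0, 0) = (k - 1, k)" for k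
    by (induction k) auto
  then have eq: "k - Suc 0 = fst ((?f ^^ k) (0, 0))" for k
    by simp
  show ?thesis
    unfolding eq by (intro pr_intros that)
qed

lemma pr_minus [pr_intros]: "pr (\<lambda>x. m x - n x)" if "pr m" "pr n" for m n :: "_ \<Rightarrow> nat"
proof -
  have "a - b = ((\<lambda>k. k - Suc 0) ^^ b) a" for a b
    by (induction b) auto
  then have eq: "(\<lambda>x. m x - n x) = (\<lambda>x. ((\<lambda>k. k - Suc 0) ^^ n x) (m x))"
    by (intro ext)
  show ?thesis
    unfolding eq by (intro pr_intros pr_pred that)
qed

text \<open>
  Truth values have no bijection with the numbers, so predicates get a notion of their own.
  Truth is represented by \<open>0\<close>, which matches \<open>pr_if_zero\<close>.
\<close>

definition decidable_pr :: "('a::encodable \<Rightarrow> bool) \<Rightarrow> bool" where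
  "decidable_pr P \<longleftrightarrow> pr (\<lambda>x. if P x then 0 else 1 :: nat)"

lemma pr_if [pr_intros]:
  assumes "decidable_pr P" "pr f" "pr g"
  shows "pr (\<lambda>x. if P x then f x else g x)"
proof -
  have eq: "(if b then u else v) = (if (if b then 0 else 1 :: nat) = 0 then u else v)"
    for b and u v :: 'b
    by simp
  show ?thesis
    by (subst eq) (intro pr_if_zero assms(2,3) assms(1)[unfolded decidable_pr_def])
qed

lemma decidable_pr_comp: "decidable_pr P \<Longrightarrow> pr f \<Longrightarrow> decidable_pr (\<lambda>x. P (f x))"
  unfolding decidable_pr_def by (rule pr_comp)

lemma decidable_pr_zero: "pr n \<Longrightarrow> decidable_pr (\<lambda>x. n x = 0)" for n :: "_ \<Rightarrow> nat"
  unfolding decidable_pr_def by (intro pr_if_zero pr_intros)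

lemma decidable_pr_not [pr_intros]: "decidable_pr P \<Longrightarrow> decidable_pr (\<lambda>x. \<not> P x)"
proof -
  assume "decidable_pr P"
  then have "pr (\<lambda>x. if P x then 1 else 0 :: nat)"
    by (intro pr_intros)
  moreover have "(if b then 1 else 0 :: nat) = (if \<not> b then 0 else 1)" for b
    by simp
  ultimately show ?thesis
    unfolding decidable_pr_def by simp
qed

lemma decidable_pr_conj [pr_intros]:
  assumes "decidable_pr P" "decidable_pr Q"
  shows "decidable_pr (\<lambda>x. P x \<and> Q x)"
proof -
  have "pr (\<lambda>x. if P x then if Q x then 0 else 1 else 1 :: nat)"
    by (intro pr_intros assms)
  moreover have "(if a then if b then 0 else 1 else 1 :: nat) = (if a \<and> b then 0 else 1)" for a b
    by simp
  ultimately show ?thesis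
    unfolding decidable_pr_def by simp
qed

lemma decidable_pr_le [pr_intros]: "decidable_pr (\<lambda>x. m x \<le> n x)" if "pr m" "pr n"
  for m n :: "_ \<Rightarrow> nat"
  using decidable_pr_zero[OF pr_minus[OF that]] by simp

lemma decidable_pr_less [pr_intros]: "decidable_pr (\<lambda>x. m x < n x)" if "pr m" "pr n"
  for m n :: "_ \<Rightarrow> nat"
  using decidable_pr_not[OF decidable_pr_le[OF that(2,1)]] by (simp add: not_le)

lemma decidable_pr_eq [pr_intros]: "decidable_pr (\<lambda>x. f x = g x)" if "pr f" "pr g"
proof -
  have eq: "f x = g x \<longleftrightarrow> encode (f x) \<le> encode (g x) \<and> encode (g x) \<le> encode (f x)" for x
    by (metis encode_inject le_antisym order_refl)
  show ?thesis
    unfolding eq by (intro pr_intros that)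
qed

text \<open>
  The source of all finite tables below: transition tables, codes of letters and substitutions
  may be arbitrary functions, as only finitely many arguments matter.
\<close>

lemma pr_finite_table:
  assumes "finite D"
  shows "pr (\<lambda>x. if x \<in> D then f x else d)"
  using assms
proof (induction D)
  case empty
  then show ?case by (simp add: pr_const)
next
  case (insert a D)
  have "pr (\<lambda>x. if x = a then f a else if x \<in> D then f x else d)"
    by (intro pr_intros insert.IH)
  moreover have "(\<lambda>x. if x = a then f a else if x \<in> D then f x else d)
      = (\<lambda>x. if x \<in> insert a D then f x else d)"
    by auto
  ultimately show ?case by simp
qed

lemma decidable_pr_finite: "finite D \<Longrightarrow> decidable_pr (\<lambda>x. x \<in> D)"
  unfolding decidable_pr_def by (rule pr_finite_table)

lemma pr_Cons [pr_intros]: "pr f \<Longrightarrow> pr g \<Longrightarrow> pr (\<lambda>x. f x # g x)"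
proof -
  assume "pr f" "pr g"
  then have "pr (\<lambda>x. Suc (encode (f x, g x)))" by (intro pr_intros)
  then show ?thesis by (simp add: pr_def)
qed

lemma pr_case_list [pr_intros]:
  assumes "pr l" "pr f" "pr (\<lambda>p. g (fst p) (fst (snd p)) (snd (snd p)))"
  shows "pr (\<lambda>x. case l x of [] \<Rightarrow> f x | y # ys \<Rightarrow> g x y ys)"
proof -
  have eq: "(case l x of [] \<Rightarrow> f x | y # ys \<Rightarrow> g x y ys) =
    (if encode (l x) = 0 then f x else
      (\<lambda>p. g (fst p) (fst (snd p)) (snd (snd p))) (x, decode (encode (l x) - Suc 0)))" for x
    by (cases "l x") (simp_all flip: encode_pair)
  show ?thesis
    unfolding eq
    by (intro pr_if_zero pr_intros assms pr_comp[OF assms(3)] pr_pred)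
qed

text \<open>
  The code of a list bounds its length, so a loop through the list can be
  run \<open>encode xs\<close> times without computing the length first.
\<close>

lemma length_le_encode: "length xs \<le> encode xs"
  by (induction xs) (auto intro: order_trans[OF _ le_prod_encode_2])

lemma pr_fold [pr_intros]:
  assumes f: "pr (\<lambda>p. f (fst p) (fst (snd p)) (snd (snd p)))" and l: "pr l" and a: "pr a"
  shows "pr (\<lambda>x. fold (f x) (l x) (a x))"
proof -
  let ?f = "\<lambda>x q. case fst q of [] \<Rightarrow> q | y # ys \<Rightarrow> (ys, f x y (snd q))"
  have "length ys \<le> k \<Longrightarrow> snd ((?f x ^^ k) (ys, b)) = fold (f x) ys b" for x k ys b
  proof (induction k arbitrary: ys b)
    case (Suc k)
    show ?case
    proof (cases ys)
      case Nil
      moreover have "(?f x ^^ i) ([], b) = ([], b)" for i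
        by (induction i) simp_all
      ultimately show ?thesis by (simp only: fold_simps snd_conv)
    next
      case (Cons y ys')
      then show ?thesis using Suc.IH[of ys' "f x y b"] Suc.prems
        by (simp add: funpow_Suc_right del: funpow.simps)
    qed
  qed simp
  then have eq: "fold (f x) (l x) (a x) = snd ((?f x ^^ encode (l x)) (l x, a x))" for x
    using length_le_encode[of "l x"] by simp
  have "pr (\<lambda>p. f (fst (fst p)) (fst (snd p)) (snd (snd (fst p))))"
    using pr_comp[OF f, of "\<lambda>p. (fst (fst p), fst (snd p), snd (snd (fst p)))"] by (simp add: pr_intros)
  then show ?thesis
    unfolding eq by (intro pr_intros l a)
qed

lemma pr_rev [pr_intros]: "pr l \<Longrightarrow> pr (\<lambda>x. rev (l x))"
  unfolding rev_conv_fold by (intro pr_intros)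

lemma pr_foldr [pr_intros]:
  assumes "pr (\<lambda>p. f (fst p) (fst (snd p)) (snd (snd p)))" "pr l" "pr a"
  shows "pr (\<lambda>x. foldr (f x) (l x) (a x))"
  unfolding foldr_conv_fold by (intro pr_intros assms)

lemma append_foldr: "xs @ ys = foldr (#) xs ys"
  by (induction xs) auto

lemma pr_append [pr_intros]: "pr l \<Longrightarrow> pr l' \<Longrightarrow> pr (\<lambda>x. l x @ l' x)"
  unfolding append_foldr by (intro pr_intros)

lemma pr_map [pr_intros]:
  assumes "pr (\<lambda>p. f (fst p) (snd p))" "pr l"
  shows "pr (\<lambda>x. map (f x) (l x))"
proof -
  have eq: "map g xs = foldr (\<lambda>y ys. g y # ys) xs []" for g :: "'b \<Rightarrow> 'c" and xs
    by (induction xs) auto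
  show ?thesis
    unfolding eq by (intro pr_intros assms pr_uncurry[OF assms(1)])
qed

lemma pr_concat [pr_intros]: "pr l \<Longrightarrow> pr (\<lambda>x. concat (l x))"
  unfolding concat_conv_foldr by (intro pr_intros)

lemma decidable_pr_list_all [pr_intros]:
  assumes "decidable_pr (\<lambda>p. P (fst p) (snd p))" "pr l"
  shows "decidable_pr (\<lambda>x. \<forall>y\<in>set (l x). P x y)"
proof -
  have eq: "(if \<forall>y\<in>set ys. P x y then 0 else 1) =
    foldr (\<lambda>y (b::nat). if P x y then b else 1) ys 0" for x ys
    by (induction ys) auto
  have P: "decidable_pr (\<lambda>p :: 'a \<times> 'b \<times> nat. P (fst p) (fst (snd p)))"
    using decidable_pr_comp[OF assms(1) pr_Pair[OF pr_fst[OF pr_id] pr_fst[OF pr_snd[OF pr_id]]]]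
    by simp
  show ?thesis
    unfolding decidable_pr_def eq by (intro pr_intros P assms(2))
qed

lemma pr_zip [pr_intros]:
  fixes l :: "'c::encodable \<Rightarrow> 'a::encodable list" and l' :: "'c \<Rightarrow> 'b::encodable list"
  assumes "pr l" "pr l'"
  shows "pr (\<lambda>x. zip (l x) (l' x))"
proof -
  let ?f = "\<lambda>y q. case snd q of [] \<Rightarrow> q | z # zs \<Rightarrow> ((y, z) # fst q, zs)"
  have "rev (fst (fold ?f ys (r, zs))) = rev r @ zip ys zs" for ys :: "'a list" and zs :: "'b list" and r
  proof (induction ys arbitrary: r zs)
    case (Cons y ys)
    show ?case
    proof (cases zs)
      case Nil
      moreover have "fold ?f ys (r, []) = (r, [])" by (induction ys) auto
      ultimately show ?thesis by simp
    next
      case (Cons z zs')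
      with Cons.IH show ?thesis by simp
    qed
  qed simp
  then have eq: "zip ys zs = rev (fst (fold ?f ys ([], zs)))" for ys :: "'a list" and zs :: "'b list"
    by simp
  show ?thesis
    unfolding eq by (intro pr_intros assms)
qed

section \<open>Register programs with an input and output tape\<close>

text \<open>
  Programs act on infinitely many registers and on the tape \<open>0\<close> of a machine, which
  serves for input and output only. \<open>Loop r c\<close> means: as long as the register \<open>r\<close> is positive,
  decrement it and run \<open>c\<close>; here \<open>c\<close> may set \<open>r\<close> anew, which yields unbounded search.
  \<open>IfZero r c d\<close> decrements \<open>r\<close> before it runs \<open>d\<close>, so that no separate decrement is needed.
\<close>

datatype 'l com =
    Skip
  | Inc nat
  | Act "'l symbol \<Rightarrow> 'l symbol \<times> move"
  | Seq "'l com" "'l com"  (infixr ";;" 60)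
  | Loop nat "'l com"
  | IfZero nat "'l com" "'l com"
  | IfSym "'l symbol \<Rightarrow> bool" "'l com" "'l com"

type_synonym 'l store = "'l tape \<times> (nat \<Rightarrow> nat)"

inductive exec :: "'l com \<Rightarrow> 'l store \<Rightarrow> 'l store \<Rightarrow> bool" where
  exec_Skip: "exec Skip x x"
| exec_Inc: "exec (Inc r) (t, s) (t, s(r := Suc (s r)))"
| exec_Act: "exec (Act f) (t, s) (act (f (read_symbol t)) t, s)"
| exec_Seq: "exec c x y \<Longrightarrow> exec d y z \<Longrightarrow> exec (c ;; d) x z"
| exec_Loop_0: "s r = 0 \<Longrightarrow> exec (Loop r c) (t, s) (t, s)"
| exec_Loop_Suc: "s r = Suc n \<Longrightarrow> exec c (t, s(r := n)) y \<Longrightarrow> exec (Loop r c) y z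
    \<Longrightarrow> exec (Loop r c) (t, s) z"
| exec_IfZero_0: "s r = 0 \<Longrightarrow> exec c (t, s) y \<Longrightarrow> exec (IfZero r c d) (t, s) y"
| exec_IfZero_Suc: "s r = Suc n \<Longrightarrow> exec d (t, s(r := n)) y \<Longrightarrow> exec (IfZero r c d) (t, s) y"
| exec_IfSym_True: "P (read_symbol t) \<Longrightarrow> exec c (t, s) y \<Longrightarrow> exec (IfSym P c d) (t, s) y"
| exec_IfSym_False: "\<not> P (read_symbol t) \<Longrightarrow> exec d (t, s) y \<Longrightarrow> exec (IfSym P c d) (t, s) y"

lemma exec_Loop_stop: "s r = 0 \<Longrightarrow> s' = s \<Longrightarrow> exec (Loop r c) (t, s) (t, s')"
  by (simp add: exec_Loop_0)

text \<open>
  What a program can write on tape \<open>0\<close>; the tape alphabet of the compiled machine must be closed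
  under these functions.
\<close>

primrec acts :: "'l com \<Rightarrow> ('l symbol \<Rightarrow> 'l symbol \<times> move) set" where
  "acts Skip = {}"
| "acts (Inc r) = {}"
| "acts (Act f) = {f}"
| "acts (c ;; d) = acts c \<union> acts d"
| "acts (Loop r c) = acts c"
| "acts (IfZero r c d) = acts c \<union> acts d"
| "acts (IfSym P c d) = acts c \<union> acts d"

primrec width :: "'l com \<Rightarrow> nat" where
  "width Skip = 0"
| "width (Inc r) = Suc r"
| "width (Act f) = 0"
| "width (c ;; d) = max (width c) (width d)"
| "width (Loop r c) = max (Suc r) (width c)"
| "width (IfZero r c d) = max (Suc r) (max (width c) (width d))"
| "width (IfSym P c d) = max (width c) (width d)"

section \<open>Register programs for primitive recursive functions\<close>

definition move_reg :: "nat \<Rightarrow> nat \<Rightarrow> 'l com" where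
  "move_reg a b = Loop a (Inc b)"

lemma exec_move_reg:
  "a \<noteq> b \<Longrightarrow> exec (move_reg a b) (t, s) (t, s(a := 0, b := s b + s a))"
proof (induction "s a" arbitrary: s)
  case 0
  then show ?case unfolding move_reg_def by (intro exec_Loop_stop) (auto simp: fun_eq_iff)
next
  case (Suc n)
  let ?s = "s(a := n, b := Suc (s b))"
  have "exec (move_reg a b) (t, ?s) (t, ?s(a := 0, b := ?s b + ?s a))"
    using Suc by (intro Suc.hyps) auto
  moreover have "?s(a := 0, b := ?s b + ?s a) = s(a := 0, b := s b + s a)"
    using Suc by auto
  moreover have "exec (Inc b) (t, s(a := n)) (t, ?s)"
    using exec_Inc[of b t "s(a := n)"] Suc.prems by simp
  ultimately show ?case
    using Suc.hyps(2) unfolding move_reg_def by (metis exec_Loop_Suc)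
qed

definition copy_reg :: "nat \<Rightarrow> nat \<Rightarrow> nat \<Rightarrow> 'l com" where
  "copy_reg a b d = Loop a (Inc b ;; Inc d) ;; move_reg d a"

lemma exec_copy_reg:
  assumes "distinct [a, b, d]" "s d = 0"
  shows "exec (copy_reg a b d) (t, s) (t, s(b := s b + s a))"
proof -
  have "exec (Loop a (Inc b ;; Inc d)) (t, s) (t, s(a := 0, b := s b + s a, d := s d + s a))" for s
  proof (induction "s a" arbitrary: s)
    case 0
    then show ?case by (intro exec_Loop_stop) (auto simp: fun_eq_iff)
  next
    case (Suc n)
    let ?s = "s(a := n, b := Suc (s b), d := Suc (s d))"
    have "exec (Loop a (Inc b ;; Inc d)) (t, ?s) (t, ?s(a := 0, b := ?s b + ?s a, d := ?s d + ?s a))"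
      using Suc assms by (intro Suc.hyps) auto
    moreover have "?s(a := 0, b := ?s b + ?s a, d := ?s d + ?s a)
        = s(a := 0, b := s b + s a, d := s d + s a)"
      using Suc assms by (auto simp: fun_eq_iff)
    moreover have "exec (Inc b ;; Inc d) (t, s(a := n)) (t, ?s)"
      using exec_Seq[OF exec_Inc[of b t "s(a := n)"] exec_Inc[of d]] assms by simp
    ultimately show ?case
      using Suc.hyps(2) by (metis exec_Loop_Suc)
  qed
  then have "exec (copy_reg a b d) (t, s)
      (t, s(a := 0, b := s b + s a, d := s a, d := 0, a := s a))"
    unfolding copy_reg_def
    using assms exec_move_reg[of d a t "s(a := 0, b := s b + s a, d := s a)"]
    by (auto intro!: exec_Seq)
  moreover have "s(a := 0, b := s b + s a, d := s a, d := 0, a := s a) = s(b := s b + s a)"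
    using assms by (auto simp: fun_eq_iff)
  ultimately show ?thesis by simp
qed

definition clear_reg :: "nat \<Rightarrow> 'l com" where
  "clear_reg a = Loop a Skip"

lemma exec_clear_reg: "exec (clear_reg a) (t, s) (t, s(a := 0))"
proof (induction "s a" arbitrary: s)
  case 0
  then show ?case unfolding clear_reg_def by (intro exec_Loop_stop) (auto simp: fun_eq_iff)
next
  case (Suc n)
  from Suc(1)[of "s(a := n)"] have "exec (clear_reg a) (t, s(a := n)) (t, s(a := 0))" by simp
  with Suc(2) show ?case
    unfolding clear_reg_def by (metis exec_Loop_Suc exec_Skip)
qed

definition swap_reg :: "nat \<Rightarrow> nat \<Rightarrow> nat \<Rightarrow> 'l com" where
  "swap_reg a b d = move_reg a d ;; move_reg b a ;; move_reg d b"

lemma exec_swap_reg: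
  assumes "distinct [a, b, d]" "s d = 0"
  shows "exec (swap_reg a b d) (t, s) (t, s(a := s b, b := s a))"
proof -
  have "exec (swap_reg a b d) (t, s)
      (t, s(a := 0, d := s a, b := 0, a := s b, d := 0, b := s a))"
    unfolding swap_reg_def
    using assms exec_move_reg[of a d t s] exec_move_reg[of b a t "s(a := 0, d := s a)"]
      exec_move_reg[of d b t "s(a := 0, d := s a, b := 0, a := s b)"]
    by (auto intro!: exec_Seq)
  moreover have "s(a := 0, d := s a, b := 0, a := s b, d := 0, b := s a) = s(a := s b, b := s a)"
    using assms by (auto simp: fun_eq_iff)
  ultimately show ?thesis by simp
qed

text \<open>
  With \<open>m\<close> and \<open>n\<close> in the registers \<open>b\<close> and \<open>b + 1\<close>, the program forms \<open>m + n\<close>, then adds its triangle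
  number to \<open>m\<close>, which is the Cantor pairing \<open>triangle (m + n) + m\<close>.
\<close>

definition pair_regs :: "nat \<Rightarrow> 'l com" where
  "pair_regs b =
     Loop b (Inc (b + 1) ;; Inc (b + 2)) ;;
     Loop (b + 1) (Inc (b + 2) ;; copy_reg (b + 1) (b + 2) (b + 3)) ;;
     move_reg (b + 2) b"

lemma exec_pair_regs:
  assumes "\<And>i. i > b + 1 \<Longrightarrow> s i = 0"
  shows "exec (pair_regs b) (t, s) (t, s(b := prod_encode (s b, s (b + 1)), b + 1 := 0))"
proof -
  have 1: "exec (Loop b (Inc (b + 1) ;; Inc (b + 2))) (t, s)
      (t, s(b := 0, b + 1 := s b + s (b + 1), b + 2 := s (b + 2) + s b))" for s
  proof (induction "s b" arbitrary: s)
    case 0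
    then show ?case by (intro exec_Loop_stop) (auto simp: fun_eq_iff)
  next
    case (Suc n)
    let ?s = "s(b := n, b + 1 := Suc (s (b + 1)), b + 2 := Suc (s (b + 2)))"
    have "exec (Loop b (Inc (b + 1) ;; Inc (b + 2))) (t, ?s)
        (t, ?s(b := 0, b + 1 := ?s b + ?s (b + 1), b + 2 := ?s (b + 2) + ?s b))"
      using Suc by (intro Suc.hyps) auto
    moreover have "?s(b := 0, b + 1 := ?s b + ?s (b + 1), b + 2 := ?s (b + 2) + ?s b)
        = s(b := 0, b + 1 := s b + s (b + 1), b + 2 := s (b + 2) + s b)"
      using Suc by (auto simp: fun_eq_iff)
    moreover have "exec (Inc (b + 1) ;; Inc (b + 2)) (t, s(b := n)) (t, ?s)"
      using exec_Seq[OF exec_Inc[of "b + 1" t "s(b := n)"] exec_Inc[of "b + 2"]] by simp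
    ultimately show ?case
      using Suc.hyps(2) by (metis exec_Loop_Suc)
  qed
  have 2: "exec (Loop (b + 1) (Inc (b + 2) ;; copy_reg (b + 1) (b + 2) (b + 3))) (t, s)
      (t, s(b + 1 := 0, b + 2 := s (b + 2) + triangle (s (b + 1))))" if "s (b + 3) = 0" for s
    using that
  proof (induction "s (b + 1)" arbitrary: s)
    case 0
    then show ?case by (intro exec_Loop_stop) (auto simp: fun_eq_iff)
  next
    case (Suc n)
    let ?s = "s(b + 1 := n, b + 2 := s (b + 2) + Suc n)"
    have "exec (Loop (b + 1) (Inc (b + 2) ;; copy_reg (b + 1) (b + 2) (b + 3))) (t, ?s)
        (t, ?s(b + 1 := 0, b + 2 := ?s (b + 2) + triangle (?s (b + 1))))"
      using Suc by (intro Suc.hyps) auto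
    moreover have "?s(b + 1 := 0, b + 2 := ?s (b + 2) + triangle (?s (b + 1)))
        = s(b + 1 := 0, b + 2 := s (b + 2) + triangle (s (b + 1)))"
      using Suc(2)[symmetric] by (auto simp: fun_eq_iff)
    moreover have "exec (Inc (b + 2) ;; copy_reg (b + 1) (b + 2) (b + 3)) (t, s(b + 1 := n)) (t, ?s)"
      using exec_Seq[OF exec_Inc[of "b + 2" t "s(b + 1 := n)"]
          exec_copy_reg[of "b + 1" "b + 2" "b + 3"]] Suc.prems
      by simp
    ultimately show ?case
      using Suc.hyps(2) by (metis exec_Loop_Suc)
  qed
  let ?s1 = "s(b := 0, b + 1 := s b + s (b + 1), b + 2 := s (b + 2) + s b)"
  let ?s2 = "?s1(b + 1 := 0, b + 2 := ?s1 (b + 2) + triangle (?s1 (b + 1)))"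
  let ?s3 = "?s2(b + 2 := 0, b := ?s2 b + ?s2 (b + 2))"
  have "exec (pair_regs b) (t, s) (t, ?s3)"
    unfolding pair_regs_def
    by (rule exec_Seq[OF 1 exec_Seq[OF 2 exec_move_reg]]) (use assms in auto)
  moreover have "?s3 = s(b := prod_encode (s b, s (b + 1)), b + 1 := 0)"
    using assms by (auto simp: fun_eq_iff prod_encode_def)
  ultimately show ?thesis by simp
qed

text \<open>
  Decoding walks along the diagonals: counting up from \<open>0\<close>, the decoded pair moves from \<open>(m, n + 1)\<close>
  to \<open>(m + 1, n)\<close>, and from the end \<open>(m, 0)\<close> of a diagonal to the start \<open>(0, m + 1)\<close> of the
  next.
\<close>

definition unpair_reg :: "nat \<Rightarrow> 'l com" where
  "unpair_reg b =
     move_reg b (b + 2) ;;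
     Loop (b + 2) (IfZero (b + 1) (Inc b ;; move_reg b (b + 1)) (Inc b))"

lemma prod_decode_Suc:
  assumes "prod_decode k = (m, n)"
  shows "prod_decode (Suc k) = (case n of 0 \<Rightarrow> (0, Suc m) | Suc n' \<Rightarrow> (Suc m, n'))"
proof -
  have "k = prod_encode (m, n)"
    using assms by (metis prod_decode_inverse)
  then have "Suc k = prod_encode (case n of 0 \<Rightarrow> (0, Suc m) | Suc n' \<Rightarrow> (Suc m, n'))"
    by (cases n) (simp_all add: prod_encode_def)
  then show ?thesis by simp
qed

lemma exec_unpair_reg:
  assumes "\<And>i. i > b \<Longrightarrow> s i = 0"
  shows "exec (unpair_reg b) (t, s)
    (t, s(b := fst (prod_decode (s b)), b + 1 := snd (prod_decode (s b))))"
proof -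
  let ?body = "IfZero (b + 1) (Inc b ;; move_reg b (b + 1)) (Inc b)"
  have 1: "exec (Loop (b + 2) ?body) (t, s)
      (t, s(b := fst (prod_decode (k + s (b + 2))), b + 1 := snd (prod_decode (k + s (b + 2))), b + 2 := 0))"
    if "prod_decode k = (s b, s (b + 1))" for s k
    using that
  proof (induction "s (b + 2)" arbitrary: s k)
    case 0
    then show ?case by (intro exec_Loop_stop) (auto simp: fun_eq_iff)
  next
    case (Suc n)
    define m' n' where "m' = fst (prod_decode (Suc k))" and "n' = snd (prod_decode (Suc k))"
    let ?s = "s(b := m', b + 1 := n', b + 2 := n)"
    have "exec (Loop (b + 2) ?body) (t, ?s)
        (t, ?s(b := fst (prod_decode (Suc k + ?s (b + 2))), b + 1 := snd (prod_decode (Suc k + ?s (b + 2))), b + 2 := 0))"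
      by (intro Suc.hyps) (auto simp: m'_def n'_def)
    moreover have "?s(b := fst (prod_decode (Suc k + ?s (b + 2))), b + 1 := snd (prod_decode (Suc k + ?s (b + 2))), b + 2 := 0)
        = s(b := fst (prod_decode (k + s (b + 2))), b + 1 := snd (prod_decode (k + s (b + 2))), b + 2 := 0)"
      using Suc.hyps(2)[symmetric] by (auto simp: fun_eq_iff)
    moreover have "exec ?body (t, s(b + 2 := n)) (t, ?s)"
    proof (cases "s (b + 1)")
      case 0
      then have "m' = 0" "n' = Suc (s b)"
        using prod_decode_Suc[OF Suc.prems] by (simp_all add: m'_def n'_def)
      then have "?s = s(b + 2 := n, b := 0, b + 1 := Suc (s b))"
        by (auto simp: fun_eq_iff)
      with 0 show ?thesis
        using exec_IfZero_0[OF _ exec_Seq[OF exec_Inc[of b t "s(b + 2 := n)"]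
            exec_move_reg[of b "b + 1"]]]
        by simp
    next
      case (Suc l)
      then have "m' = Suc (s b)" "n' = l"
        using prod_decode_Suc[OF Suc.prems] by (simp_all add: m'_def n'_def)
      then have "?s = s(b + 2 := n, b + 1 := l, b := Suc (s b))"
        by (auto simp: fun_eq_iff)
      with Suc show ?thesis
        using exec_IfZero_Suc[of "s(b + 2 := n)" "b + 1" l, OF _ exec_Inc[of b]] by simp
    qed
    ultimately show ?case
      using Suc.hyps(2) by (metis exec_Loop_Suc)
  qed
  let ?s1 = "s(b := 0, b + 2 := s (b + 2) + s b)"
  let ?s2 = "?s1(b := fst (prod_decode (0 + ?s1 (b + 2))),
    b + 1 := snd (prod_decode (0 + ?s1 (b + 2))), b + 2 := 0)"
  have "prod_decode 0 = (0, 0)"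
    using prod_encode_inverse[of "(0, 0)"] by (simp add: prod_encode_def)
  then have "exec (unpair_reg b) (t, s) (t, ?s2)"
    unfolding unpair_reg_def
    by (intro exec_Seq[OF exec_move_reg 1]) (use assms in auto)
  moreover have "?s2 = s(b := fst (prod_decode (s b)), b + 1 := snd (prod_decode (s b)))"
    using assms by (auto simp: fun_eq_iff)
  ultimately show ?thesis by simp
qed

text \<open>
  A relocatable calling convention: argument and result sit in register \<open>b\<close>, the registers below
  are preserved, those above are scratch space and are zero before and after. A subprogram can thus be
  called one register higher while a value is parked in register \<open>b\<close>.
\<close>

definition computes :: "(nat \<Rightarrow> 'l com) \<Rightarrow> (nat \<Rightarrow> nat) \<Rightarrow> bool" where
  "computes c f \<longleftrightarrow> (\<forall>b. acts (c b) = {} \<and>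
     (\<forall>t s. (\<forall>i>b. s i = 0) \<longrightarrow> exec (c b) (t, s) (t, s(b := f (s b)))))"

lemma acts_basic [simp]:
  "acts (move_reg a b) = {}" "acts (copy_reg a b d) = {}" "acts (clear_reg a) = {}"
  "acts (swap_reg a b d) = {}" "acts (pair_regs a) = {}" "acts (unpair_reg a) = {}"
  by (simp_all add: move_reg_def copy_reg_def clear_reg_def swap_reg_def pair_regs_def unpair_reg_def)

lemma computesI:
  assumes "\<And>b. acts (c b) = {}"
    and "\<And>b t s. (\<And>i. i > b \<Longrightarrow> s i = 0) \<Longrightarrow>
      \<exists>s'. exec (c b) (t, s) (t, s') \<and> s' = s(b := f (s b))"
  shows "computes c f"
  using assms unfolding computes_def by metis

lemma computes_exec:
  assumes "computes c f" "\<And>i. i > b \<Longrightarrow> s i = 0"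
  shows "exec (c b) (t, s) (t, s(b := f (s b)))"
  using assms unfolding computes_def by blast

lemma computes_acts [simp]: "computes c f \<Longrightarrow> acts (c b) = {}"
  unfolding computes_def by blast

lemma exec_funpow_Loop:
  assumes "computes c f" "\<And>i. i > b + 1 \<Longrightarrow> s i = 0"
  shows "exec (Loop b (c (b + 1))) (t, s) (t, s(b := 0, b + 1 := (f ^^ s b) (s (b + 1))))"
  using assms(2)
proof (induction "s b" arbitrary: s)
  case 0
  then show ?case by (intro exec_Loop_stop) (auto simp: fun_eq_iff)
next
  case (Suc n)
  let ?s = "s(b := n, b + 1 := f (s (b + 1)))"
  have "exec (c (b + 1)) (t, s(b := n)) (t, ?s)"
    using computes_exec[OF assms(1), of "b + 1" "s(b := n)" t] Suc.prems by simp
  moreover have "exec (Loop b (c (b + 1))) (t, ?s)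
      (t, ?s(b := 0, b + 1 := (f ^^ ?s b) (?s (b + 1))))"
    using Suc.prems by (intro Suc.hyps) auto
  moreover have "?s(b := 0, b + 1 := (f ^^ ?s b) (?s (b + 1)))
      = s(b := 0, b + 1 := (f ^^ s b) (s (b + 1)))"
    using Suc.hyps(2)[symmetric] by (auto simp: fun_eq_iff funpow_swap1)
  ultimately show ?case
    using Suc.hyps(2) by (metis exec_Loop_Suc)
qed

text \<open>
  For a pair, the argument is copied upwards, the first function is run on the copy, and the result
  is swapped with the argument, so that the scratch space is clean for the second function.
\<close>

lemma prim_rec_computable:
  assumes "prim_rec f"
  shows "\<exists>c :: nat \<Rightarrow> 'l com. computes c f"
  using assms
proof induction
  case prim_rec_zero
  have "computes clear_reg (\<lambda>n. 0)"
    by (rule computesI) (auto intro: exec_clear_reg)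
  then show ?case by blast
next
  case prim_rec_Suc
  have "computes Inc Suc"
    by (rule computesI) (auto intro: exec_Inc)
  then show ?case by blast
next
  case prim_rec_fst
  have "computes (\<lambda>b. unpair_reg b ;; clear_reg (b + 1)) (\<lambda>n. fst (prod_decode n))"
    by (rule computesI, simp, intro exI conjI, rule exec_Seq[OF exec_unpair_reg exec_clear_reg])
      (auto simp: fun_eq_iff)
  then show ?case by blast
next
  case prim_rec_snd
  have "computes (\<lambda>b. unpair_reg b ;; clear_reg b ;; move_reg (b + 1) b) (\<lambda>n. snd (prod_decode n))"
    by (rule computesI, simp, intro exI conjI,
        rule exec_Seq[OF exec_unpair_reg exec_Seq[OF exec_clear_reg exec_move_reg]])
      (auto simp: fun_eq_iff)
  then show ?case by blast
next
  case (prim_rec_pair f g)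
  then obtain c d :: "nat \<Rightarrow> 'l com" where c: "computes c f" and d: "computes d g" by blast
  have "computes (\<lambda>b. copy_reg b (b + 1) (b + 2) ;; c (b + 1) ;; swap_reg b (b + 1) (b + 2) ;;
      d (b + 1) ;; pair_regs b) (\<lambda>n. prod_encode (f n, g n))"
  proof (rule computesI)
    fix b and t :: "'l tape" and s :: "nat \<Rightarrow> nat"
    assume s: "\<And>i. i > b \<Longrightarrow> s i = 0"
    have 1: "exec (copy_reg b (b + 1) (b + 2)) (t, s) (t, s(b + 1 := s b))"
      using exec_copy_reg[of b "b + 1" "b + 2" s t] s by simp
    have 2: "exec (c (b + 1)) (t, s(b + 1 := s b)) (t, s(b + 1 := f (s b)))"
      using computes_exec[OF c, of "b + 1" "s(b + 1 := s b)"] s by simp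
    have 3: "exec (swap_reg b (b + 1) (b + 2)) (t, s(b + 1 := f (s b)))
        (t, s(b := f (s b), b + 1 := s b))"
      using exec_swap_reg[of b "b + 1" "b + 2" "s(b + 1 := f (s b))" t] s
      by (simp add: fun_upd_twist)
    have 4: "exec (d (b + 1)) (t, s(b := f (s b), b + 1 := s b)) (t, s(b := f (s b), b + 1 := g (s b)))"
      using computes_exec[OF d, of "b + 1" "s(b := f (s b), b + 1 := s b)"] s by simp
    have "\<exists>s'. exec (pair_regs b) (t, s(b := f (s b), b + 1 := g (s b))) (t, s') \<and>
        s' = s(b := prod_encode (f (s b), g (s b)))"
      by (intro exI conjI, rule exec_pair_regs) (use s in \<open>auto simp: fun_eq_iff\<close>)
    with 1 2 3 4 show "\<exists>s'. exec (copy_reg b (b + 1) (b + 2) ;; c (b + 1) ;;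
        swap_reg b (b + 1) (b + 2) ;; d (b + 1) ;; pair_regs b) (t, s) (t, s') \<and>
        s' = s(b := prod_encode (f (s b), g (s b)))"
      by (blast intro: exec_Seq)
  qed (use c d in simp)
  then show ?case by blast
next
  case (prim_rec_comp f g)
  then obtain c d :: "nat \<Rightarrow> 'l com" where c: "computes c f" and d: "computes d g" by blast
  have "computes (\<lambda>b. d b ;; c b) (\<lambda>n. f (g n))"
  proof (rule computesI)
    fix b and t :: "'l tape" and s :: "nat \<Rightarrow> nat"
    assume s: "\<And>i. i > b \<Longrightarrow> s i = 0"
    show "\<exists>s'. exec (d b ;; c b) (t, s) (t, s') \<and> s' = s(b := f (g (s b)))"
      by (intro exI conjI, rule exec_Seq[OF computes_exec[OF d] computes_exec[OF c]])
        (use s in auto)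
  qed (use c d in simp)
  then show ?case by blast
next
  case (prim_rec_iter f)
  then obtain c :: "nat \<Rightarrow> 'l com" where c: "computes c f" by blast
  have "computes (\<lambda>b. unpair_reg b ;; swap_reg b (b + 1) (b + 2) ;; Loop b (c (b + 1)) ;;
      move_reg (b + 1) b) (\<lambda>n. (f ^^ snd (prod_decode n)) (fst (prod_decode n)))"
  proof (rule computesI)
    fix b and t :: "'l tape" and s :: "nat \<Rightarrow> nat"
    assume s: "\<And>i. i > b \<Longrightarrow> s i = 0"
    show "\<exists>s'. exec (unpair_reg b ;; swap_reg b (b + 1) (b + 2) ;; Loop b (c (b + 1)) ;;
      move_reg (b + 1) b) (t, s) (t, s') \<and>
      s' = s(b := (f ^^ snd (prod_decode (s b))) (fst (prod_decode (s b))))"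
      by (intro exI conjI, rule exec_Seq[OF exec_unpair_reg exec_Seq[OF exec_swap_reg
              exec_Seq[OF exec_funpow_Loop[OF c] exec_move_reg]]])
        (use s in \<open>auto simp: fun_eq_iff\<close>)
  qed (use c in simp)
  then show ?case by blast
qed

lemma pr_computable:
  assumes "pr f"
  obtains c :: "nat \<Rightarrow> 'l com" where "computes c (\<lambda>n. encode (f (decode n)))"
  using prim_rec_computable assms unfolding pr_def by blast

section \<open>Compiling register programs to Turing machines\<close>

text \<open>
  A program \<open>c\<close> becomes a block of \<open>len c\<close> consecutive states entered at its first state and left
  to the state just after its last one. In a loop, the state \<open>0\<close> tests the register and the last
  state jumps back; in a conditional, one state after the first branch jumps over the second branch.
\<close>

primrec len :: "'l com \<Rightarrow> nat" where
  "len Skip = 0"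
| "len (Inc r) = 1"
| "len (Act f) = 1"
| "len (c ;; d) = len c + len d"
| "len (Loop r c) = len c + 2"
| "len (IfZero r c d) = len c + 2 + len d"
| "len (IfSym P c d) = len c + 2 + len d"

definition keep :: "'l symbol list \<Rightarrow> ('l symbol \<times> move) list" where
  "keep ss = map (\<lambda>a. (a, Stay)) ss"

text \<open>
  Register \<open>r\<close> lives on the tape \<open>r + 1\<close>.
\<close>

definition move_head :: "nat \<Rightarrow> move \<Rightarrow> 'l symbol list \<Rightarrow> ('l symbol \<times> move) list" where
  "move_head r d ss = (keep ss)[Suc r := (ss ! Suc r, d)]"

definition at_zero :: "nat \<Rightarrow> 'l symbol list \<Rightarrow> bool" where
  "at_zero r ss \<longleftrightarrow> ss ! Suc r = Aux 0"

text \<open>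
  States are relative to the start of the block, so that blocks can be placed anywhere by adding
  an offset.
\<close>

primrec transition :: "'l com \<Rightarrow> nat \<Rightarrow> 'l symbol list \<Rightarrow> nat \<times> ('l symbol \<times> move) list" where
  "transition Skip q ss = (q, keep ss)"
| "transition (Inc r) q ss = (1, move_head r MoveRight ss)"
| "transition (Act f) q ss = (1, (keep ss)[0 := f (ss ! 0)])"
| "transition (c ;; d) q ss =
    (if q < len c then transition c q ss else apfst ((+) (len c)) (transition d (q - len c) ss))"
| "transition (Loop r c) q ss =
    (if q = 0 then if at_zero r ss then (len c + 2, keep ss) else (1, move_head r MoveLeft ss)
     else if q \<le> len c then apfst ((+) 1) (transition c (q - 1) ss)
     else (0, keep ss))"
| "transition (IfZero r c d) q ss =
    (if q = 0 then if at_zero r ss then (1, keep ss) else (len c + 2, move_head r MoveLeft ss)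
     else if q \<le> len c then apfst ((+) 1) (transition c (q - 1) ss)
     else if q = len c + 1 then (len c + 2 + len d, keep ss)
     else apfst ((+) (len c + 2)) (transition d (q - (len c + 2)) ss))"
| "transition (IfSym P c d) q ss =
    (if q = 0 then (if P (ss ! 0) then 1 else len c + 2, keep ss)
     else if q \<le> len c then apfst ((+) 1) (transition c (q - 1) ss)
     else if q = len c + 1 then (len c + 2 + len d, keep ss)
     else apfst ((+) (len c + 2)) (transition d (q - (len c + 2)) ss))"

definition code_at :: "('l, 'm) tm_scheme \<Rightarrow> nat \<Rightarrow> 'l com \<Rightarrow> bool" where
  "code_at M l c \<longleftrightarrow> (\<forall>q<len c. l + q \<notin> final M \<and>
     (\<forall>ss. delta M (l + q) ss = apfst ((+) l) (transition c q ss)))"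

lemma code_atD:
  "code_at M l c \<Longrightarrow> q < len c \<Longrightarrow> l + q \<notin> final M"
  "code_at M l c \<Longrightarrow> q < len c \<Longrightarrow> delta M (l + q) ss = apfst ((+) l) (transition c q ss)"
  by (auto simp: code_at_def)

lemma apfst_plus: "apfst ((+) l) (apfst ((+) k) p) = apfst ((+) (l + k)) p" for l k :: nat
  by (cases p) simp

lemma code_at_sub:
  assumes "code_at M l c"
    and "\<And>q. q < len d \<Longrightarrow> k + q < len c"
    and "\<And>q ss. q < len d \<Longrightarrow> transition c (k + q) ss = apfst ((+) k) (transition d q ss)"
  shows "code_at M (l + k) d"
  unfolding code_at_def
proof (intro allI impI conjI)
  fix q ss
  assume "q < len d"
  with assms(2) have "k + q < len c" by blast
  with code_atD[OF assms(1) this] assms(3)[OF \<open>q < len d\<close>]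
  show "l + k + q \<notin> final M" "delta M (l + k + q) ss = apfst ((+) (l + k)) (transition d q ss)"
    by (simp_all add: add.assoc apfst_plus)
qed

lemma code_at_Seq:
  assumes "code_at M l (c ;; d)"
  shows "code_at M l c" "code_at M (l + len c) d"
proof -
  show "code_at M l c"
    using code_at_sub[OF assms, of c 0] by (simp add: apfst_def map_prod_def split_beta)
  show "code_at M (l + len c) d"
    by (rule code_at_sub[OF assms]) simp_all
qed

lemma code_at_Loop: "code_at M l (Loop r c) \<Longrightarrow> code_at M (l + 1) c"
  by (rule code_at_sub) auto

lemma code_at_IfZero:
  assumes "code_at M l (IfZero r c d)"
  shows "code_at M (l + 1) c" "code_at M (l + (len c + 2)) d"
  by (rule code_at_sub[OF assms]; simp)+

lemma code_at_IfSym: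
  assumes "code_at M l (IfSym P c d)"
  shows "code_at M (l + 1) c" "code_at M (l + (len c + 2)) d"
  by (rule code_at_sub[OF assms]; simp)+

text \<open>
  A register tape carries a single mark at cell \<open>0\<close> and never changes: the value of the register is
  the position of the head, and the mark serves to recognise the value zero.
\<close>

definition counter_contents :: "int \<Rightarrow> 'l symbol" where
  "counter_contents i = (if i = 0 then Aux 0 else Blank)"

definition config :: "nat \<Rightarrow> nat \<Rightarrow> 'l store \<Rightarrow> 'l config" where
  "config K q x = (q, fst x # map (\<lambda>r. (counter_contents, int (snd x r))) [0..<K])"

lemma fst_config [simp]: "fst (config K q x) = q"
  by (simp add: config_def)

text \<open>
  Keeping track of the states on the way matters for enumerators, which must not pass through
  the printing state at the wrong time.
\<close>

inductive path :: "('l, 'm) tm_scheme \<Rightarrow> nat set \<Rightarrow> 'l config \<Rightarrow> 'l config \<Rightarrow> bool"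
  for M A where
  path_refl: "path M A c c"
| path_step: "fst c \<in> A \<Longrightarrow> path M A (step M c) d \<Longrightarrow> path M A c d"

lemma path_trans: "path M A c d \<Longrightarrow> path M A d e \<Longrightarrow> path M A c e"
  by (induction rule: path.induct) (auto intro: path_step)

lemma path_mono: "path M A c d \<Longrightarrow> A \<subseteq> B \<Longrightarrow> path M B c d"
  by (induction rule: path.induct) (auto intro: path.intros)

lemma path_single: "fst c \<in> A \<Longrightarrow> step M c = d \<Longrightarrow> path M A c d"
  by (auto intro: path.intros)

lemma path_funpow:
  "path M A c d \<Longrightarrow> \<exists>n. (step M ^^ n) c = d \<and> (\<forall>i<n. fst ((step M ^^ i) c) \<in> A)"
proof (induction rule: path.induct)
  case (path_refl c)
  show ?case by (rule exI[of _ 0]) simp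
next
  case (path_step c d)
  then obtain n where n: "(step M ^^ n) (step M c) = d" "\<forall>i<n. fst ((step M ^^ i) (step M c)) \<in> A"
    by blast
  have "fst ((step M ^^ i) c) \<in> A" if "i < Suc n" for i
    using that n(2) path_step.hyps(1) by (cases i) (simp_all add: funpow_swap1)
  with n(1) show ?case by (intro exI[of _ "Suc n"]) (simp add: funpow_swap1)
qed

lemma act_keep: "map2 act (keep (map read_symbol ts)) ts = ts"
proof -
  have "act (read_symbol t, Stay) t = t" for t :: "'a tape"
    by (cases t) simp
  then show ?thesis
    by (induction ts) (simp_all add: keep_def)
qed

lemma act_keep_update:
  "map2 act ((keep (map read_symbol ts))[j := a]) ts = ts[j := act a (ts ! j)]"
proof (induction ts arbitrary: j)
  case (Cons t ts)
  have "act (read_symbol t, Stay) t = t" by (cases t) simp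
  moreover have "map2 act (map (\<lambda>a. (a, Stay)) (map read_symbol ts)) ts = ts"
    using act_keep[of ts] by (simp add: keep_def)
  ultimately show ?case
    using Cons.IH by (cases j) (simp_all add: keep_def)
qed (simp add: keep_def)

lemma step_config:
  assumes "q \<notin> final M"
    and "delta M q (map read_symbol (snd (config K q x))) = (q', as)"
  shows "step M (config K q x) = (q', map2 act as (snd (config K q x)))"
  using assms by (simp add: step_def config_def)

lemma step_keep:
  assumes "q \<notin> final M"
    and "delta M q (map read_symbol (snd (config K q x))) = (q', keep (map read_symbol (snd (config K q x))))"
  shows "step M (config K q x) = config K q' x"
  unfolding step_config[OF assms] act_keep by (simp add: config_def)

lemma config_update_reg:
  "r < K \<Longrightarrow> (snd (config K q (t, s)))[Suc r := (counter_contents, int n)] = snd (config K q (t, s(r := n)))"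
  by (auto simp: config_def list_eq_iff_nth_eq nth_list_update nth_Cons split: nat.split)

lemma step_move_head:
  assumes "q \<notin> final M" "r < K" "int n = int (s r) + shift d"
    and "delta M q (map read_symbol (snd (config K q (t, s)))) =
      (q', move_head r d (map read_symbol (snd (config K q (t, s)))))"
  shows "step M (config K q (t, s)) = config K q' (t, s(r := n))"
proof -
  let ?ts = "snd (config K q (t, s))"
  have tape: "?ts ! Suc r = (counter_contents, int (s r))" and len: "Suc r < length ?ts"
    using assms(2) by (simp_all add: config_def)
  then have "act (map read_symbol ?ts ! Suc r, d) (?ts ! Suc r) = (counter_contents, int n)"
    using assms(3) by (simp add: fun_eq_iff)
  then have "step M (config K q (t, s)) = (q', ?ts[Suc r := (counter_contents, int n)])"
    unfolding step_config[OF assms(1,4)] move_head_def act_keep_update by simp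
  then show ?thesis
    unfolding config_update_reg[OF assms(2)] by (simp add: config_def)
qed

lemma at_zero_config: "r < K \<Longrightarrow> at_zero r (map read_symbol (snd (config K q (t, s)))) \<longleftrightarrow> s r = 0"
  by (simp add: at_zero_def config_def counter_contents_def)

lemma read_symbol_config: "map read_symbol (snd (config K q (t, s))) ! 0 = read_symbol t"
  by (simp add: config_def)

text \<open>
  Correctness of the compiler. Every construct is simulated by its test or jump steps and the runs
  of its components, each of which stays inside its own block of states.
\<close>

lemma exec_path:
  assumes "exec c x y" "code_at M l c" "width c \<le> K"
  shows "path M {l..<l + len c} (config K l x) (config K (l + len c) y)"
  using assms
proof (induction arbitrary: l rule: exec.induct)
  case (exec_Skip x)
  then show ?case by (simp add: path_refl)
next
  case (exec_Inc r t s)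
  from code_atD[OF exec_Inc(1), of 0] have "step M (config K l (t, s)) = config K (l + 1) (t, s(r := Suc (s r)))"
    using exec_Inc(2) by (intro step_move_head) auto
  then show ?case by (intro path_single) auto
next
  case (exec_Act f t s)
  let ?ts = "snd (config K l (t, s))"
  from code_atD[OF exec_Act(1), of 0]
  have "step M (config K l (t, s)) = (l + 1, map2 act ((keep (map read_symbol ?ts))[0 := f (read_symbol t)]) ?ts)"
    by (intro step_config) (auto simp: read_symbol_config)
  also have "\<dots> = config K (l + 1) (act (f (read_symbol t)) t, s)"
    unfolding act_keep_update by (simp add: config_def)
  finally show ?case by (intro path_single) auto
next
  case (exec_Seq c x y d z)
  have "path M {l..<l + len c} (config K l x) (config K (l + len c) y)"
    using exec_Seq.IH(1) code_at_Seq(1)[OF exec_Seq.prems(1)] exec_Seq.prems(2) by simp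
  moreover have "path M {l + len c..<l + len c + len d} (config K (l + len c) y) (config K (l + len c + len d) z)"
    using exec_Seq.IH(2) code_at_Seq(2)[OF exec_Seq.prems(1)] exec_Seq.prems(2) by simp
  ultimately have "path M {l..<l + len c + len d} (config K l x) (config K (l + len c + len d) z)"
    by (meson path_mono path_trans ivl_subset le_add1 le_refl)
  then show ?case by (simp add: add.assoc)
next
  case (exec_Loop_0 s r c t)
  then have "step M (config K l (t, s)) = config K (l + (len c + 2)) (t, s)"
    using code_atD[OF exec_Loop_0(2), of 0] by (intro step_keep) (auto simp: at_zero_config)
  then show ?case by (intro path_single) auto
next
  case (exec_Loop_Suc s r n c t y z)
  let ?A = "{l..<l + len (Loop r c)}"
  have "step M (config K l (t, s)) = config K (l + 1) (t, s(r := n))"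
    using code_atD[OF exec_Loop_Suc.prems(1), of 0] exec_Loop_Suc.prems(2) exec_Loop_Suc.hyps(1)
    by (intro step_move_head) (auto simp: at_zero_config)
  then have 1: "path M ?A (config K l (t, s)) (config K (l + 1) (t, s(r := n)))"
    by (intro path_single) auto
  have "path M {l + 1..<l + 1 + len c} (config K (l + 1) (t, s(r := n))) (config K (l + 1 + len c) y)"
    using exec_Loop_Suc.IH(1)[of "l + 1"] code_at_Loop[OF exec_Loop_Suc.prems(1)] exec_Loop_Suc.prems(2) by simp
  then have 2: "path M ?A (config K (l + 1) (t, s(r := n))) (config K (l + 1 + len c) y)"
    by (rule path_mono) auto
  have "step M (config K (l + 1 + len c) y) = config K l y"
    using code_atD[OF exec_Loop_Suc.prems(1), of "1 + len c"] by (intro step_keep) auto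
  then have 3: "path M ?A (config K (l + 1 + len c) y) (config K l y)"
    by (intro path_single) auto
  show ?case
    using 1 2 3 exec_Loop_Suc.IH(2)[OF exec_Loop_Suc.prems] by (meson path_trans)
next
  case (exec_IfZero_0 s r c t y d)
  let ?A = "{l..<l + len (IfZero r c d)}"
  have "step M (config K l (t, s)) = config K (l + 1) (t, s)"
    using code_atD[OF exec_IfZero_0.prems(1), of 0] exec_IfZero_0.prems(2) exec_IfZero_0.hyps(1)
    by (intro step_keep) (auto simp: at_zero_config)
  then have 1: "path M ?A (config K l (t, s)) (config K (l + 1) (t, s))"
    by (intro path_single) auto
  have "path M {l + 1..<l + 1 + len c} (config K (l + 1) (t, s)) (config K (l + 1 + len c) y)"
    using exec_IfZero_0.IH[of "l + 1"] code_at_IfZero(1)[OF exec_IfZero_0.prems(1)] exec_IfZero_0.prems(2) by simp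
  then have 2: "path M ?A (config K (l + 1) (t, s)) (config K (l + 1 + len c) y)"
    by (rule path_mono) auto
  have "step M (config K (l + 1 + len c) y) = config K (l + (len c + 2 + len d)) y"
    using code_atD[OF exec_IfZero_0.prems(1), of "1 + len c"] by (intro step_keep) auto
  then have 3: "path M ?A (config K (l + 1 + len c) y) (config K (l + (len c + 2 + len d)) y)"
    by (intro path_single) auto
  show ?case
    using path_trans[OF 1 path_trans[OF 2 3]] by simp
next
  case (exec_IfZero_Suc s r n d t y c)
  let ?A = "{l..<l + len (IfZero r c d)}"
  have "step M (config K l (t, s)) = config K (l + (len c + 2)) (t, s(r := n))"
    using code_atD[OF exec_IfZero_Suc.prems(1), of 0] exec_IfZero_Suc.prems(2) exec_IfZero_Suc.hyps(1)
    by (intro step_move_head) (auto simp: at_zero_config)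
  then have 1: "path M ?A (config K l (t, s)) (config K (l + (len c + 2)) (t, s(r := n)))"
    by (intro path_single) auto
  have "path M {l + (len c + 2)..<l + (len c + 2) + len d} (config K (l + (len c + 2)) (t, s(r := n)))
      (config K (l + (len c + 2) + len d) y)"
    using exec_IfZero_Suc.IH[of "l + (len c + 2)"] code_at_IfZero(2)[OF exec_IfZero_Suc.prems(1)] exec_IfZero_Suc.prems(2) by simp
  then have 2: "path M ?A (config K (l + (len c + 2)) (t, s(r := n))) (config K (l + (len c + 2) + len d) y)"
    by (rule path_mono) auto
  show ?case
    using path_trans[OF 1 2] by (simp add: add.assoc)
next
  case (exec_IfSym_True P t c s y d)
  let ?A = "{l..<l + len (IfSym P c d)}"
  have "step M (config K l (t, s)) = config K (l + 1) (t, s)"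
    using code_atD[OF exec_IfSym_True.prems(1), of 0] exec_IfSym_True.hyps(1)
    by (intro step_keep) (auto simp: read_symbol_config)
  then have 1: "path M ?A (config K l (t, s)) (config K (l + 1) (t, s))"
    by (intro path_single) auto
  have "path M {l + 1..<l + 1 + len c} (config K (l + 1) (t, s)) (config K (l + 1 + len c) y)"
    using exec_IfSym_True.IH[of "l + 1"] code_at_IfSym(1)[OF exec_IfSym_True.prems(1)] exec_IfSym_True.prems(2) by simp
  then have 2: "path M ?A (config K (l + 1) (t, s)) (config K (l + 1 + len c) y)"
    by (rule path_mono) auto
  have "step M (config K (l + 1 + len c) y) = config K (l + (len c + 2 + len d)) y"
    using code_atD[OF exec_IfSym_True.prems(1), of "1 + len c"] by (intro step_keep) auto
  then have 3: "path M ?A (config K (l + 1 + len c) y) (config K (l + (len c + 2 + len d)) y)"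
    by (intro path_single) auto
  show ?case
    using path_trans[OF 1 path_trans[OF 2 3]] by simp
next
  case (exec_IfSym_False P t d s y c)
  let ?A = "{l..<l + len (IfSym P c d)}"
  have "step M (config K l (t, s)) = config K (l + (len c + 2)) (t, s)"
    using code_atD[OF exec_IfSym_False.prems(1), of 0] exec_IfSym_False.hyps(1)
    by (intro step_keep) (auto simp: read_symbol_config)
  then have 1: "path M ?A (config K l (t, s)) (config K (l + (len c + 2)) (t, s))"
    by (intro path_single) auto
  have "path M {l + (len c + 2)..<l + (len c + 2) + len d} (config K (l + (len c + 2)) (t, s))
      (config K (l + (len c + 2) + len d) y)"
    using exec_IfSym_False.IH[of "l + (len c + 2)"] code_at_IfSym(2)[OF exec_IfSym_False.prems(1)] exec_IfSym_False.prems(2) by simp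
  then have 2: "path M ?A (config K (l + (len c + 2)) (t, s)) (config K (l + (len c + 2) + len d) y)"
    by (rule path_mono) auto
  show ?case
    using path_trans[OF 1 2] by (simp add: add.assoc)
qed

lemma length_keep [simp]: "length (keep ss) = length ss"
  and length_move_head [simp]: "length (move_head r d ss) = length ss"
  by (simp_all add: keep_def move_head_def)

lemma keep_symbols: "set ss \<subseteq> B \<Longrightarrow> fst ` set (keep ss) \<subseteq> B"
  by (auto simp: keep_def)

lemma move_head_symbols:
  "set ss \<subseteq> B \<Longrightarrow> Suc r < length ss \<Longrightarrow> fst ` set (move_head r d ss) \<subseteq> B"
  unfolding move_head_def
  by (auto simp: keep_def dest!: subsetD[OF set_update_subset_insert])

lemma transition_valid:
  assumes "\<And>f a. f \<in> acts c \<Longrightarrow> a \<in> B \<Longrightarrow> fst (f a) \<in> B"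
    and "set ss \<subseteq> B" "width c < length ss"
  shows "q < len c \<Longrightarrow> fst (transition c q ss) \<le> len c \<and> length (snd (transition c q ss)) = length ss \<and>
    fst ` set (snd (transition c q ss)) \<subseteq> B" (is "_ \<Longrightarrow> ?valid c q")
  using assms
proof (induction c arbitrary: q)
  case (Act f)
  have "ss ! 0 \<in> B" using Act.prems(3,4) by (metis subsetD nth_mem width.simps(3))
  then have "fst (f (ss ! 0)) \<in> B" using Act.prems(2) by simp
  then show ?case
    using keep_symbols[OF Act.prems(3)]
      subset_trans[OF image_mono[OF set_update_subset_insert[of "keep ss" 0 "f (ss ! 0)"], of fst]]
    by simp
next
  case (Seq c d)
  have "q < len c \<Longrightarrow> ?valid c q"
    by (rule Seq.IH(1)) (use Seq.prems in auto)
  moreover have "\<not> q < len c \<Longrightarrow> ?valid d (q - len c)"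
    by (rule Seq.IH(2)) (use Seq.prems in auto)
  ultimately show ?case by auto
next
  case (Loop r c)
  have "0 < q \<Longrightarrow> q \<le> len c \<Longrightarrow> ?valid c (q - 1)"
    by (rule Loop.IH) (use Loop.prems in auto)
  then show ?case
    using Loop.prems keep_symbols[OF Loop.prems(3)]
      move_head_symbols[OF Loop.prems(3), of r MoveLeft] by auto
next
  case (IfZero r c d)
  have "0 < q \<Longrightarrow> q \<le> len c \<Longrightarrow> ?valid c (q - 1)"
    by (rule IfZero.IH(1)) (use IfZero.prems in auto)
  moreover have "len c + 1 < q \<Longrightarrow> ?valid d (q - (len c + 2))"
    by (rule IfZero.IH(2)) (use IfZero.prems in auto)
  ultimately show ?case
    using keep_symbols[OF IfZero.prems(3)] move_head_symbols[OF IfZero.prems(3), of r MoveLeft]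
      IfZero.prems(4) by auto
next
  case (IfSym P c d)
  have "0 < q \<Longrightarrow> q \<le> len c \<Longrightarrow> ?valid c (q - 1)"
    by (rule IfSym.IH(1)) (use IfSym.prems in auto)
  moreover have "len c + 1 < q \<Longrightarrow> ?valid d (q - (len c + 2))"
    by (rule IfSym.IH(2)) (use IfSym.prems in auto)
  ultimately show ?case
    using keep_symbols[OF IfSym.prems(3)] by auto
qed (auto simp: keep_symbols move_head_symbols)

section \<open>Enumerators and deciders from programs\<close>

definition init_actions :: "'l symbol list \<Rightarrow> ('l symbol \<times> move) list" where
  "init_actions ss = (ss ! 0, Stay) # map (\<lambda>_. (Aux 0, Stay)) (tl ss)"

text \<open>
  The state \<open>0\<close> puts the marks on the register tapes, the program starts in state \<open>1\<close>. When
  it ends, the machine is in its printing state and restarts the program with the current store.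
\<close>

definition enum_tm :: "'l symbol set \<Rightarrow> 'l com \<Rightarrow> 'l enumerator" where
  "enum_tm B c = \<lparr>num_tapes = Suc (width c), states = {..len c + 1}, tape_alphabet = B,
     initial = 0, final = {},
     delta = (\<lambda>q ss. if q = 0 then (1, init_actions ss)
       else if q \<le> len c then apfst ((+) 1) (transition c (q - 1) ss) else (1, keep ss)),
     printing = len c + 1\<rparr>"

text \<open>
  When the program ends, the verdict is read off register \<open>0\<close>. One spare register tape
  makes sure that register \<open>0\<close> exists.
\<close>

definition dec_tm :: "'l symbol set \<Rightarrow> 'l com \<Rightarrow> 'l decider" where
  "dec_tm B c = \<lparr>num_tapes = Suc (Suc (width c)), states = {..len c + 3}, tape_alphabet = B,
     initial = 0, final = {len c + 2, len c + 3},
     delta = (\<lambda>q ss. if q = 0 then (1, init_actions ss)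
       else if q \<le> len c then apfst ((+) 1) (transition c (q - 1) ss)
       else (if at_zero 0 ss then len c + 2 else len c + 3, keep ss)),
     accepting = {len c + 2}\<rparr>"

lemma init_actions_valid:
  assumes "set ss \<subseteq> B" "Aux 0 \<in> B" "ss \<noteq> []"
  shows "length (init_actions ss) = length ss" "fst ` set (init_actions ss) \<subseteq> B"
  using assms by (cases ss; auto simp: init_actions_def)+

lemma code_at_enum: "code_at (enum_tm B c) 1 c"
  by (auto simp: code_at_def enum_tm_def)

lemma code_at_dec: "code_at (dec_tm B c) 1 c"
  by (auto simp: code_at_def dec_tm_def)

lemma valid_enum_tm:
  assumes "finite B" "Blank \<in> B" "Aux 0 \<in> B" "Letter ` A \<subseteq> B"
    and "\<And>f a. f \<in> acts c \<Longrightarrow> a \<in> B \<Longrightarrow> fst (f a) \<in> B"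
  shows "valid_tm A (enum_tm B c)"
proof -
  have "fst (delta (enum_tm B c) q ss) \<in> states (enum_tm B c) \<and>
      length (snd (delta (enum_tm B c) q ss)) = num_tapes (enum_tm B c) \<and>
      fst ` set (snd (delta (enum_tm B c) q ss)) \<subseteq> B"
    if "ss \<in> lists B" "length ss = Suc (width c)" for q ss
  proof -
    have ss: "set ss \<subseteq> B" "ss \<noteq> []" "width c < length ss"
      using that by auto
    have "0 < q \<Longrightarrow> q \<le> len c \<Longrightarrow> fst (transition c (q - 1) ss) \<le> len c \<and>
        length (snd (transition c (q - 1) ss)) = length ss \<and> fst ` set (snd (transition c (q - 1) ss)) \<subseteq> B"
      by (rule transition_valid) (use assms(5) ss in auto)
    then show ?thesis
      using that(2) init_actions_valid[OF ss(1) assms(3) ss(2)] keep_symbols[OF ss(1)]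
      by (auto simp: enum_tm_def)
  qed
  with assms(1-4) show ?thesis
    unfolding valid_tm_def by (simp add: enum_tm_def)
qed

lemma valid_dec_tm:
  assumes "finite B" "Blank \<in> B" "Aux 0 \<in> B" "Letter ` A \<subseteq> B"
    and "\<And>f a. f \<in> acts c \<Longrightarrow> a \<in> B \<Longrightarrow> fst (f a) \<in> B"
  shows "valid_tm A (dec_tm B c)"
proof -
  have "fst (delta (dec_tm B c) q ss) \<in> states (dec_tm B c) \<and>
      length (snd (delta (dec_tm B c) q ss)) = num_tapes (dec_tm B c) \<and>
      fst ` set (snd (delta (dec_tm B c) q ss)) \<subseteq> B"
    if "ss \<in> lists B" "length ss = Suc (Suc (width c))" for q ss
  proof -
    have ss: "set ss \<subseteq> B" "ss \<noteq> []" "width c < length ss"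
      using that by auto
    have "0 < q \<Longrightarrow> q \<le> len c \<Longrightarrow> fst (transition c (q - 1) ss) \<le> len c \<and>
        length (snd (transition c (q - 1) ss)) = length ss \<and> fst ` set (snd (transition c (q - 1) ss)) \<subseteq> B"
      by (rule transition_valid) (use assms(5) ss in auto)
    then show ?thesis
      using that(2) init_actions_valid[OF ss(1) assms(3) ss(2)] keep_symbols[OF ss(1)]
      by (auto simp: dec_tm_def)
  qed
  with assms(1-4) show ?thesis
    unfolding valid_tm_def by (simp add: dec_tm_def)
qed

lemma step_init:
  assumes "num_tapes M = Suc K" "initial M \<notin> final M"
    and "\<And>ss. delta M (initial M) ss = (q, init_actions ss)"
  shows "step M (start_config M w) = config K q ((word_contents w, 0), \<lambda>_. 0)"
proof -
  have "(word_contents [])(0 := Aux 0) = (counter_contents :: int \<Rightarrow> 'a symbol)"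
    by (auto simp: word_contents_def counter_contents_def)
  moreover have "map2 act (map (\<lambda>_. (Aux 0, Stay)) (replicate n a)) (replicate n (f, 0)) =
      replicate n (f(0 := Aux 0), 0)" for n and a and f :: "int \<Rightarrow> 'a symbol"
    by (induction n) (simp_all add: fun_upd_def)
  ultimately show ?thesis
    using assms
    by (simp add: step_def start_config_def config_def init_actions_def map_replicate_const)
qed

text \<open>
  The program is run over and over, \<open>S n\<close> being the store before round \<open>n\<close>. The printing state is
  entered exactly at the end of each round, because a run of the program stays below it.
\<close>

lemma enum_tm_outputs:
  assumes start: "S 0 = ((word_contents [], 0), \<lambda>_. 0)"
    and exec: "\<And>n. exec c (S n) (S (Suc n))"
  shows "outputs (enum_tm B c) = {w. \<exists>n. fst (fst (S (Suc n))) = word_contents w}"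
proof -
  let ?M = "enum_tm B c"
  let ?p = "len c + 1"
  let ?run = "\<lambda>m. run ?M [] m"
  have p: "printing ?M = ?p" "?p \<notin> final ?M"
    by (simp_all add: enum_tm_def)
  have round_trip: "\<exists>k. (step ?M ^^ k) (config (width c) 1 (S n)) = config (width c) ?p (S (Suc n)) \<and>
      (\<forall>i<k. fst ((step ?M ^^ i) (config (width c) 1 (S n))) \<noteq> ?p)" for n
  proof -
    obtain k where "(step ?M ^^ k) (config (width c) 1 (S n)) = config (width c) ?p (S (Suc n))"
      "\<forall>i<k. fst ((step ?M ^^ i) (config (width c) 1 (S n))) \<in> {1..<?p}"
      using path_funpow[OF exec_path[OF exec[of n] code_at_enum[of B c] order_refl]]
      by (auto simp: add.commute)
    moreover have "?p \<notin> {1..<?p}" by simp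
    ultimately show ?thesis by metis
  qed
  have restart: "step ?M (config (width c) ?p x) = config (width c) 1 x" for x
    by (rule step_keep) (simp_all add: enum_tm_def)
  \<comment> \<open>The invariant at the start of round n: every visit to the printing state so far was the end of
      some round, and each earlier round has had its visit.\<close>
  define printed where
    "printed i j \<longleftrightarrow> ?run i = config (width c) ?p (S (Suc j))" for i j
  have rounds: "\<exists>m\<ge>n. ?run m = config (width c) 1 (S n) \<and>
      (\<forall>i<m. fst (?run i) = ?p \<longrightarrow> (\<exists>j. printed i j)) \<and> (\<forall>j<n. \<exists>i<m. printed i j)" for n
  proof (induction n)
    case 0
    have "?run 1 = config (width c) 1 (S 0)"
      unfolding start run_def using step_init[of ?M "width c" 1 "[]"] by (simp add: enum_tm_def)
    moreover have "fst (?run 0) \<noteq> ?p"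
      by (simp add: run_def start_config_def enum_tm_def)
    ultimately show ?case
      by (intro exI[of _ 1]) simp
  next
    case (Suc n)
    then obtain m where m: "m \<ge> n" "?run m = config (width c) 1 (S n)"
      "\<And>i. i < m \<Longrightarrow> fst (?run i) = ?p \<Longrightarrow> \<exists>j. printed i j"
      "\<And>j. j < n \<Longrightarrow> \<exists>i<m. printed i j"
      by blast
    obtain k where k: "(step ?M ^^ k) (config (width c) 1 (S n)) = config (width c) ?p (S (Suc n))"
      "\<And>i. i < k \<Longrightarrow> fst ((step ?M ^^ i) (config (width c) 1 (S n))) \<noteq> ?p"
      using round_trip by blast
    have shift: "?run (i + m) = (step ?M ^^ i) (config (width c) 1 (S n))" for i
      using m(2) by (simp add: run_def funpow_add)
    have last: "printed (k + m) n"
      unfolding printed_def shift k(1) ..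
    show ?case
    proof (rule exI[of _ "Suc (k + m)"], intro conjI allI impI)
      show "Suc n \<le> Suc (k + m)" using m(1) by simp
      have "?run (Suc (k + m)) = step ?M (?run (k + m))"
        by (simp add: run_def)
      then show "?run (Suc (k + m)) = config (width c) 1 (S (Suc n))"
        unfolding shift k(1) restart .
    next
      fix i
      assume i: "i < Suc (k + m)" "fst (?run i) = ?p"
      show "\<exists>j. printed i j"
      proof (cases "i < m")
        case True
        with m(3) i(2) show ?thesis by blast
      next
        case False
        then have eq: "i - m + m = i" by simp
        then have "fst ((step ?M ^^ (i - m)) (config (width c) 1 (S n))) = ?p"
          using i(2) shift[of "i - m"] by simp
        with k(2) have "\<not> i - m < k" by blast
        with i(1) False have "i = k + m" by linarith
        with last show ?thesis by blast
      qed
    next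
      fix j
      assume "j < Suc n"
      then consider "j = n" | "j < n" by linarith
      then show "\<exists>i<Suc (k + m). printed i j"
      proof cases
        case 1
        with last show ?thesis by (intro exI[of _ "k + m"]) simp
      next
        case 2
        with m(4) obtain i where "i < m" "printed i j" by blast
        then show ?thesis by (intro exI[of _ i]) simp
      qed
    qed
  qed
  have tape: "snd (config K q x) ! 0 = fst x" for K q and x :: "'a store"
    by (simp add: config_def)
  have outputs: "w \<in> outputs ?M \<longleftrightarrow> (\<exists>i. fst (?run i) = ?p \<and> fst (snd (?run i) ! 0) = word_contents w)"
    for w
    by (simp add: outputs_def p)
  show ?thesis
  proof (intro equalityI subsetI)
    fix w
    assume "w \<in> outputs ?M"
    then obtain i where i: "fst (?run i) = ?p" "fst (snd (?run i) ! 0) = word_contents w"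
      unfolding outputs by (elim exE conjE)
    obtain m where m: "m \<ge> Suc i" "\<forall>i<m. fst (?run i) = ?p \<longrightarrow> (\<exists>j. printed i j)"
      using rounds[of "Suc i"] by (elim exE conjE)
    with i(1) have "\<exists>j. printed i j" by simp
    then obtain j where "printed i j" ..
    with i(2) have "fst (fst (S (Suc j))) = word_contents w"
      by (simp add: printed_def tape)
    then show "w \<in> {w. \<exists>n. fst (fst (S (Suc n))) = word_contents w}" by auto
  next
    fix w
    assume "w \<in> {w. \<exists>n. fst (fst (S (Suc n))) = word_contents w}"
    then obtain n where n: "fst (fst (S (Suc n))) = word_contents w" by auto
    obtain m where "\<forall>j<Suc n. \<exists>i<m. printed i j"
      using rounds[of "Suc n"] by (elim exE conjE)
    then obtain i where "printed i n" by auto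
    with n show "w \<in> outputs ?M"
      unfolding outputs printed_def by (intro exI[of _ i]) (simp add: tape)
  qed
qed

lemma dec_tm_run:
  assumes "exec c ((word_contents w, 0), \<lambda>_. 0) (t, s)"
  shows "\<exists>n. fst (run (dec_tm B c) w n) = (if s 0 = 0 then len c + 2 else len c + 3)"
proof -
  let ?M = "dec_tm B c" and ?K = "Suc (width c)"
  have start: "step ?M (start_config ?M w) = config ?K 1 ((word_contents w, 0), \<lambda>_. 0)"
    by (rule step_init) (simp_all add: dec_tm_def)
  obtain n where n: "(step ?M ^^ n) (config ?K 1 ((word_contents w, 0), \<lambda>_. 0)) = config ?K (1 + len c) (t, s)"
    using path_funpow[OF exec_path[OF assms code_at_dec[of B c], of ?K]] by auto
  have stop: "step ?M (config ?K (1 + len c) (t, s)) =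
      config ?K (if s 0 = 0 then len c + 2 else len c + 3) (t, s)"
    by (rule step_keep) (simp_all add: dec_tm_def at_zero_config)
  have "run ?M w (Suc (n + 1)) = step ?M ((step ?M ^^ n) (step ?M (start_config ?M w)))"
    by (simp add: run_def funpow_swap1)
  also have "\<dots> = config ?K (if s 0 = 0 then len c + 2 else len c + 3) (t, s)"
    unfolding start n stop ..
  finally have "fst (run ?M w (Suc (n + 1))) = (if s 0 = 0 then len c + 2 else len c + 3)"
    by simp
  then show ?thesis ..
qed

section \<open>Printing and reading words\<close>

lemma word_contents_inject: "word_contents u = word_contents v \<Longrightarrow> u = v"
proof -
  have "length u \<le> length v" if "word_contents u = word_contents v" for u v :: "'a list"
    using fun_cong[OF that, of "int (length v)"] by (auto simp: word_contents_def split: if_splits)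
  moreover assume eq: "word_contents u = word_contents v"
  ultimately have "length u = length v" by (metis le_antisym)
  moreover have "u ! i = v ! i" if "i < length u" for i
    using fun_cong[OF eq, of "int i"] that \<open>length u = length v\<close> by (simp add: word_contents_def)
  ultimately show "u = v" by (rule nth_equalityI)
qed

lemma word_contents_snoc: "(word_contents u)(int (length u) := Letter a) = word_contents (u @ [a])"
  by (auto simp: word_contents_def fun_eq_iff nth_append)

lemma word_contents_erase: "(word_contents (u @ [a]))(int (length u) := Blank) = word_contents u"
  by (auto simp: word_contents_def fun_eq_iff nth_append)

text \<open>
  The register \<open>r\<close> knows the length of the word, and the head stands just behind the word.
\<close>

definition erase_word :: "nat \<Rightarrow> 'l com" where
  "erase_word r = Loop r (Act (\<lambda>a. (a, MoveLeft)) ;; Act (\<lambda>a. (Blank, Stay)))"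

lemma exec_erase_word:
  "s r = length u \<Longrightarrow>
    exec (erase_word r) ((word_contents u, int (length u)), s) ((word_contents [], 0), s(r := 0))"
proof (induction u arbitrary: s rule: rev_induct)
  case Nil
  then show ?case unfolding erase_word_def by (auto intro!: exec_Loop_stop)
next
  case (snoc a u)
  let ?s = "s(r := length u)"
  have 1: "exec (Act (\<lambda>a. (a, MoveLeft))) ((word_contents (u @ [a]), int (length (u @ [a]))), ?s)
      ((word_contents (u @ [a]), int (length u)), ?s)"
    using exec_Act[of "\<lambda>a. (a, MoveLeft)" "(word_contents (u @ [a]), int (length (u @ [a])))" ?s]
    by simp
  have 2: "exec (Act (\<lambda>a. (Blank, Stay))) ((word_contents (u @ [a]), int (length u)), ?s)
      ((word_contents u, int (length u)), ?s)"
    using exec_Act[of "\<lambda>a. (Blank, Stay)" "(word_contents (u @ [a]), int (length u))" ?s]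
    by (simp add: word_contents_erase)
  have "exec (erase_word r) ((word_contents u, int (length u)), ?s) ((word_contents [], 0), ?s(r := 0))"
    by (rule snoc.IH) simp
  then have 3: "exec (erase_word r) ((word_contents u, int (length u)), ?s) ((word_contents [], 0), s(r := 0))"
    by (simp only: fun_upd_upd)
  show ?case
    unfolding erase_word_def
    by (rule exec_Loop_Suc[OF _ exec_Seq[OF 1 2] 3[unfolded erase_word_def]]) (use snoc.prems in simp)
qed

definition case_reg :: "nat \<Rightarrow> 'l com list \<Rightarrow> 'l com" where
  "case_reg r cs = foldr (IfZero r) cs Skip"

lemma exec_case_reg:
  "i < length cs \<Longrightarrow> s r = i \<Longrightarrow> exec (cs ! i) (t, s(r := 0)) y \<Longrightarrow> exec (case_reg r cs) (t, s) y"
proof (induction cs arbitrary: i s)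
  case (Cons c cs)
  show ?case
  proof (cases i)
    case 0
    with Cons.prems have "s(r := 0) = s" by auto
    with 0 Cons.prems show ?thesis
      by (auto simp: case_reg_def intro: exec_IfZero_0)
  next
    case (Suc j)
    have "exec (case_reg r cs) (t, s(r := j)) y"
      by (rule Cons.IH[of j]) (use Suc Cons.prems in \<open>simp_all only: fun_upd_upd, auto\<close>)
    with Suc Cons.prems(2) show ?thesis
      by (auto simp: case_reg_def intro: exec_IfZero_Suc)
  qed
qed simp

lemma acts_case_reg [simp]: "acts (case_reg r cs) = \<Union> (acts ` set cs)"
  by (induction cs) (auto simp: case_reg_def)

text \<open>
  Register \<open>2\<close> holds the code of the word to be written, register \<open>1\<close> counts the letters for the later
  erasure. A nonempty list is coded as the successor of a pair; the loop itself strips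
  the successor, and what remains is split into the index of a letter and the rest.
\<close>

definition write_word :: "(nat \<Rightarrow> 'l) \<Rightarrow> nat \<Rightarrow> 'l com" where
  "write_word lt k = Loop 2 (unpair_reg 2 ;; swap_reg 2 3 4 ;;
     case_reg 3 (map (\<lambda>i. Act (\<lambda>_. (Letter (lt i), MoveRight))) [0..<k]) ;; Inc 1)"

lemma exec_write_word:
  assumes "set xs \<subseteq> {..<k}" "s 1 = length u" "s 2 = encode xs" "\<And>i. i > 2 \<Longrightarrow> s i = 0"
  shows "exec (write_word lt k) ((word_contents u, int (length u)), s)
    ((word_contents (u @ map lt xs), int (length (u @ map lt xs))),
      s(1 := length (u @ map lt xs), 2 := 0))"
  using assms
proof (induction xs arbitrary: u s)
  case Nil
  then show ?case
    unfolding write_word_def by (auto intro!: exec_Loop_stop simp: fun_eq_iff)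
next
  case (Cons x xs)
  let ?t = "(word_contents u, int (length u))"
  let ?t' = "(word_contents (u @ [lt x]), int (length (u @ [lt x])))"
  let ?s0 = "s(2 := prod_encode (x, encode xs))"
  let ?s1 = "s(2 := x, 3 := encode xs)"
  let ?s2 = "s(2 := encode xs, 3 := x)"
  let ?s3 = "s(2 := encode xs, 3 := 0)"
  let ?s4 = "s(1 := length (u @ [lt x]), 2 := encode xs)"
  have 1: "exec (unpair_reg 2) (?t, ?s0) (?t, ?s1)"
    using exec_unpair_reg[of 2 ?s0 ?t] Cons.prems(4) by simp
  have 2: "exec (swap_reg 2 3 4) (?t, ?s1) (?t, ?s2)"
    using exec_swap_reg[of 2 3 4 ?s1 ?t] Cons.prems(4) by simp
  have 3: "exec (case_reg 3 (map (\<lambda>i. Act (\<lambda>_. (Letter (lt i), MoveRight))) [0..<k])) (?t, ?s2) (?t', ?s3)"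
  proof (rule exec_case_reg[of x])
    show "exec (map (\<lambda>i. Act (\<lambda>_. (Letter (lt i), MoveRight))) [0..<k] ! x) (?t, ?s2(3 := 0)) (?t', ?s3)"
      using exec_Act[of "\<lambda>_. (Letter (lt x), MoveRight)" ?t ?s3] Cons.prems(1)
      by (simp add: word_contents_snoc add.commute)
  qed (use Cons.prems(1) in auto)
  have "?s3(1 := Suc (?s3 1)) = ?s4"
    using Cons.prems(2,4) by (auto simp: fun_eq_iff)
  then have 4: "exec (Inc 1) (?t', ?s3) (?t', ?s4)"
    using exec_Inc[of 1 ?t' ?s3] by simp
  have "exec (write_word lt k) (?t', ?s4)
      ((word_contents ((u @ [lt x]) @ map lt xs), int (length ((u @ [lt x]) @ map lt xs))),
       ?s4(1 := length ((u @ [lt x]) @ map lt xs), 2 := 0))"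
    using Cons.prems by (intro Cons.IH) auto
  then have 5: "exec (write_word lt k) (?t', ?s4)
      ((word_contents (u @ map lt (x # xs)), int (length (u @ map lt (x # xs)))),
       s(1 := length (u @ map lt (x # xs)), 2 := 0))"
    by (simp add: fun_upd_twist)
  show ?case
    unfolding write_word_def
    by (rule exec_Loop_Suc[OF _ exec_Seq[OF 1 exec_Seq[OF 2 exec_Seq[OF 3 4]]] 5[unfolded write_word_def]])
      (use Cons.prems(3) in simp)
qed

text \<open>
  Round \<open>n\<close> erases the previous word, computes \<open>F n\<close> from the counter in register \<open>0\<close>, and
  writes it.
\<close>

theorem recursively_enumerable_range:
  fixes F :: "nat \<Rightarrow> nat list"
  assumes A: "finite A" "lt ` {..<k} \<subseteq> A" and F: "pr F" "\<And>n. set (F n) \<subseteq> {..<k}"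
  shows "recursively_enumerable A (range (\<lambda>n. map lt (F n)))"
proof -
  obtain c :: "nat \<Rightarrow> 'a com" where c: "computes c (\<lambda>n. encode (F (decode n)))"
    using pr_computable[OF F(1)] by blast
  define body where "body = erase_word 1 ;; copy_reg 0 2 3 ;; Inc 0 ;; c 2 ;; write_word lt k"
  \<comment> \<open>W n is the word left on the tape by the rounds before n.\<close>
  define W where "W = case_nat [] (\<lambda>n. map lt (F n))"
  define S where "S n = ((word_contents (W n), int (length (W n))),
      (\<lambda>_. 0)(0 := n, 1 := length (W n)) :: nat \<Rightarrow> nat)" for n :: nat
  define B where "B = {Blank, Aux 0} \<union> Letter ` A"
  have "exec body (S n) (S (Suc n))" for n
  proof -
    let ?t = "(word_contents [], 0) :: 'a tape"
    let ?s1 = "(\<lambda>_. 0)(0 := n) :: nat \<Rightarrow> nat"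
    let ?s2 = "(\<lambda>_. 0)(0 := n, 2 := n) :: nat \<Rightarrow> nat"
    let ?s3 = "(\<lambda>_. 0)(0 := Suc n, 2 := n) :: nat \<Rightarrow> nat"
    let ?s4 = "(\<lambda>_. 0)(0 := Suc n, 2 := encode (F n)) :: nat \<Rightarrow> nat"
    have "(\<lambda>_. 0)(0 := n, 1 := length (W n), 1 := 0) = ?s1"
      by (auto simp: fun_eq_iff)
    then have 1: "exec (erase_word 1) (S n) (?t, ?s1)"
      using exec_erase_word[of "(\<lambda>_. 0)(0 := n, 1 := length (W n))" 1 "W n"] by (simp add: S_def)
    have 2: "exec (copy_reg 0 2 3) (?t, ?s1) (?t, ?s2)"
      using exec_copy_reg[of 0 2 3 ?s1 ?t] by simp
    have "?s2(0 := Suc (?s2 0)) = ?s3"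
      by (auto simp: fun_eq_iff)
    then have 3: "exec (Inc 0) (?t, ?s2) (?t, ?s3)"
      using exec_Inc[of 0 ?t ?s2] by simp
    have 4: "exec (c 2) (?t, ?s3) (?t, ?s4)"
      using computes_exec[OF c, of 2 ?s3 ?t] by simp
    have "?s4(1 := length (map lt (F n)), 2 := 0) = (\<lambda>_. 0)(0 := Suc n, 1 := length (W (Suc n)))"
      by (auto simp: fun_eq_iff W_def)
    then have 5: "exec (write_word lt k) (?t, ?s4) (S (Suc n))"
      using exec_write_word[of "F n" k ?s4 "[]" lt] F(2) by (simp add: S_def W_def)
    show ?thesis
      unfolding body_def by (intro exec_Seq[OF 1] exec_Seq[OF 2] exec_Seq[OF 3] exec_Seq[OF 4] 5)
  qed
  moreover have "S 0 = ((word_contents [], 0), \<lambda>_. 0)"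
    by (auto simp: S_def W_def fun_eq_iff)
  ultimately have "outputs (enum_tm B body) = {w. \<exists>n. fst (fst (S (Suc n))) = word_contents w}"
    by (intro enum_tm_outputs)
  also have "\<dots> = range (\<lambda>n. map lt (F n))"
    by (auto simp: S_def W_def dest: word_contents_inject)
  finally have "outputs (enum_tm B body) = range (\<lambda>n. map lt (F n))" .
  moreover have "lt x \<in> A" if "x < k" for x
    using A(2) that by auto
  then have "valid_tm A (enum_tm B body)"
    by (intro valid_enum_tm)
      (use A c in \<open>auto simp: B_def body_def erase_word_def write_word_def\<close>)
  moreover have "range (\<lambda>n. map lt (F n)) \<subseteq> lists A"
    using A(2) F(2) by (fastforce simp: lists_eq_set)
  ultimately show ?thesis
    unfolding recursively_enumerable_def by blast
qed

text \<open>
  The machines above always print something, so the empty language needs one that never enters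
  its printing state.
\<close>

lemma recursively_enumerable_empty:
  assumes "finite A"
  shows "recursively_enumerable A {}"
proof -
  define M :: "'a enumerator" where "M = (enum_tm ({Blank, Aux 0} \<union> Letter ` A) Skip)\<lparr>printing := 2\<rparr>"
  have "fst (run M [] n) \<le> 1" for n
  proof (induction n)
    case 0
    show ?case by (simp add: run_def start_config_def M_def enum_tm_def)
  next
    case (Suc n)
    have "fst (step M x) \<le> 1" for x
      by (cases x) (simp add: step_def M_def enum_tm_def)
    then show ?case by (simp add: run_def)
  qed
  then have "fst (run M [] n) \<noteq> 2" for n
    by (metis Suc_1 Suc_n_not_le_n)
  moreover have "printing M = 2"
    by (simp add: M_def)
  ultimately have "outputs M = {}"
    by (simp add: outputs_def)
  moreover have "valid_tm A (enum_tm ({Blank, Aux 0} \<union> Letter ` A) Skip)"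
    by (rule valid_enum_tm) (use assms in auto)
  then have "valid_tm A M"
    by (simp add: valid_tm_def M_def)
  ultimately show ?thesis
    unfolding recursively_enumerable_def by blast
qed

definition case_letter :: "(nat \<Rightarrow> 'l) \<Rightarrow> (nat \<Rightarrow> 'l com) \<Rightarrow> nat list \<Rightarrow> 'l com" where
  "case_letter lt c is = foldr (\<lambda>i. IfSym (\<lambda>a. a = Letter (lt i)) (c i)) is Skip"

lemma exec_case_letter:
  "i \<in> set is \<Longrightarrow> inj_on lt (set is) \<Longrightarrow> read_symbol t = Letter (lt i) \<Longrightarrow> exec (c i) (t, s) y
    \<Longrightarrow> exec (case_letter lt c is) (t, s) y"
proof (induction "is")
  case (Cons j js)
  show ?case
  proof (cases "j = i")
    case True
    with Cons.prems show ?thesis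
      by (auto simp: case_letter_def intro: exec_IfSym_True)
  next
    case False
    then have "lt i \<noteq> lt j" using Cons.prems(1,2) by (auto simp: inj_on_def)
    with Cons False show ?thesis
      by (auto simp: case_letter_def intro!: exec_IfSym_False)
  qed
qed simp

lemma exec_case_letter_Blank: "read_symbol t = Blank \<Longrightarrow> exec (case_letter lt c is) (t, s) (t, s)"
  by (induction "is") (auto simp: case_letter_def intro: exec_Skip exec_IfSym_False)

lemma acts_case_letter [simp]: "acts (case_letter lt c is) = (\<Union>i\<in>set is. acts (c i))"
  by (induction "is") (auto simp: case_letter_def)

text \<open>
  Register \<open>0\<close> is a flag that is raised again after every letter; the first blank leaves it down. Letters
  are pushed onto the list in register \<open>1\<close>, which therefore ends up reversed.
\<close>

definition read_word :: "(nat \<Rightarrow> 'l) \<Rightarrow> nat \<Rightarrow> (nat \<Rightarrow> nat \<Rightarrow> 'l com) \<Rightarrow> 'l com" where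
  "read_word lt k c =
    Loop 0 (case_letter lt (\<lambda>i. c i 1 ;; Act (\<lambda>a. (a, MoveRight)) ;; Inc 0) [0..<k])"

lemma exec_read_word:
  assumes lt: "inj_on lt {..<k}" and c: "\<And>i. computes (c i) (\<lambda>n. Suc (prod_encode (i, n)))"
    and "set ys \<subseteq> {..<k}" "s 0 = 1" "s 1 = encode xs" "\<And>i. i > 1 \<Longrightarrow> s i = 0"
    and "w = u @ map lt ys"
  shows "exec (read_word lt k c) ((word_contents w, int (length u)), s)
    ((word_contents w, int (length w)), s(0 := 0, 1 := encode (rev ys @ xs)))"
  using assms(3-)
proof (induction ys arbitrary: u s xs)
  case Nil
  have "read_symbol (word_contents w, int (length u)) = Blank"
    using Nil.prems(5) by (simp add: word_contents_def)
  then have 1: "exec (case_letter lt (\<lambda>i. c i 1 ;; Act (\<lambda>a. (a, MoveRight)) ;; Inc 0) [0..<k])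
      ((word_contents w, int (length u)), s(0 := 0)) ((word_contents w, int (length u)), s(0 := 0))"
    by (rule exec_case_letter_Blank)
  have eq: "s(0 := 0, 1 := encode (rev [] @ xs)) = s(0 := 0)" "length u = length w"
    using Nil.prems(3,5) by (auto simp: fun_eq_iff)
  show ?case
    unfolding read_word_def eq
    by (rule exec_Loop_Suc[OF _ 1[unfolded eq] exec_Loop_0]) (use Nil.prems(2) in simp_all)
next
  case (Cons y ys)
  let ?t = "(word_contents w, int (length u))"
  let ?t' = "(word_contents w, int (length (u @ [lt y])))"
  let ?s1 = "s(0 := 0, 1 := encode (y # xs))"
  let ?s2 = "s(1 := encode (y # xs))"
  have rd: "read_symbol ?t = Letter (lt y)"
    using Cons.prems(5) by (simp add: word_contents_def)
  have 1: "exec (c y 1) (?t, s(0 := 0)) (?t, ?s1)"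
    using computes_exec[OF c[of y], of 1 "s(0 := 0)" ?t] Cons.prems(3,4) by simp
  have 2: "exec (Act (\<lambda>a. (a, MoveRight))) (?t, ?s1) (?t', ?s1)"
    using exec_Act[of "\<lambda>a. (a, MoveRight)" ?t ?s1] by (simp add: add.commute)
  have "?s1(0 := Suc (?s1 0)) = ?s2"
    using Cons.prems(2) by (auto simp: fun_eq_iff)
  then have 3: "exec (Inc 0) (?t', ?s1) (?t', ?s2)"
    using exec_Inc[of 0 ?t' ?s1] by simp
  have 4: "exec (case_letter lt (\<lambda>i. c i 1 ;; Act (\<lambda>a. (a, MoveRight)) ;; Inc 0) [0..<k])
      (?t, s(0 := 0)) (?t', ?s2)"
  proof (rule exec_case_letter[where i = y])
    show "read_symbol ?t = Letter (lt y)"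
      by (rule rd)
    show "exec (c y 1 ;; Act (\<lambda>a. (a, MoveRight)) ;; Inc 0) (?t, s(0 := 0)) (?t', ?s2)"
      by (rule exec_Seq[OF 1 exec_Seq[OF 2 3]])
  qed (use Cons.prems(1) lt in \<open>simp_all add: atLeast0LessThan\<close>)
  have "exec (read_word lt k c) (?t', ?s2)
      ((word_contents w, int (length w)), ?s2(0 := 0, 1 := encode (rev ys @ (y # xs))))"
    using Cons.prems by (intro Cons.IH) auto
  moreover have "?s2(0 := 0, 1 := encode (rev ys @ (y # xs))) = s(0 := 0, 1 := encode (rev (y # ys) @ xs))"
    by (auto simp: fun_eq_iff)
  ultimately have 5: "exec (read_word lt k c) (?t', ?s2)
      ((word_contents w, int (length w)), s(0 := 0, 1 := encode (rev (y # ys) @ xs)))"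
    by (simp only:)
  show ?case
    unfolding read_word_def
    by (rule exec_Loop_Suc[OF _ 4 5[unfolded read_word_def]]) (use Cons.prems(2) in simp)
qed

lemma run_final:
  assumes "fst (run M w n) \<in> final M" "n \<le> m"
  shows "run M w m = run M w n"
proof -
  have "step M (run M w n) = run M w n"
    using assms(1) by (cases "run M w n") (simp add: step_def)
  then have "(step M ^^ i) (run M w n) = run M w n" for i
    by (induction i) simp_all
  moreover have "run M w m = (step M ^^ (m - n)) (run M w n)"
    using assms(2) by (metis (no_types, lifting) run_def funpow_add comp_apply le_add_diff_inverse2)
  ultimately show ?thesis by simp
qed

text \<open>
  The test \<open>P\<close> has three outcomes: \<open>0\<close> for no decision yet, \<open>1\<close> for acceptance, and larger values for
  rejection. The machine looks for the first \<open>n\<close> with a decision.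
\<close>

theorem decidable_language_search:
  fixes P :: "nat list \<times> nat \<Rightarrow> nat"
  assumes A: "finite A" "bij_betw lt {..<k} A" and P: "pr P" and L: "L \<subseteq> lists A"
    and ex: "\<And>xs. set xs \<subseteq> {..<k} \<Longrightarrow> \<exists>n. P (xs, n) \<noteq> 0"
    and acc: "\<And>xs n. set xs \<subseteq> {..<k} \<Longrightarrow> P (xs, n) = 1 \<Longrightarrow> map lt xs \<in> L"
    and rej: "\<And>xs n. set xs \<subseteq> {..<k} \<Longrightarrow> P (xs, n) > 1 \<Longrightarrow> map lt xs \<notin> L"
  shows "decidable_language A L"
proof -
  have "\<exists>c :: nat \<Rightarrow> 'a com. computes c (\<lambda>n. Suc (prod_encode (i, n)))" for i
  proof -
    have "pr (\<lambda>ys :: nat list. i # ys)"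
      by (intro pr_intros)
    then obtain c :: "nat \<Rightarrow> 'a com" where "computes c (\<lambda>n. encode (i # (decode n :: nat list)))"
      by (rule pr_computable)
    then show ?thesis by auto
  qed
  then obtain c :: "nat \<Rightarrow> nat \<Rightarrow> 'a com" where c: "\<And>i. computes (c i) (\<lambda>n. Suc (prod_encode (i, n)))"
    by metis
  \<comment> \<open>Initialisation undoes the reversal of the input and starts the search at 0; ft computes the
      flag for another round, fn advances the search, and fo turns the decision into the verdict.\<close>
  define fi where "fi ys = (rev ys, 0 :: nat)" for ys :: "nat list"
  define ft where "ft z = (if P z = 0 then 1 else 0 :: nat)" for z
  define fn where "fn z = (fst z, if P z = 0 then Suc (snd z) else snd z)" for z
  define fo where "fo z = (if P z = 1 then 0 else 1 :: nat)" for z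
  have "pr fi" "pr ft" "pr fn" "pr fo"
    unfolding fi_def ft_def fn_def fo_def by (intro pr_intros P)+
  then obtain ci ct cn co :: "nat \<Rightarrow> 'a com"
    where ci: "computes ci (\<lambda>n. encode (fi (decode n)))" and ct: "computes ct (\<lambda>n. encode (ft (decode n)))"
      and cn: "computes cn (\<lambda>n. encode (fn (decode n)))" and co: "computes co (\<lambda>n. encode (fo (decode n)))"
    using pr_computable[of fi] pr_computable[of ft] pr_computable[of fn] pr_computable[of fo]
    by metis
  define search where "search = Loop 0 (copy_reg 1 2 3 ;; ct 2 ;; move_reg 2 0 ;; cn 1)"
  define body where "body = Inc 0 ;; read_word lt k c ;; ci 1 ;; Inc 0 ;; search ;; co 1 ;; move_reg 1 0"
  define B where "B = {Blank, Aux 0} \<union> Letter ` A"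
  define st :: "nat \<Rightarrow> nat \<Rightarrow> nat \<Rightarrow> nat" where "st a b = (\<lambda>_. 0)(0 := a, 1 := b)" for a b
  have st_simps: "st a b 0 = a" "st a b 1 = b" "st a b (Suc 0) = b" "i > 1 \<Longrightarrow> st a b i = 0" for a b i
    by (simp_all add: st_def)
  have st_upd: "(st a b)(0 := a') = st a' b" "(st a b)(1 := b') = st a b'"
    "(st a b)(Suc 0 := b') = st a b'" for a b a' b'
    by (auto simp: st_def)
  have iter: "exec (copy_reg 1 2 3 ;; ct 2 ;; move_reg 2 0 ;; cn 1) (t, st 0 (encode z))
      (t, st (ft z) (encode (fn z)))" for t z
  proof -
    have 1: "exec (copy_reg 1 2 3) (t, st 0 (encode z)) (t, (st 0 (encode z))(2 := encode z))"
      using exec_copy_reg[of 1 2 3 "st 0 (encode z)" t] by (simp add: st_simps)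
    have 2: "exec (ct 2) (t, (st 0 (encode z))(2 := encode z)) (t, (st 0 (encode z))(2 := ft z))"
      using computes_exec[OF ct, of 2 "(st 0 (encode z))(2 := encode z)" t] by (simp add: st_simps)
    have "(st 0 (encode z))(2 := ft z, 2 := 0, 0 := ft z) = st (ft z) (encode z)"
      by (auto simp: st_def fun_eq_iff)
    then have 3: "exec (move_reg 2 0) (t, (st 0 (encode z))(2 := ft z)) (t, st (ft z) (encode z))"
      using exec_move_reg[of 2 0 t "(st 0 (encode z))(2 := ft z)"] by (simp add: st_simps)
    have 4: "exec (cn 1) (t, st (ft z) (encode z)) (t, st (ft z) (encode (fn z)))"
      using computes_exec[OF cn, of 1 "st (ft z) (encode z)" t] by (simp add: st_simps st_upd)
    show ?thesis by (intro exec_Seq[OF 1] exec_Seq[OF 2] exec_Seq[OF 3] 4)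
  qed
  have exec_search: "exec search (t, st 1 (encode (xs, m))) (t, st 0 (encode (xs, n)))"
    if n: "P (xs, n) \<noteq> 0" "\<And>i. i < n \<Longrightarrow> P (xs, i) = 0" and "m \<le> n" for t xs n m
    using \<open>m \<le> n\<close>
  proof (induction rule: inc_induct)
    case base
    have "ft (xs, n) = 0" "fn (xs, n) = (xs, n)"
      using n(1) by (simp_all add: ft_def fn_def)
    with iter[of t "(xs, n)"] have 1: "exec (copy_reg 1 2 3 ;; ct 2 ;; move_reg 2 0 ;; cn 1)
        (t, (st 1 (encode (xs, n)))(0 := 0)) (t, st 0 (encode (xs, n)))"
      by (simp only: st_upd)
    show ?case
      unfolding search_def by (rule exec_Loop_Suc[OF _ 1 exec_Loop_0]) (simp_all add: st_simps)
  next
    case (step m)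
    have "ft (xs, m) = 1" "fn (xs, m) = (xs, Suc m)"
      using n(2) step.hyps by (simp_all add: ft_def fn_def)
    with iter[of t "(xs, m)"] have 1: "exec (copy_reg 1 2 3 ;; ct 2 ;; move_reg 2 0 ;; cn 1)
        (t, (st 1 (encode (xs, m)))(0 := 0)) (t, st 1 (encode (xs, Suc m)))"
      by (simp only: st_upd)
    show ?case
      unfolding search_def
      by (rule exec_Loop_Suc[OF _ 1 step.IH[unfolded search_def]]) (simp add: st_simps)
  qed
  have exec_body: "\<exists>t b r. exec body ((word_contents (map lt xs), 0), \<lambda>_. 0) (t, st r b) \<and>
      (r = 0 \<longleftrightarrow> map lt xs \<in> L)"
    if xs: "set xs \<subseteq> {..<k}" for xs
  proof -
    define n where "n = (LEAST n. P (xs, n) \<noteq> 0)"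
    have n: "P (xs, n) \<noteq> 0" "\<And>i. i < n \<Longrightarrow> P (xs, i) = 0"
      unfolding n_def using LeastI_ex[OF ex[OF xs]] not_less_Least by (blast, blast)
    let ?start = "(word_contents (map lt xs), 0)"
    let ?t = "(word_contents (map lt xs), int (length (map lt xs)))"
    have "(\<lambda>_. 0)(0 := Suc 0) = st 1 0"
      by (auto simp: st_def)
    then have 1: "exec (Inc 0) (?start, \<lambda>_. 0) (?start, st 1 0)"
      using exec_Inc[of 0 ?start "\<lambda>_. 0"] by simp
    have "exec (read_word lt k c) ((word_contents (map lt xs), int (length ([] :: 'a list))), st 1 0)
        (?t, (st 1 0)(0 := 0, 1 := encode (rev xs @ [])))"
      by (rule exec_read_word[OF _ c xs]) (use A(2) in \<open>auto simp: st_simps bij_betw_def\<close>)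
    then have 2: "exec (read_word lt k c) (?start, st 1 0) (?t, st 0 (encode (rev xs)))"
      by (simp add: st_upd)
    have 3: "exec (ci 1) (?t, st 0 (encode (rev xs))) (?t, st 0 (encode (xs, 0 :: nat)))"
      using computes_exec[OF ci, of 1 "st 0 (encode (rev xs))" ?t] by (simp add: st_simps st_upd fi_def)
    have 4: "exec (Inc 0) (?t, st 0 (encode (xs, 0 :: nat))) (?t, st 1 (encode (xs, 0 :: nat)))"
      using exec_Inc[of 0 ?t "st 0 (encode (xs, 0 :: nat))"] by (simp add: st_simps st_upd)
    have 5: "exec search (?t, st 1 (encode (xs, 0 :: nat))) (?t, st 0 (encode (xs, n)))"
      by (rule exec_search[OF n]) simp_all
    have 6: "exec (co 1) (?t, st 0 (encode (xs, n))) (?t, st 0 (fo (xs, n)))"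
      using computes_exec[OF co, of 1 "st 0 (encode (xs, n))" ?t]
      by (simp add: st_simps st_upd del: encode_pair)
    have "(st 0 (fo (xs, n)))(1 := 0, 0 := fo (xs, n)) = st (fo (xs, n)) 0"
      by (auto simp: st_def fun_eq_iff)
    then have 7: "exec (move_reg 1 0) (?t, st 0 (fo (xs, n))) (?t, st (fo (xs, n)) 0)"
      using exec_move_reg[of 1 0 ?t "st 0 (fo (xs, n))"] by (simp add: st_simps)
    have "fo (xs, n) = 0 \<longleftrightarrow> map lt xs \<in> L"
      using acc[OF xs, of n] rej[OF xs, of n] n(1) by (auto simp: fo_def)
    moreover have "exec body (?start, \<lambda>_. 0) (?t, st (fo (xs, n)) 0)"
      unfolding body_def
      by (intro exec_Seq[OF 1] exec_Seq[OF 2] exec_Seq[OF 3] exec_Seq[OF 4] exec_Seq[OF 5]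
          exec_Seq[OF 6] 7)
    ultimately show ?thesis by metis
  qed
  have c_acts: "acts (c i b) = {}" for i b
    by (rule computes_acts[OF c])
  have acts: "acts body \<subseteq> {\<lambda>a. (a, MoveRight)}"
    unfolding body_def read_word_def search_def
    by (simp add: c_acts computes_acts[OF ci] computes_acts[OF ct] computes_acts[OF cn]
        computes_acts[OF co] UN_subset_iff)
  have "valid_tm A (dec_tm B body)"
  proof (rule valid_dec_tm)
    fix f a
    assume f: "f \<in> acts body" and "a \<in> B"
    from subsetD[OF acts f] have "f = (\<lambda>a. (a, MoveRight))" by (rule singletonD)
    with \<open>a \<in> B\<close> show "fst (f a) \<in> B" by simp
  qed (use A(1) in \<open>auto simp: B_def\<close>)
  moreover have "\<exists>n. fst (run (dec_tm B body) w n) \<in> final (dec_tm B body) \<and>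
      (fst (run (dec_tm B body) w n) \<in> accepting (dec_tm B body) \<longleftrightarrow> w \<in> L)"
    if "w \<in> lists A" for w
  proof -
    have "w \<in> map lt ` lists {..<k}"
      using that A(2) by (simp add: lists_image[symmetric] bij_betw_def)
    then obtain xs where xs: "set xs \<subseteq> {..<k}" "w = map lt xs"
      by (auto simp: lists_eq_set)
    obtain t b r where r: "exec body ((word_contents w, 0), \<lambda>_. 0) (t, st r b)"
      and r_L: "r = 0 \<longleftrightarrow> w \<in> L"
      using exec_body[OF xs(1)] unfolding xs(2) by (elim exE conjE)
    obtain n where n: "fst (run (dec_tm B body) w n) = (if r = 0 then len body + 2 else len body + 3)"
      using dec_tm_run[OF r, of B] unfolding st_simps by (elim exE)
    have "fst (run (dec_tm B body) w n) \<in> final (dec_tm B body)"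
      "fst (run (dec_tm B body) w n) \<in> accepting (dec_tm B body) \<longleftrightarrow> w \<in> L"
      unfolding n r_L[symmetric] by (simp_all add: dec_tm_def)
    then show ?thesis by (intro exI conjI)
  qed
  moreover have "accepting (dec_tm B body) \<subseteq> final (dec_tm B body)"
    by (simp add: dec_tm_def)
  ultimately have "decides (dec_tm B body) A L"
    unfolding decides_def by (intro conjI ballI)
  with L show ?thesis
    unfolding decidable_language_def by (intro conjI exI)
qed

section \<open>Runs of Turing machines are primitive recursive\<close>

text \<open>
  The code of an integer is even for nonnegative numbers and odd for negative ones, so successor
  and predecessor need a parity test on codes.
\<close>

lemma parity_code: "((\<lambda>b. 1 - b) ^^ n) 0 = (if even n then 0 else 1 :: nat)"
  by (induction n) auto

lemma int_encode_nat: "int_encode (int n) = 2 * n"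
  and int_encode_neg: "int_encode (- int n - 1) = Suc (2 * n)"
  by (simp_all add: int_encode_def sum_encode_def)

lemma pr_int_succ [pr_intros]: "pr f \<Longrightarrow> pr (\<lambda>x. f x + 1 :: int)"
proof -
  assume f: "pr f"
  let ?c = "\<lambda>n. if ((\<lambda>b. 1 - b) ^^ n) 0 = (0 :: nat) then Suc (Suc n) else n - Suc (Suc 0)"
  have code: "encode (i + 1) = ?c (encode i)" for i :: int
  proof (cases "0 \<le> i")
    case True
    then obtain n where "i = int n" by (metis nonneg_int_cases)
    moreover have "int n + 1 = int (Suc n)" by simp
    ultimately show ?thesis
      unfolding parity_code encode_int_def by (simp only: int_encode_nat) simp
  next
    case False
    define n where "n = nat (- i - 1)"
    with False have n: "i = - int n - 1" by simp
    show ?thesis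
    proof (cases n)
      case 0
      then show ?thesis
        unfolding n parity_code encode_int_def by (simp add: int_encode_def sum_encode_def)
    next
      case (Suc m)
      then have "i + 1 = - int m - 1" using n by simp
      then show ?thesis
        unfolding parity_code encode_int_def by (simp only: n Suc int_encode_neg) simp
    qed
  qed
  have eq: "f x + 1 = decode (?c (encode (f x)))" for x
    unfolding code[symmetric] by (rule decode_encode[symmetric])
  show ?thesis
    unfolding eq by (intro pr_intros f)
qed

lemma pr_int_pred [pr_intros]: "pr f \<Longrightarrow> pr (\<lambda>x. f x - 1 :: int)"
proof -
  assume f: "pr f"
  let ?c = "\<lambda>n. if n = 0 then 1 else if ((\<lambda>b. 1 - b) ^^ n) 0 = (0 :: nat) then n - Suc (Suc 0) else Suc (Suc n)"
  have code: "encode (i - 1) = ?c (encode i)" for i :: int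
  proof (cases "0 \<le> i")
    case True
    then obtain n where n: "i = int n" by (metis nonneg_int_cases)
    show ?thesis
    proof (cases n)
      case 0
      then show ?thesis
        unfolding n encode_int_def by (simp add: int_encode_def sum_encode_def)
    next
      case (Suc m)
      then have "i - 1 = int m" using n by simp
      then show ?thesis
        unfolding parity_code encode_int_def by (simp only: n Suc int_encode_nat) simp
    qed
  next
    case False
    define n where "n = nat (- i - 1)"
    with False have n: "i = - int n - 1" by simp
    then have "i - 1 = - int (Suc n) - 1" by simp
    then show ?thesis
      unfolding parity_code encode_int_def by (simp only: n int_encode_neg) simp
  qed
  have eq: "f x - 1 = decode (?c (encode (f x)))" for x
    unfolding code[symmetric] by (rule decode_encode[symmetric])
  show ?thesis
    unfolding eq by (intro pr_intros f)
qed

text \<open>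
  The contents of a tape are represented by the list of all writes, the most recent one first,
  together with the position of the head. Cells never written to read as \<open>0\<close>, the code of the blank.
  Writing is then a mere \<open>Cons\<close>, no matter where on the two-way infinite tape the head is.
\<close>

type_synonym tape_log = "(int \<times> nat) list \<times> int"

definition lookup :: "(int \<times> nat) list \<Rightarrow> int \<Rightarrow> nat" where
  "lookup l i = foldr (\<lambda>e n. if fst e = i then snd e else n) l 0"

lemma lookup_simps [simp]:
  "lookup [] i = 0" "lookup (e # l) i = (if fst e = i then snd e else lookup l i)"
  by (simp_all add: lookup_def)

lemma lookup_outside: "i \<notin> fst ` set l \<Longrightarrow> lookup l i = 0"
  by (induction l) auto

lemma pr_lookup [pr_intros]:
  assumes "pr l" "pr i"
  shows "pr (\<lambda>x. lookup (l x) (i x))"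
  unfolding lookup_def by (intro pr_intros pr_comp[OF assms(2)] assms)

text \<open>
  Contents of tapes are functions on all integers; comparing two logs at the finitely many cells
  mentioned in them is enough.
\<close>

definition same_contents :: "(int \<times> nat) list \<Rightarrow> (int \<times> nat) list \<Rightarrow> bool" where
  "same_contents l l' \<longleftrightarrow> (\<forall>e\<in>set (l @ l'). lookup l (fst e) = lookup l' (fst e))"

lemma same_contents: "same_contents l l' \<longleftrightarrow> lookup l = lookup l'"
proof
  assume *: "same_contents l l'"
  show "lookup l = lookup l'"
  proof
    fix i
    show "lookup l i = lookup l' i"
    proof (cases "i \<in> fst ` set (l @ l')")
      case True
      with * show ?thesis by (auto simp: same_contents_def)
    next
      case False
      then show ?thesis by (simp add: lookup_outside image_Un)
    qed
  qed
qed (simp add: same_contents_def)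

lemma decidable_pr_same_contents [pr_intros]:
  assumes "pr l" "pr l'"
  shows "decidable_pr (\<lambda>x. same_contents (l x) (l' x))"
  unfolding same_contents_def
  by (intro pr_intros pr_comp[OF assms(1)] pr_comp[OF assms(2)])

definition move_code :: "move \<Rightarrow> nat" where
  "move_code d = (case d of MoveLeft \<Rightarrow> 0 | Stay \<Rightarrow> 1 | MoveRight \<Rightarrow> 2)"

definition shift_log :: "nat \<Rightarrow> int \<Rightarrow> int" where
  "shift_log m i = (if m = 0 then i - 1 else if m = 1 then i else i + 1)"

lemma shift_log: "shift_log (move_code d) i = i + shift d"
  by (cases d) (simp_all add: shift_log_def move_code_def)

definition act_log :: "nat \<times> nat \<Rightarrow> tape_log \<Rightarrow> tape_log" where
  "act_log a t = ((snd t, fst a) # fst t, shift_log (snd a) (snd t))"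

definition read_log :: "tape_log \<Rightarrow> nat" where
  "read_log t = lookup (fst t) (snd t)"

definition step_log :: "(nat \<times> nat list \<Rightarrow> nat \<times> (nat \<times> nat) list) \<Rightarrow> nat set \<Rightarrow>
    nat \<times> tape_log list \<Rightarrow> nat \<times> tape_log list" where
  "step_log d F c =
    (if fst c \<in> F then c
     else (fst (d (fst c, map read_log (snd c))),
           map2 act_log (snd (d (fst c, map read_log (snd c)))) (snd c)))"

lemma pr_step_log:
  assumes "pr d" "finite F"
  shows "pr (step_log d F)"
proof -
  have act: "pr (\<lambda>p :: _ \<times> _. case snd p of (a, b) \<Rightarrow> act_log a b)"
    unfolding act_log_def shift_log_def by (intro pr_intros)
  have rd: "pr (\<lambda>p :: 'x::encodable \<times> _. read_log (snd p))"
    unfolding read_log_def by (intro pr_intros)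
  show ?thesis
    unfolding step_log_def[abs_def]
    by (intro pr_intros decidable_pr_comp[OF decidable_pr_finite[OF assms(2)]] act rd
        pr_comp[OF assms(1)])
qed

definition word_log :: "(nat \<Rightarrow> nat) \<Rightarrow> nat list \<Rightarrow> (int \<times> nat) list" where
  "word_log e xs = snd (fold (\<lambda>x p. (fst p + 1, (fst p, e x) # snd p)) xs (0, []))"

lemma pr_word_log [pr_intros]:
  assumes "pr e" "pr l"
  shows "pr (\<lambda>x. word_log e (l x))"
  unfolding word_log_def by (intro pr_intros pr_comp[OF assms(1)] assms(2))

lemma word_log_snoc: "word_log e (xs @ [x]) = (int (length xs), e x) # word_log e xs"
proof -
  have "fst (fold (\<lambda>x p. (fst p + 1, (fst p, e x) # snd p)) xs (0, [])) = int (length xs)" for xs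
    by (induction xs rule: rev_induct) simp_all
  then show ?thesis by (simp add: word_log_def)
qed

lemma lookup_word_log:
  assumes "sc Blank = 0" "\<And>x. x \<in> set xs \<Longrightarrow> e x = sc (Letter (lt x))"
  shows "lookup (word_log e xs) i = sc (word_contents (map lt xs) i)"
  using assms(2)
proof (induction xs rule: rev_induct)
  case Nil
  then show ?case using assms(1) by (simp add: word_log_def word_contents_def)
next
  case (snoc x xs)
  then show ?case
    by (simp add: word_log_snoc word_contents_snoc[symmetric, of "map lt xs"])
qed

text \<open>
  A machine together with a numbering \<open>sc\<close> of its finite tape alphabet, the blank getting the
  number \<open>0\<close> that logs return by default, and an enumeration \<open>lt\<close> of input letters. Its transition function matters only on a finite set of arguments and
  becomes a finite table.
\<close>

locale coded_tm =
  fixes A :: "'l set" and M :: "('l, 'm) tm_scheme" and sc :: "'l symbol \<Rightarrow> nat"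
    and lt :: "nat \<Rightarrow> 'l" and k :: nat
  assumes valid: "valid_tm A M"
    and sc_inj: "inj_on sc (tape_alphabet M)" and sc_Blank: "sc Blank = 0"
    and lt: "lt ` {..<k} \<subseteq> A"
begin

definition simulates_tape :: "'l tape \<Rightarrow> tape_log \<Rightarrow> bool" where
  "simulates_tape t l \<longleftrightarrow> snd l = snd t \<and>
     (\<forall>i. fst t i \<in> tape_alphabet M \<and> lookup (fst l) i = sc (fst t i))"

text \<open>
  The state and the number of tapes are included because the transition table is faithful only
  on arguments that belong to the machine.
\<close>

definition simulates :: "'l config \<Rightarrow> nat \<times> tape_log list \<Rightarrow> bool" where
  "simulates c d \<longleftrightarrow> fst d = fst c \<and> fst c \<in> states M \<and> length (snd c) = num_tapes M \<and>
     list_all2 simulates_tape (snd c) (snd d)"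

definition table_domain :: "(nat \<times> nat list) set" where
  "table_domain = states M \<times> {cs \<in> lists (sc ` tape_alphabet M). length cs = num_tapes M}"

definition table :: "nat \<times> nat list \<Rightarrow> nat \<times> (nat \<times> nat) list" where
  "table p = (if p \<in> table_domain
     then map_prod id (map (map_prod sc move_code))
       (delta M (fst p) (map (inv_into (tape_alphabet M) sc) (snd p)))
     else (0, []))"

definition letter_code :: "nat \<Rightarrow> nat" where
  "letter_code x = (if x \<in> {..<k} then sc (Letter (lt x)) else 0)"

definition start_log :: "nat list \<Rightarrow> nat \<times> tape_log list" where
  "start_log xs = (initial M, (word_log letter_code xs, 0) # replicate (num_tapes M - 1) ([], 0))"

definition run_log :: "nat list \<times> nat \<Rightarrow> nat \<times> tape_log list" where
  "run_log p = (step_log table (final M) ^^ snd p) (start_log (fst p))"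

lemma pr_table: "pr table"
proof -
  have "finite table_domain"
    unfolding table_domain_def lists_eq_set
    using valid finite_lists_length_eq[of "sc ` tape_alphabet M" "num_tapes M"]
    by (simp add: valid_tm_def)
  then show ?thesis
    unfolding table_def[abs_def] by (rule pr_finite_table)
qed

lemma pr_letter_code: "pr letter_code"
  unfolding letter_code_def[abs_def] by (rule pr_finite_table) simp

lemma pr_run_log: "pr run_log"
proof -
  have "finite (final M)"
    using valid by (auto simp: valid_tm_def intro: finite_subset)
  then have "pr (\<lambda>p :: (nat list \<times> nat) \<times> nat \<times> tape_log list. step_log table (final M) (snd p))"
    by (intro pr_comp[OF pr_step_log] pr_table pr_intros)
  then show ?thesis
    unfolding run_log_def[abs_def] start_log_def
    by (intro pr_intros pr_letter_code)
qed

lemma simulates_word: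
  assumes "set xs \<subseteq> {..<k}"
  shows "simulates_tape (word_contents (map lt xs), 0) (word_log letter_code xs, 0)"
proof -
  have "word_contents (map lt xs) i \<in> tape_alphabet M" for i
  proof -
    have "Letter (lt x) \<in> tape_alphabet M" if "x \<in> set xs" for x
    proof -
      have "lt x \<in> A" using that assms lt by auto
      moreover have "Letter ` A \<subseteq> tape_alphabet M" using valid by (simp add: valid_tm_def)
      ultimately show ?thesis by blast
    qed
    moreover have "Blank \<in> tape_alphabet M"
      using valid by (simp add: valid_tm_def)
    ultimately show ?thesis
      by (auto simp: word_contents_def nat_less_iff)
  qed
  moreover have "lookup (word_log letter_code xs) i = sc (word_contents (map lt xs) i)" for i
    by (rule lookup_word_log) (use assms sc_Blank in \<open>auto simp: letter_code_def\<close>)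
  ultimately show ?thesis
    by (simp add: simulates_tape_def)
qed

lemma simulates_start:
  assumes "set xs \<subseteq> {..<k}"
  shows "simulates (start_config M (map lt xs)) (start_log xs)"
proof -
  have "simulates_tape (word_contents [], 0) ([], 0)"
    using simulates_word[of "[]"] by (simp add: word_log_def)
  then have "list_all2 simulates_tape (replicate n (word_contents [], 0)) (replicate n ([], 0))" for n
    by (simp add: list_all2_conv_all_nth)
  with simulates_word[OF assms] valid show ?thesis
    by (auto simp: simulates_def start_config_def start_log_def valid_tm_def)
qed

lemma simulates_act:
  assumes "simulates_tape t l" "fst a \<in> tape_alphabet M"
  shows "simulates_tape (act a t) (act_log (map_prod sc move_code a) l)"
  using assms by (cases a; cases t) (auto simp: simulates_tape_def act_log_def shift_log)

lemma simulates_step: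
  assumes "simulates c d"
  shows "simulates (step M c) (step_log table (final M) d)"
proof (cases "fst c \<in> final M")
  case True
  with assms show ?thesis
    by (cases c) (simp add: step_def step_log_def simulates_def)
next
  case False
  let ?B = "tape_alphabet M"
  obtain q ts where c: "c = (q, ts)" by (cases c)
  obtain ls where d: "d = (q, ls)" using assms by (cases d) (simp add: simulates_def c)
  have q: "q \<in> states M" "length ts = num_tapes M" and sim: "list_all2 simulates_tape ts ls"
    using assms by (simp_all add: simulates_def c d)
  let ?ss = "map read_symbol ts"
  have rd: "map read_log ls = map sc ?ss" and ss: "set ?ss \<subseteq> ?B"
  proof -
    have "read_log l = sc (read_symbol t) \<and> read_symbol t \<in> ?B" if "simulates_tape t l" for t l
      using that by (cases t) (simp add: simulates_tape_def read_log_def)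
    with sim show "map read_log ls = map sc ?ss" "set ?ss \<subseteq> ?B"
      by (induction rule: list_all2_induct) auto
  qed
  obtain q' as where step: "delta M q ?ss = (q', as)" by fastforce
  have ss': "?ss \<in> lists ?B" "length ?ss = num_tapes M"
    using ss q by (auto simp: lists_eq_set)
  have "\<forall>q\<in>states M. \<forall>ss\<in>lists ?B. length ss = num_tapes M \<longrightarrow>
      fst (delta M q ss) \<in> states M \<and> length (snd (delta M q ss)) = num_tapes M \<and>
      fst ` set (snd (delta M q ss)) \<subseteq> ?B"
    using valid by (simp add: valid_tm_def)
  from this[rule_format, OF q(1) ss'] have as: "q' \<in> states M" "length as = num_tapes M" "fst ` set as \<subseteq> ?B"
    by (simp_all add: step)
  have "map (inv_into ?B sc) (map sc ?ss) = ?ss"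
    using ss sc_inj by (auto simp: map_idI inv_into_f_f subset_iff)
  moreover have "(q, map sc ?ss) \<in> table_domain"
    unfolding table_domain_def lists_image
    using q(1) ss'(2) imageI[OF ss'(1), of "map sc"] by (simp del: map_map)
  ultimately have "table (q, map read_log ls) = (q', map (map_prod sc move_code) as)"
    unfolding rd table_def by (simp add: step del: map_map)
  then have 1: "step_log table (final M) d = (q', map2 act_log (map (map_prod sc move_code) as) ls)"
    using False by (simp add: step_log_def c d)
  have 2: "step M c = (q', map2 act as ts)"
    using False step by (simp add: step_def c)
  have "length as = length ts" using as(2) q(2) by simp
  then have "list_all2 simulates_tape (map2 act as ts) (map2 act_log (map (map_prod sc move_code) as) ls)"
    using sim as(3)
  proof (induction as ts arbitrary: ls rule: list_induct2)
    case (Cons a as t ts)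
    then obtain l ls' where "ls = l # ls'" "simulates_tape t l" "list_all2 simulates_tape ts ls'"
      by (auto simp: list_all2_Cons1)
    with Cons show ?case by (simp add: simulates_act)
  qed simp
  with as q(2) show ?thesis
    by (simp add: simulates_def 1 2)
qed

lemma simulates_run:
  assumes "set xs \<subseteq> {..<k}"
  shows "simulates (run M (map lt xs) n) (run_log (xs, n))"
proof (induction n)
  case 0
  show ?case using simulates_start[OF assms] by (simp add: run_def run_log_def)
next
  case (Suc n)
  then show ?case using simulates_step by (simp add: run_def run_log_def)
qed

lemma contents_eq_iff:
  assumes "simulates_tape t l" "simulates_tape t' l'"
  shows "fst t = fst t' \<longleftrightarrow> same_contents (fst l) (fst l')"
proof -
  have "fst t i = fst t' i \<longleftrightarrow> lookup (fst l) i = lookup (fst l') i" for i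
    using assms sc_inj by (auto simp: simulates_tape_def inj_on_eq_iff)
  then show ?thesis
    by (simp add: same_contents fun_eq_iff)
qed

lemma first_tape_contents:
  assumes "set xs \<subseteq> {..<k}"
  shows "fst (snd (run M [] n) ! 0) = word_contents (map lt xs) \<longleftrightarrow>
    same_contents (case snd (run_log ([], n)) of [] \<Rightarrow> [] | l # ls \<Rightarrow> fst l) (word_log letter_code xs)"
proof -
  have sim: "simulates (run M [] n) (run_log ([], n))"
    using simulates_run[of "[]" n] by simp
  moreover have "num_tapes M \<ge> 1"
    using valid by (simp add: valid_tm_def)
  ultimately obtain t ts l ls where "snd (run M [] n) = t # ts" "snd (run_log ([], n)) = l # ls"
    "simulates_tape t l"
    by (cases "snd (run M [] n)") (auto simp: simulates_def list_all2_Cons1)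
  with contents_eq_iff[OF _ simulates_word[OF assms]] show ?thesis
    by simp
qed

end

lemma coded_tm_exists:
  assumes "valid_tm A M" "lt ` {..<k} \<subseteq> A"
  shows "\<exists>sc. coded_tm A M sc lt k"
proof -
  have "finite (tape_alphabet M)"
    using assms(1) by (simp add: valid_tm_def)
  then obtain f :: "'a symbol \<Rightarrow> nat" where "inj_on f (tape_alphabet M)"
    by (metis finite_imp_inj_to_nat_seg)
  then have "coded_tm A M (\<lambda>a. if a = Blank then 0 else Suc (f a)) lt k"
    using assms by unfold_locales (auto simp: inj_on_def)
  then show ?thesis by blast
qed

text \<open>
  For deciders the state is all that matters.
\<close>

theorem pr_run_state:
  assumes "valid_tm A M" "lt ` {..<k} \<subseteq> A"
  obtains f :: "nat list \<times> nat \<Rightarrow> nat" where "pr f"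
    and "\<And>xs n. set xs \<subseteq> {..<k} \<Longrightarrow> f (xs, n) = fst (run M (map lt xs) n)"
proof -
  obtain sc where "coded_tm A M sc lt k"
    using coded_tm_exists[OF assms] by blast
  then interpret coded_tm A M sc lt k .
  show thesis
  proof (rule that)
    show "pr (\<lambda>p. fst (run_log p))"
      by (intro pr_intros pr_run_log)
    show "fst (run_log (xs, n)) = fst (run M (map lt xs) n)" if "set xs \<subseteq> {..<k}" for xs n
      using simulates_run[OF that, of n] by (simp add: simulates_def)
  qed
qed

text \<open>
  A recursively enumerable language is the projection of a primitive recursive relation: \<open>P (xs, n)\<close> says that
  the enumerator outputs \<open>xs\<close> at time \<open>n\<close>. The word is compared with the tape, not read off it, which avoids
  determining where the word on the tape ends.
\<close>

theorem recursively_enumerable_imp_pr: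
  assumes "recursively_enumerable A L" "lt ` {..<k} \<subseteq> A"
  shows "\<exists>P :: nat list \<times> nat \<Rightarrow> bool. decidable_pr P \<and>
    (\<forall>xs. set xs \<subseteq> {..<k} \<longrightarrow> (map lt xs \<in> L \<longleftrightarrow> (\<exists>n. P (xs, n))))"
proof -
  obtain M where M: "valid_tm A M" "outputs M = L"
    using assms(1) unfolding recursively_enumerable_def by blast
  obtain sc where "coded_tm A M sc lt k"
    using coded_tm_exists[OF M(1) assms(2)] by blast
  then interpret coded_tm A M sc lt k .
  define P where "P p \<longleftrightarrow> fst (run_log ([], snd p)) = printing M \<and>
    same_contents (case snd (run_log ([], snd p)) of [] \<Rightarrow> [] | l # ls \<Rightarrow> fst l)
      (word_log letter_code (fst p))" for p :: "nat list \<times> nat"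
  show ?thesis
  proof (intro exI[of _ P] conjI allI impI)
    show "decidable_pr P"
      unfolding P_def[abs_def] by (intro pr_intros pr_comp[OF pr_run_log] pr_letter_code)
    show "map lt xs \<in> L \<longleftrightarrow> (\<exists>n. P (xs, n))" if "set xs \<subseteq> {..<k}" for xs
      unfolding M(2)[symmetric] outputs_def P_def
      using simulates_run[of "[]"] first_tape_contents[OF that] by (simp add: simulates_def)
  qed
qed

section \<open>Free groups\<close>

lemma flip_flip [simp]: "flip (flip a) = a"
  by (cases a) simp_all

lemma flip_in_letters [simp]: "flip a \<in> letters X \<longleftrightarrow> a \<in> letters X"
  by (cases a) (auto simp: letters_def)

lemma freely_reduced_simps [simp]:
  "freely_reduced []" "freely_reduced [a]"
  "freely_reduced (a # b # w) \<longleftrightarrow> b \<noteq> flip a \<and> freely_reduced (b # w)"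
  by (simp_all add: freely_reduced_def)

lemma freely_reduced_tl: "freely_reduced (a # w) \<Longrightarrow> freely_reduced w"
  by (cases w) simp_all

lemma freely_reduced_push: "freely_reduced w \<Longrightarrow> freely_reduced (push_letter a w)"
  by (cases w) (auto dest: freely_reduced_tl)

text \<open>
  This is the reason why free reduction defines a group: on reduced words, pushing a letter is a bijection whose
  inverse pushes the inverse letter.
\<close>

lemma push_letter_flip: "freely_reduced w \<Longrightarrow> push_letter a (push_letter (flip a) w) = w"
proof (cases w)
  case (Cons b v)
  assume "freely_reduced w"
  then show ?thesis
    using Cons by (cases v) auto
qed simp

lemma free_reduce_simps [simp]:
  "free_reduce [] = []" "free_reduce (a # w) = push_letter a (free_reduce w)"
  by (simp_all add: free_reduce_def)

lemma freely_reduced_foldr: "freely_reduced z \<Longrightarrow> freely_reduced (foldr push_letter w z)"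
  by (induction w) (simp_all add: freely_reduced_push)

lemma freely_reduced_free_reduce [simp]: "freely_reduced (free_reduce w)"
  by (simp add: free_reduce_def freely_reduced_foldr)

lemma free_reduce_id: "freely_reduced w \<Longrightarrow> free_reduce w = w"
proof (induction w)
  case (Cons a w)
  then have "free_reduce w = w" by (blast dest: freely_reduced_tl)
  with Cons.prems show ?case by (cases w) auto
qed simp

lemma foldr_push_letter:
  assumes "freely_reduced z"
  shows "foldr push_letter (push_letter a w) z = push_letter a (foldr push_letter w z)"
proof (cases w)
  case (Cons b v)
  show ?thesis
    using Cons push_letter_flip[OF freely_reduced_foldr[OF assms, of v], of a] by simp
qed simp

text \<open>
  Pushing all letters of a word and pushing all letters of its reduced form have the same
  effect; associativity of the free group rests on this.
\<close>

lemma foldr_free_reduce: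
  "freely_reduced z \<Longrightarrow> foldr push_letter (free_reduce w) z = foldr push_letter w z"
  by (induction w) (simp_all add: foldr_push_letter)

lemma free_reduce_append: "free_reduce (u @ v) = foldr push_letter u (free_reduce v)"
  by (simp add: free_reduce_def)

lemma free_reduce_left [simp]: "free_reduce (free_reduce u @ v) = free_reduce (u @ v)"
  by (simp add: free_reduce_append foldr_free_reduce)

lemma free_reduce_right [simp]: "free_reduce (u @ free_reduce v) = free_reduce (u @ v)"
  by (simp add: free_reduce_append free_reduce_id)

lemma free_reduce_inside: "free_reduce (u @ free_reduce v @ w) = free_reduce (u @ v @ w)"
  by (metis free_reduce_left free_reduce_right)

definition inverse_word :: "'a letter list \<Rightarrow> 'a letter list" where
  "inverse_word w = map flip (rev w)"

lemma inverse_word_simps [simp]: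
  "inverse_word [] = []" "inverse_word (u @ v) = inverse_word v @ inverse_word u"
  "inverse_word (inverse_word w) = w"
  by (simp_all add: inverse_word_def rev_map[symmetric] comp_def)

lemma set_inverse_word [simp]: "set (inverse_word w) = flip ` set w"
  by (simp add: inverse_word_def)

lemma inverse_word_lists [simp]: "inverse_word w \<in> lists (letters X) \<longleftrightarrow> w \<in> lists (letters X)"
  by (auto simp: lists_eq_set)

lemma free_reduce_inverse_right: "free_reduce (w @ inverse_word w) = []"
proof (induction w)
  case (Cons a w)
  have "free_reduce ((a # w) @ inverse_word (a # w)) =
      push_letter a (free_reduce ((w @ inverse_word w) @ [flip a]))"
    by (simp add: inverse_word_def)
  also have "\<dots> = push_letter a (free_reduce (free_reduce (w @ inverse_word w) @ [flip a]))"
    by (simp only: free_reduce_left)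
  finally show ?case by (simp only: Cons.IH) simp
qed simp

lemma free_reduce_inverse_left: "free_reduce (inverse_word w @ w) = []"
  using free_reduce_inverse_right[of "inverse_word w"] by simp

lemma set_push_letter: "set (push_letter a w) \<subseteq> insert a (set w)"
  by (cases w) auto

lemma free_reduce_lists: "w \<in> lists (letters X) \<Longrightarrow> free_reduce w \<in> lists (letters X)"
proof (induction w)
  case (Cons a w)
  then show ?case using set_push_letter[of a "free_reduce w"] by (auto simp: lists_eq_set)
qed simp

lemma free_group_simps:
  "x \<in> carrier (free_group X) \<longleftrightarrow> x \<in> lists (letters X) \<and> freely_reduced x"
  "x \<otimes>\<^bsub>free_group X\<^esub> y = free_reduce (x @ y)" "\<one>\<^bsub>free_group X\<^esub> = []"
  by (simp_all add: free_group_def)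

lemma free_reduce_carrier: "w \<in> lists (letters X) \<Longrightarrow> free_reduce w \<in> carrier (free_group X)"
  by (simp add: free_group_simps free_reduce_lists)

theorem group_free_group: "group (free_group X)"
proof (rule groupI)
  fix x y z
  assume x: "x \<in> carrier (free_group X)" and y: "y \<in> carrier (free_group X)"
    and "z \<in> carrier (free_group X)"
  show "x \<otimes>\<^bsub>free_group X\<^esub> y \<in> carrier (free_group X)"
    using x y by (simp add: free_group_simps free_reduce_lists)
  show "x \<otimes>\<^bsub>free_group X\<^esub> y \<otimes>\<^bsub>free_group X\<^esub> z = x \<otimes>\<^bsub>free_group X\<^esub> (y \<otimes>\<^bsub>free_group X\<^esub> z)"
    by (simp add: free_group_simps)
next
  show "\<one>\<^bsub>free_group X\<^esub> \<in> carrier (free_group X)"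
    by (simp add: free_group_simps)
next
  fix x
  assume x: "x \<in> carrier (free_group X)"
  then show "\<one>\<^bsub>free_group X\<^esub> \<otimes>\<^bsub>free_group X\<^esub> x = x"
    by (simp add: free_group_simps free_reduce_id)
  have "free_reduce (inverse_word x) \<in> carrier (free_group X)"
    using x by (simp add: free_group_simps free_reduce_lists)
  moreover have "free_reduce (inverse_word x) \<otimes>\<^bsub>free_group X\<^esub> x = \<one>\<^bsub>free_group X\<^esub>"
    by (simp add: free_group_simps free_reduce_inverse_left)
  ultimately show "\<exists>y\<in>carrier (free_group X). y \<otimes>\<^bsub>free_group X\<^esub> x = \<one>\<^bsub>free_group X\<^esub>"
    by blast
qed

lemma inv_free_group:
  assumes "x \<in> carrier (free_group X)"
  shows "inv\<^bsub>free_group X\<^esub> x = free_reduce (inverse_word x)"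
  using assms
  by (intro group.inv_equality[OF group_free_group])
    (simp_all add: free_group_simps free_reduce_lists free_reduce_inverse_left)

section \<open>Evaluation of words\<close>

definition eval_word :: "('a, 'm) monoid_scheme \<Rightarrow> 'a letter list \<Rightarrow> 'a" where
  "eval_word G w = word_value G (map (letter_value G) w)"

lemma word_value_simps [simp]:
  "word_value G [] = \<one>\<^bsub>G\<^esub>" "word_value G (x # w) = x \<otimes>\<^bsub>G\<^esub> word_value G w"
  by (simp_all add: word_value_def)

lemma eval_word_simps [simp]:
  "eval_word G [] = \<one>\<^bsub>G\<^esub>" "eval_word G (a # w) = letter_value G a \<otimes>\<^bsub>G\<^esub> eval_word G w"
  by (simp_all add: eval_word_def)

context group
begin

lemma word_value_closed: "set w \<subseteq> carrier G \<Longrightarrow> word_value G w \<in> carrier G"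
  by (induction w) auto

lemma letter_value_closed: "X \<subseteq> carrier G \<Longrightarrow> a \<in> letters X \<Longrightarrow> letter_value G a \<in> carrier G"
  by (auto simp: letters_def)

lemma eval_word_closed: "X \<subseteq> carrier G \<Longrightarrow> w \<in> lists (letters X) \<Longrightarrow> eval_word G w \<in> carrier G"
  by (induction w) (auto simp: letter_value_closed)

lemma eval_word_append:
  "X \<subseteq> carrier G \<Longrightarrow> u \<in> lists (letters X) \<Longrightarrow> v \<in> lists (letters X) \<Longrightarrow>
    eval_word G (u @ v) = eval_word G u \<otimes> eval_word G v"
  by (induction u) (auto simp: letter_value_closed eval_word_closed m_assoc)

lemma letter_value_flip:
  "X \<subseteq> carrier G \<Longrightarrow> a \<in> letters X \<Longrightarrow> letter_value G a \<otimes> letter_value G (flip a) = \<one>"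
  by (cases a) (auto simp: letters_def)

lemma eval_word_push_letter:
  assumes "X \<subseteq> carrier G" "a \<in> letters X" "w \<in> lists (letters X)"
  shows "eval_word G (push_letter a w) = letter_value G a \<otimes> eval_word G w"
proof (cases w)
  case (Cons b v)
  show ?thesis
  proof (cases "b = flip a")
    case True
    have "letter_value G a \<otimes> (letter_value G (flip a) \<otimes> eval_word G v) = eval_word G v"
      using assms Cons letter_value_closed[OF assms(1), of "flip a"]
      by (simp add: m_assoc[symmetric] letter_value_flip letter_value_closed eval_word_closed)
    with Cons True show ?thesis by simp
  next
    case False
    with Cons show ?thesis by simp
  qed
qed simp

lemma eval_word_free_reduce:
  assumes "X \<subseteq> carrier G" "w \<in> lists (letters X)"
  shows "eval_word G (free_reduce w) = eval_word G w"
  using assms(2)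
proof (induction w)
  case (Cons a w)
  then show ?case
    by (simp add: eval_word_push_letter[OF assms(1)] free_reduce_lists)
qed simp

lemma eval_word_hom:
  assumes "X \<subseteq> carrier G"
  shows "group_hom (free_group X) G (eval_word G)"
proof -
  have "eval_word G \<in> hom (free_group X) G"
    by (rule homI)
      (auto simp: free_group_simps eval_word_closed[OF assms] eval_word_free_reduce[OF assms]
        eval_word_append[OF assms])
  then show ?thesis
    using group_free_group is_group by (simp add: group_hom_def group_hom_axioms_def)
qed

lemma generate_eval_word:
  assumes "X \<subseteq> carrier G"
  shows "generate G X = eval_word G ` lists (letters X)"
proof (intro equalityI subsetI)
  fix g
  assume "g \<in> generate G X"
  then show "g \<in> eval_word G ` lists (letters X)"
  proof (induction rule: generate.induct)
    case one
    show ?case by (rule image_eqI[of _ _ "[]"]) simp_all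
  next
    case (incl h)
    then show ?case
      using assms by (intro image_eqI[of _ _ "[Pos h]"]) (auto simp: letters_def)
  next
    case (inv h)
    then show ?case
      using assms by (intro image_eqI[of _ _ "[Neg h]"]) (auto simp: letters_def)
  next
    case (eng h1 h2)
    then obtain u v where "h1 = eval_word G u" "u \<in> lists (letters X)"
      "h2 = eval_word G v" "v \<in> lists (letters X)" by blast
    then show ?case
      by (intro image_eqI[of _ _ "u @ v"]) (simp_all add: eval_word_append[OF assms])
  qed
next
  fix g
  assume "g \<in> eval_word G ` lists (letters X)"
  then obtain w where w: "w \<in> lists (letters X)" "g = eval_word G w" by blast
  have "eval_word G w \<in> generate G X"
    using w(1)
  proof (induction w rule: list.induct)
    case (Cons a w)
    have "letter_value G a \<in> generate G X"
      using Cons.prems by (auto simp: letters_def intro: generate.incl generate.inv)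
    with Cons show ?case by (simp add: generate.eng)
  qed (simp add: generate.one)
  with w show "g \<in> generate G X" by simp
qed

end

section \<open>Normal closures in free groups\<close>

text \<open>
  A certificate lists triples \<open>(g, s, r)\<close>, standing for the conjugate by \<open>g\<close> of the relator \<open>r\<close>,
  inverted iff \<open>s \<noteq> 0\<close>. The sign is a number since it becomes part of an encoded certificate.
\<close>

definition conjugate_product :: "('a letter list \<times> nat \<times> 'a letter list) list \<Rightarrow> 'a letter list" where
  "conjugate_product cs =
     concat (map (\<lambda>(g, s, r). g @ (if s = 0 then r else inverse_word r) @ inverse_word g) cs)"

definition conjugates :: "'a set \<Rightarrow> 'a letter list set \<Rightarrow> ('a letter list \<times> nat \<times> 'a letter list) set" where
  "conjugates X R = lists (letters X) \<times> UNIV \<times> R"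

lemma conjugate_product_simps [simp]:
  "conjugate_product [] = []" "conjugate_product (cs @ ds) = conjugate_product cs @ conjugate_product ds"
  "conjugate_product ((g, s, r) # cs) =
    g @ (if s = 0 then r else inverse_word r) @ inverse_word g @ conjugate_product cs"
  by (simp_all add: conjugate_product_def)

lemma conjugate_product_lists:
  "R \<subseteq> lists (letters X) \<Longrightarrow> cs \<in> lists (conjugates X R) \<Longrightarrow> conjugate_product cs \<in> lists (letters X)"
proof (induction cs rule: list.induct)
  case (Cons c cs)
  obtain g s r where c: "c = (g, s, r)" by (cases c)
  have "(g, s, r) \<in> conjugates X R"
    using Cons.prems by (simp add: c)
  then have "g \<in> lists (letters X)" "r \<in> lists (letters X)"
    using Cons.prems(1) by (auto simp: conjugates_def)
  with Cons show ?case by (simp add: c)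
qed simp

lemma conjugate_product_inverse:
  assumes "cs \<in> lists (conjugates X R)"
  obtains ds where "ds \<in> lists (conjugates X R)" "conjugate_product ds = inverse_word (conjugate_product cs)"
proof -
  have "\<exists>ds. ds \<in> lists (conjugates X R) \<and> conjugate_product ds = inverse_word (conjugate_product cs)"
    using assms
  proof (induction cs rule: list.induct)
    case (Cons c cs)
    then obtain ds where ds: "ds \<in> lists (conjugates X R)" "conjugate_product ds = inverse_word (conjugate_product cs)"
      by auto
    obtain g s r where c: "c = (g, s, r)" by (cases c)
    have "(g, s, r) \<in> conjugates X R"
      using Cons.prems by (simp add: c)
    then have "g \<in> lists (letters X)" "r \<in> R"
      by (auto simp: conjugates_def)
    with ds show ?case
      by (intro exI[of _ "ds @ [(g, if s = 0 then 1 else 0, r)]"]) (simp add: c conjugates_def)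
  qed (rule exI[of _ "[]"], simp)
  then show thesis using that by blast
qed

text \<open>
  Conjugating a product of conjugates by \<open>u\<close> amounts to conjugating each factor, because the inner
  pairs \<open>u\<inverse> u\<close> cancel.
\<close>

lemma conjugate_product_conj:
  assumes "cs \<in> lists (conjugates X R)" "u \<in> lists (letters X)"
  obtains ds where "ds \<in> lists (conjugates X R)"
    "free_reduce (conjugate_product ds) = free_reduce (u @ conjugate_product cs @ inverse_word u)"
proof -
  have "\<exists>ds. ds \<in> lists (conjugates X R) \<and>
      free_reduce (conjugate_product ds) = free_reduce (u @ conjugate_product cs @ inverse_word u)"
    using assms(1)
  proof (induction cs rule: list.induct)
    case Nil
    show ?case
      by (intro exI[of _ "[]"]) (simp add: free_reduce_inverse_right)
  next
    case (Cons c cs)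
    then obtain ds where ds: "ds \<in> lists (conjugates X R)"
      "free_reduce (conjugate_product ds) = free_reduce (u @ conjugate_product cs @ inverse_word u)"
      by auto
    obtain g s r where c: "c = (g, s, r)" by (cases c)
    let ?a = "g @ (if s = 0 then r else inverse_word r) @ inverse_word g"
    let ?b = "conjugate_product cs @ inverse_word u"
    have "free_reduce (conjugate_product ((u @ g, s, r) # ds)) =
        free_reduce ((u @ ?a @ inverse_word u) @ free_reduce (conjugate_product ds))"
      unfolding free_reduce_right by simp
    also have "\<dots> = free_reduce ((u @ ?a @ inverse_word u) @ u @ ?b)"
      unfolding ds(2) free_reduce_right ..
    also have "\<dots> = free_reduce ((u @ ?a) @ free_reduce (inverse_word u @ u) @ ?b)"
      unfolding free_reduce_inside by simp
    also have "\<dots> = free_reduce (u @ conjugate_product (c # cs) @ inverse_word u)"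
      unfolding free_reduce_inverse_left by (simp add: c)
    finally have "free_reduce (conjugate_product ((u @ g, s, r) # ds)) =
      free_reduce (u @ conjugate_product (c # cs) @ inverse_word u)" .
    moreover have "(g, s, r) \<in> conjugates X R"
      using Cons.prems by (simp add: c)
    then have "g \<in> lists (letters X)" "r \<in> R"
      by (auto simp: conjugates_def)
    then have "(u @ g, s, r) # ds \<in> lists (conjugates X R)"
      using assms(2) ds(1) by (simp add: conjugates_def)
    ultimately show ?case by blast
  qed
  then show thesis using that by blast
qed

lemma normal_conjugate_products:
  assumes R: "R \<subseteq> lists (letters X)"
  shows "(\<lambda>cs. free_reduce (conjugate_product cs)) ` lists (conjugates X R) \<lhd> free_group X"
    (is "?K \<lhd> ?F")
  unfolding group.normal_inv_iff[OF group_free_group]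
proof (intro conjI ballI)
  interpret F: group ?F by (rule group_free_group)
  have K_carrier: "?K \<subseteq> carrier ?F"
    using conjugate_product_lists[OF R] by (auto intro!: free_reduce_carrier)
  show "subgroup ?K ?F"
  proof (rule F.subgroupI[OF K_carrier])
    show "?K \<noteq> {}" by blast
  next
    fix a
    assume a: "a \<in> ?K"
    then obtain cs where cs: "cs \<in> lists (conjugates X R)" "a = free_reduce (conjugate_product cs)"
      by blast
    obtain ds where ds: "ds \<in> lists (conjugates X R)"
      "conjugate_product ds = inverse_word (conjugate_product cs)"
      using conjugate_product_inverse[OF cs(1)] by blast
    have "free_reduce (conjugate_product ds) \<otimes>\<^bsub>?F\<^esub> a = \<one>\<^bsub>?F\<^esub>"
      by (simp add: free_group_simps cs(2) ds(2) free_reduce_inverse_left)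
    then have "inv\<^bsub>?F\<^esub> a = free_reduce (conjugate_product ds)"
      using K_carrier a ds(1) by (intro F.inv_equality) auto
    with ds(1) show "inv\<^bsub>?F\<^esub> a \<in> ?K" by blast
  next
    fix a b
    assume "a \<in> ?K" "b \<in> ?K"
    then obtain cs ds where "cs \<in> lists (conjugates X R)" "a = free_reduce (conjugate_product cs)"
      "ds \<in> lists (conjugates X R)" "b = free_reduce (conjugate_product ds)"
      by blast
    then show "a \<otimes>\<^bsub>?F\<^esub> b \<in> ?K"
      by (intro image_eqI[of _ _ "cs @ ds"]) (simp_all add: free_group_simps)
  qed
next
  fix x h
  assume x: "x \<in> carrier ?F" and "h \<in> ?K"
  then obtain cs where cs: "cs \<in> lists (conjugates X R)" "h = free_reduce (conjugate_product cs)"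
    by blast
  have "x \<in> lists (letters X)" using x by (simp add: free_group_simps)
  then obtain ds where ds: "ds \<in> lists (conjugates X R)"
    "free_reduce (conjugate_product ds) = free_reduce (x @ conjugate_product cs @ inverse_word x)"
    using conjugate_product_conj[OF cs(1)] by blast
  have "x \<otimes>\<^bsub>?F\<^esub> h \<otimes>\<^bsub>?F\<^esub> inv\<^bsub>?F\<^esub> x = free_reduce (conjugate_product ds)"
    unfolding inv_free_group[OF x] ds(2) by (simp add: free_group_simps cs(2) free_reduce_inside)
  with ds(1) show "x \<otimes>\<^bsub>?F\<^esub> h \<otimes>\<^bsub>?F\<^esub> inv\<^bsub>?F\<^esub> x \<in> ?K" by blast
qed

theorem normal_closure_free_group:
  assumes R: "R \<subseteq> lists (letters X)"
  shows "normal_closure (free_group X) (free_reduce ` R) =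
    (\<lambda>cs. free_reduce (conjugate_product cs)) ` lists (conjugates X R)"
    (is "_ = ?K")
proof (intro equalityI subsetI)
  let ?F = "free_group X"
  fix x
  assume x: "x \<in> normal_closure ?F (free_reduce ` R)"
  have "free_reduce r \<in> ?K" if "r \<in> R" for r
    using that by (intro image_eqI[of _ _ "[([], 0, r)]"]) (simp_all add: conjugates_def)
  with x normal_conjugate_products[OF R] show "x \<in> ?K"
    unfolding normal_closure_def by blast
next
  let ?F = "free_group X"
  fix x
  assume "x \<in> ?K"
  then obtain cs where cs: "cs \<in> lists (conjugates X R)" "x = free_reduce (conjugate_product cs)"
    by blast
  have "free_reduce (conjugate_product cs) \<in> N" if N: "N \<lhd> ?F" "free_reduce ` R \<subseteq> N" for N
    using cs(1)
  proof (induction cs rule: list.induct)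
    case Nil
    then show ?case
      using subgroup.one_closed[OF normal_imp_subgroup[OF N(1)]] by (simp add: free_group_simps)
  next
    case (Cons c cs)
    interpret N: normal N ?F by (rule N(1))
    obtain g s r where c: "c = (g, s, r)" by (cases c)
    let ?r = "if s = 0 then r else inverse_word r"
    have "(g, s, r) \<in> conjugates X R"
      using Cons.prems by (simp add: c)
    then have g: "g \<in> lists (letters X)" and r: "r \<in> R" "r \<in> lists (letters X)"
      using R by (auto simp: conjugates_def)
    have "free_reduce r \<in> N" using r(1) N(2) by blast
    moreover have "inv\<^bsub>?F\<^esub> (free_reduce r) = free_reduce (inverse_word r)"
      using free_reduce_inverse_left[of r] r(2)
      by (intro N.inv_equality) (simp_all add: free_group_simps free_reduce_lists)
    ultimately have "free_reduce ?r \<in> N"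
      by (metis N.m_inv_closed)
    moreover have "inv\<^bsub>?F\<^esub> (free_reduce g) = free_reduce (inverse_word g)"
      using free_reduce_inverse_left[of g] g
      by (intro N.inv_equality) (simp_all add: free_group_simps free_reduce_lists)
    ultimately have "free_reduce g \<otimes>\<^bsub>?F\<^esub> free_reduce ?r \<otimes>\<^bsub>?F\<^esub> free_reduce (inverse_word g) \<in> N"
      using N.inv_op_closed2[OF free_reduce_carrier[OF g], of "free_reduce ?r"] by simp
    then have "free_reduce (g @ ?r @ inverse_word g) \<in> N"
      by (simp add: free_group_simps free_reduce_inside)
    moreover have "free_reduce (conjugate_product cs) \<in> N"
      using Cons by auto
    ultimately have "free_reduce (g @ ?r @ inverse_word g) \<otimes>\<^bsub>?F\<^esub> free_reduce (conjugate_product cs) \<in> N"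
      by (rule subgroup.m_closed[OF normal_imp_subgroup[OF N(1)]])
    then show ?case
      by (simp add: free_group_simps c)
  qed
  with cs(2) show "x \<in> normal_closure ?F (free_reduce ` R)"
    unfolding normal_closure_def by blast
qed

lemma normal_closure_normal:
  "R \<subseteq> lists (letters X) \<Longrightarrow> normal_closure (free_group X) (free_reduce ` R) \<lhd> free_group X"
  using normal_closure_free_group normal_conjugate_products by metis

section \<open>Presented groups\<close>

text \<open>
  The element of the presented group represented by a word.
\<close>

definition word_class :: "'a set \<Rightarrow> 'a letter list set \<Rightarrow> 'a letter list \<Rightarrow> 'a letter list set" where
  "word_class X R w = normal_closure (free_group X) (free_reduce ` R) #>\<^bsub>free_group X\<^esub> free_reduce w"

locale presentation =
  fixes X :: "'a set" and R :: "'a letter list set"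
  assumes relators: "R \<subseteq> lists (letters X)"
begin

abbreviation "F \<equiv> free_group X"
abbreviation "N \<equiv> normal_closure F (free_reduce ` R)"
abbreviation "P \<equiv> presented_group X R"

sublocale N: normal N F
  by (rule normal_closure_normal[OF relators])

lemma subgroup_N: "subgroup N F"
  by (rule normal_imp_subgroup[OF normal_closure_normal[OF relators]])

lemma Nil_in_N: "[] \<in> N"
  using subgroup.one_closed[OF subgroup_N] by (simp add: free_group_simps)

lemma group_P: "group P"
  unfolding presented_group_def by (rule N.factorgroup_is_group)

lemma word_class_closed: "w \<in> lists (letters X) \<Longrightarrow> word_class X R w \<in> carrier P"
  unfolding word_class_def presented_group_def FactGroup_def
  by (simp add: N.rcosetsI[OF N.subset free_reduce_carrier])

lemma word_class_append:
  assumes "u \<in> lists (letters X)" "v \<in> lists (letters X)"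
  shows "word_class X R (u @ v) = word_class X R u \<otimes>\<^bsub>P\<^esub> word_class X R v"
proof -
  have "word_class X R u \<otimes>\<^bsub>P\<^esub> word_class X R v = N #>\<^bsub>F\<^esub> (free_reduce u \<otimes>\<^bsub>F\<^esub> free_reduce v)"
    unfolding word_class_def presented_group_def FactGroup_def
    using N.rcos_sum[OF free_reduce_carrier[OF assms(1)] free_reduce_carrier[OF assms(2)]] by simp
  then show ?thesis
    by (simp add: word_class_def free_group_simps)
qed

lemma one_P: "\<one>\<^bsub>P\<^esub> = N"
  by (simp add: presented_group_def FactGroup_def)

lemma word_class_eq_one:
  assumes "w \<in> lists (letters X)"
  shows "word_class X R w = \<one>\<^bsub>P\<^esub> \<longleftrightarrow> free_reduce w \<in> N"
  unfolding word_class_def one_P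
  using N.coset_join1[OF _ free_reduce_carrier[OF assms] subgroup_N]
    N.coset_join2[OF free_reduce_carrier[OF assms] subgroup_N]
  by blast

lemma word_class_surj:
  assumes "x \<in> carrier P"
  obtains w where "w \<in> lists (letters X)" "word_class X R w = x"
proof -
  obtain w where "w \<in> carrier F" "x = N #>\<^bsub>F\<^esub> w"
    using assms by (auto simp: presented_group_def FactGroup_def RCOSETS_def)
  then show thesis
    using that[of w] by (simp add: word_class_def free_group_simps free_reduce_id)
qed

lemma word_class_eq_iff:
  assumes u: "u \<in> lists (letters X)" and v: "v \<in> lists (letters X)"
  shows "word_class X R u = word_class X R v \<longleftrightarrow> free_reduce (u @ inverse_word v) \<in> N"
proof -
  interpret P: group P by (rule group_P)
  let ?c = "word_class X R"
  have inv_v: "inverse_word v \<in> lists (letters X)" using v by simp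
  have "?c v \<otimes>\<^bsub>P\<^esub> ?c (inverse_word v) = \<one>\<^bsub>P\<^esub>"
    using word_class_append[OF v inv_v] word_class_eq_one[of "v @ inverse_word v"] v
      Nil_in_N
    by (simp add: free_reduce_inverse_right)
  then have "?c (inverse_word v) = inv\<^bsub>P\<^esub> ?c v"
    using word_class_closed v inv_v by (metis P.inv_equality P.inv_comm)
  then have "free_reduce (u @ inverse_word v) \<in> N \<longleftrightarrow> ?c u \<otimes>\<^bsub>P\<^esub> inv\<^bsub>P\<^esub> ?c v = \<one>\<^bsub>P\<^esub>"
    using word_class_append[OF u inv_v] word_class_eq_one[of "u @ inverse_word v"] u v by simp
  also have "\<dots> \<longleftrightarrow> ?c u = ?c v"
    using word_class_closed[OF u] word_class_closed[OF v]
    by (metis P.inv_closed P.inv_equality P.inv_inv P.r_inv)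
  finally show ?thesis ..
qed

lemma hom_word_value:
  assumes h: "h \<in> hom G P" and G: "group G"
    and s: "\<And>y. y \<in> Y \<Longrightarrow> y \<in> carrier G \<and> s y \<in> lists (letters X) \<and> word_class X R (s y) = h y"
    and "w \<in> lists Y"
  shows "h (word_value G w) = word_class X R (concat (map s w)) \<and> concat (map s w) \<in> lists (letters X)"
  using \<open>w \<in> lists Y\<close>
proof (induction w rule: list.induct)
  case Nil
  interpret h: group_hom G P h
    using h G group_P by (simp add: group_hom_def group_hom_axioms_def)
  show ?case
    using word_class_eq_one[of "[]"] Nil_in_N by simp
next
  case (Cons y w)
  interpret G: group G by (rule G)
  have "word_value G w \<in> carrier G"
    using Cons.prems s by (intro G.word_value_closed) auto
  with Cons s[of y] show ?case
    by (auto simp: hom_mult[OF h] word_class_append)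
qed

end

text \<open>
  The free reductions of these relators are exactly the kernel of the evaluation map, which is its
  own normal closure; the first isomorphism theorem does the rest.
\<close>

theorem (in group) trivial_words_presentation:
  assumes X: "X \<subseteq> carrier G" "generate G X = carrier G"
  shows "G \<cong> presented_group X {w \<in> lists (letters X). eval_word G w = \<one>}"
proof -
  let ?F = "free_group X" and ?R = "{w \<in> lists (letters X). eval_word G w = \<one>}"
  interpret h: group_hom ?F G "eval_word G" by (rule eval_word_hom[OF X(1)])
  let ?K = "kernel ?F G (eval_word G)"
  have K: "free_reduce ` ?R = ?K"
  proof (intro equalityI subsetI)
    fix x
    assume "x \<in> free_reduce ` ?R"
    then obtain w where w: "w \<in> lists (letters X)" "eval_word G w = \<one>" "x = free_reduce w"
      by blast
    then show "x \<in> ?K"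
      by (simp add: kernel_def eval_word_free_reduce[OF X(1) w(1)] free_reduce_carrier[OF w(1)])
  next
    fix x
    assume "x \<in> ?K"
    then show "x \<in> free_reduce ` ?R"
      by (intro image_eqI[of _ _ x]) (auto simp: kernel_def free_group_simps free_reduce_id)
  qed
  have "normal_closure ?F ?K = ?K"
    using h.normal_kernel unfolding normal_closure_def by blast
  moreover have "eval_word G ` carrier ?F = carrier G"
  proof -
    have "eval_word G ` lists (letters X) \<subseteq> eval_word G ` carrier ?F"
    proof
      fix g
      assume "g \<in> eval_word G ` lists (letters X)"
      then obtain w where "w \<in> lists (letters X)" "g = eval_word G w" by blast
      then show "g \<in> eval_word G ` carrier ?F"
        by (intro image_eqI[of _ _ "free_reduce w"])
          (simp_all add: eval_word_free_reduce[OF X(1)] free_reduce_carrier)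
    qed
    moreover have "eval_word G ` carrier ?F \<subseteq> eval_word G ` lists (letters X)"
      by (auto simp: free_group_simps)
    ultimately show ?thesis
      using generate_eval_word[OF X(1)] X(2) by simp
  qed
  then have "?F Mod ?K \<cong> G"
    by (rule h.FactGroup_iso)
  then have "G \<cong> ?F Mod ?K"
    by (rule group.iso_sym[OF normal.factorgroup_is_group[OF h.normal_kernel]])
  ultimately show ?thesis
    by (simp add: presented_group_def K)
qed

section \<open>From machines to primitive recursive predicates and back\<close>

text \<open>
  All pairs are run through; a pair that does not qualify contributes the default word \<open>ys\<close>, taken from the
  language itself. An empty language has no such word and is treated apart.
\<close>

lemma pr_imp_recursively_enumerable:
  fixes P :: "nat list \<times> nat \<Rightarrow> bool"
  assumes A: "lt ` {..<k} = A" and P: "decidable_pr P"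
  shows "recursively_enumerable A (map lt ` {xs. set xs \<subseteq> {..<k} \<and> (\<exists>n. P (xs, n))})"
    (is "recursively_enumerable A (map lt ` ?L)")
proof (cases "?L = {}")
  case True
  have "finite A" unfolding A[symmetric] by simp
  with True show ?thesis by (simp only: image_empty recursively_enumerable_empty)
next
  case False
  then obtain ys where ys: "ys \<in> ?L" by blast
  define ok where "ok p \<longleftrightarrow> (\<forall>x\<in>set (fst p). x < k) \<and> P p" for p
  define F where "F n = (if ok (decode n) then fst (decode n :: nat list \<times> nat) else ys)" for n
  have "decidable_pr (\<lambda>n. ok (decode n))"
    unfolding ok_def by (intro pr_intros decidable_pr_comp[OF P])
  then have "pr F"
    unfolding F_def[abs_def] by (intro pr_intros)
  moreover have F_mem: "F n \<in> ?L" for n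
  proof (cases "ok (decode n)")
    case True
    then have "\<exists>m. P (fst (decode n :: nat list \<times> nat), m)"
      by (intro exI[of _ "snd (decode n :: nat list \<times> nat)"]) (simp add: ok_def)
    with True show ?thesis
      by (auto simp: F_def ok_def)
  next
    case False
    with ys show ?thesis by (simp add: F_def)
  qed
  moreover have "finite A" "lt ` {..<k} \<subseteq> A" unfolding A[symmetric] by simp_all
  moreover have "set (F n) \<subseteq> {..<k}" for n
    using F_mem[of n] by blast
  ultimately have "recursively_enumerable A (range (\<lambda>n. map lt (F n)))"
    by (intro recursively_enumerable_range)
  moreover have range_F: "range F = ?L"
  proof (intro equalityI subsetI)
    fix xs
    assume "xs \<in> ?L"
    then obtain n where "set xs \<subseteq> {..<k}" "P (xs, n)" by blast
    then have "F (encode (xs, n)) = xs"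
      by (auto simp: F_def ok_def simp del: encode_pair)
    then show "xs \<in> range F" by (rule range_eqI[OF sym])
  qed (use F_mem in blast)
  have "range (\<lambda>n. map lt (F n)) = map lt ` range F"
    by (simp only: image_image)
  ultimately show ?thesis by (simp only: range_F)
qed

lemma decidable_language_imp_pr:
  assumes "decidable_language A L" "lt ` {..<k} \<subseteq> A"
  obtains P Q :: "nat list \<times> nat \<Rightarrow> bool" where "decidable_pr P" "decidable_pr Q"
    and "\<And>xs. set xs \<subseteq> {..<k} \<Longrightarrow> map lt xs \<in> L \<longleftrightarrow> (\<exists>n. P (xs, n))"
    and "\<And>xs. set xs \<subseteq> {..<k} \<Longrightarrow> map lt xs \<notin> L \<longleftrightarrow> (\<exists>n. Q (xs, n))"
proof -
  obtain M where M: "decides M A L"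
    using assms(1) unfolding decidable_language_def by blast
  then have valid: "valid_tm A M" and acc: "accepting M \<subseteq> final M"
    by (simp_all add: decides_def)
  have "finite (final M)"
    using valid by (auto simp: valid_tm_def dest: finite_subset)
  then have fin: "finite (final M)" "finite (accepting M)"
    using finite_subset[OF acc] by blast+
  obtain f :: "nat list \<times> nat \<Rightarrow> nat" where f: "pr f"
    "\<And>xs n. set xs \<subseteq> {..<k} \<Longrightarrow> f (xs, n) = fst (run M (map lt xs) n)"
    using pr_run_state[OF valid assms(2)] by metis
  have halts: "\<exists>n. fst (run M w n) \<in> final M \<and> (fst (run M w n) \<in> accepting M \<longleftrightarrow> w \<in> L)"
    if "w \<in> lists A" for w
    using M that by (simp add: decides_def)
  have decision: "fst (run M w n) \<in> accepting M \<longleftrightarrow> w \<in> L"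
    if w: "w \<in> lists A" and n: "fst (run M w n) \<in> final M" for w n
  proof -
    obtain m where m: "fst (run M w m) \<in> final M" "fst (run M w m) \<in> accepting M \<longleftrightarrow> w \<in> L"
      using halts[OF w] by blast
    have "run M w m = run M w n"
    proof (cases "m \<le> n")
      case True
      show ?thesis by (rule run_final[OF m(1) True, symmetric])
    next
      case False
      then show ?thesis by (intro run_final[OF n]) simp
    qed
    with m(2) show ?thesis by simp
  qed
  have words: "map lt xs \<in> lists A" if "set xs \<subseteq> {..<k}" for xs
    using that assms(2) by (auto simp: lists_eq_set)
  show thesis
  proof (rule that)
    show "decidable_pr (\<lambda>p. f p \<in> accepting M)"
      by (rule decidable_pr_comp[OF decidable_pr_finite f(1)]) (rule fin(2))
    have "finite (final M - accepting M)"
      using fin(1) by (rule finite_Diff)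
    then show "decidable_pr (\<lambda>p. f p \<in> final M - accepting M)"
      by (rule decidable_pr_comp[OF decidable_pr_finite f(1)])
  next
    fix xs
    assume xs: "set xs \<subseteq> {..<k}"
    let ?w = "map lt xs"
    obtain n where n: "fst (run M ?w n) \<in> final M" "fst (run M ?w n) \<in> accepting M \<longleftrightarrow> ?w \<in> L"
      using halts[OF words[OF xs]] by blast
    show "?w \<in> L \<longleftrightarrow> (\<exists>n. f (xs, n) \<in> accepting M)"
      unfolding f(2)[OF xs] using n decision[OF words[OF xs] subsetD[OF acc]] by metis
    show "?w \<notin> L \<longleftrightarrow> (\<exists>n. f (xs, n) \<in> final M - accepting M)"
      unfolding f(2)[OF xs] Diff_iff using n decision[OF words[OF xs]] by metis
  qed
qed

section \<open>Certificates for relations\<close>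

text \<open>
  Counterparts of free reduction, inversion and products of conjugates for words whose letters are given by
  numbers, \<open>fl\<close> being the inversion of letters. In a certificate, each relator is
  accompanied by a fourth component, a witness that it is a relator.
\<close>

definition push_index :: "(nat \<Rightarrow> nat) \<Rightarrow> nat \<Rightarrow> nat list \<Rightarrow> nat list" where
  "push_index fl a w = (case w of [] \<Rightarrow> [a] | b # v \<Rightarrow> if b = fl a then v else a # w)"

definition reduce_index :: "(nat \<Rightarrow> nat) \<Rightarrow> nat list \<Rightarrow> nat list" where
  "reduce_index fl w = foldr (push_index fl) w []"

definition inverse_index :: "(nat \<Rightarrow> nat) \<Rightarrow> nat list \<Rightarrow> nat list" where
  "inverse_index fl w = map fl (rev w)"

definition conjugate_product_index ::
    "(nat \<Rightarrow> nat) \<Rightarrow> (nat list \<times> nat \<times> nat list \<times> nat) list \<Rightarrow> nat list" where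
  "conjugate_product_index fl cs = concat (map (\<lambda>c. fst c @
     (if fst (snd c) = 0 then fst (snd (snd c)) else inverse_index fl (fst (snd (snd c)))) @
     inverse_index fl (fst c)) cs)"

lemma pr_reduce_index [pr_intros]:
  assumes "pr fl" "pr w"
  shows "pr (\<lambda>x. reduce_index fl (w x))"
  unfolding reduce_index_def push_index_def by (intro pr_intros pr_comp[OF assms(1)] assms(2))

lemma pr_inverse_index [pr_intros]:
  assumes "pr fl" "pr w"
  shows "pr (\<lambda>x. inverse_index fl (w x))"
  unfolding inverse_index_def by (intro pr_intros pr_comp[OF assms(1)] assms(2))

lemma pr_conjugate_product_index [pr_intros]:
  assumes "pr fl" "pr cs"
  shows "pr (\<lambda>x. conjugate_product_index fl (cs x))"
  unfolding conjugate_product_index_def by (intro pr_intros assms)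

locale letter_index =
  fixes X :: "'a set" and lt :: "nat \<Rightarrow> 'a letter" and k :: nat
  assumes lt: "bij_betw lt {..<k} (letters X)"
begin

definition flip_index :: "nat \<Rightarrow> nat" where
  "flip_index i = (if i \<in> {..<k} then inv_into {..<k} lt (flip (lt i)) else 0)"

lemma pr_flip_index: "pr flip_index"
  unfolding flip_index_def[abs_def] by (rule pr_finite_table) simp

lemma lt_in: "i < k \<Longrightarrow> lt i \<in> letters X"
  using lt by (auto simp: bij_betw_def)

lemma lt_eq_iff: "i < k \<Longrightarrow> j < k \<Longrightarrow> lt i = lt j \<longleftrightarrow> i = j"
  using lt by (auto simp: bij_betw_def inj_on_def)

lemma flip_index: "i < k \<Longrightarrow> flip_index i < k" "i < k \<Longrightarrow> lt (flip_index i) = flip (lt i)"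
proof -
  assume i: "i < k"
  then have "flip (lt i) \<in> lt ` {..<k}"
    using lt lt_in by (simp add: bij_betw_def)
  then show "flip_index i < k" "lt (flip_index i) = flip (lt i)"
    using i inv_into_into[of "flip (lt i)" lt "{..<k}"] f_inv_into_f[of "flip (lt i)" lt "{..<k}"]
    by (simp_all add: flip_index_def)
qed

lemma word_in: "set w \<subseteq> {..<k} \<Longrightarrow> map lt w \<in> lists (letters X)"
  using lt_in by (auto simp: lists_eq_set)

lemma ex_index_word:
  assumes "w \<in> lists (letters X)"
  obtains u where "set u \<subseteq> {..<k}" "map lt u = w"
proof -
  have "w \<in> map lt ` lists {..<k}"
    using assms lt by (simp add: lists_image[symmetric] bij_betw_def)
  then show thesis using that by (auto simp: lists_eq_set)
qed

lemma map_eq_iff: "set u \<subseteq> {..<k} \<Longrightarrow> set v \<subseteq> {..<k} \<Longrightarrow> map lt u = map lt v \<longleftrightarrow> u = v"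
  using lt by (intro inj_on_map_eq_map) (auto simp: bij_betw_def intro: inj_on_subset)

lemma push_index:
  assumes "a < k" "set w \<subseteq> {..<k}"
  shows "map lt (push_index flip_index a w) = push_letter (lt a) (map lt w) \<and> set (push_index flip_index a w) \<subseteq> {..<k}"
proof (cases w)
  case Nil
  with assms show ?thesis by (simp add: push_index_def)
next
  case (Cons b v)
  then have "lt b = flip (lt a) \<longleftrightarrow> b = flip_index a"
    using assms flip_index[of a] lt_eq_iff[of b "flip_index a"] by simp
  with Cons assms show ?thesis by (simp add: push_index_def)
qed

lemma reduce_index:
  "set w \<subseteq> {..<k} \<Longrightarrow> map lt (reduce_index flip_index w) = free_reduce (map lt w) \<and> set (reduce_index flip_index w) \<subseteq> {..<k}"
proof (induction w)
  case (Cons a w)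
  then show ?case using push_index[of a "reduce_index flip_index w"] by (simp add: reduce_index_def)
qed (simp add: reduce_index_def)

lemma inverse_index:
  assumes "set w \<subseteq> {..<k}"
  shows "map lt (inverse_index flip_index w) = inverse_word (map lt w)" "set (inverse_index flip_index w) \<subseteq> {..<k}"
proof -
  have "map (\<lambda>i. lt (flip_index i)) w = map (\<lambda>i. flip (lt i)) w"
    using assms flip_index(2) by auto
  then show "map lt (inverse_index flip_index w) = inverse_word (map lt w)"
    by (simp add: inverse_index_def inverse_word_def comp_def flip: rev_map)
  show "set (inverse_index flip_index w) \<subseteq> {..<k}"
    using assms flip_index(1) by (auto simp: inverse_index_def)
qed

lemma conjugate_product_index:
  assumes "\<And>g s r n. (g, s, r, n) \<in> set cs \<Longrightarrow> set g \<subseteq> {..<k} \<and> set r \<subseteq> {..<k}"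
  shows "map lt (conjugate_product_index flip_index cs) =
      conjugate_product (map (\<lambda>(g, s, r, n). (map lt g, s, map lt r)) cs) \<and>
    set (conjugate_product_index flip_index cs) \<subseteq> {..<k}"
  using assms
proof (induction cs)
  case (Cons c cs)
  obtain g s r n where c: "c = (g, s, r, n)" by (cases c)
  have gr: "set g \<subseteq> {..<k}" "set r \<subseteq> {..<k}"
    using Cons.prems[of g s r n] by (simp_all add: c)
  have "set g \<subseteq> {..<k} \<and> set r \<subseteq> {..<k}" if "(g, s, r, n) \<in> set cs" for g s r n
    using Cons.prems[of g s r n] that by simp
  from Cons.IH[OF this] have "map lt (conjugate_product_index flip_index cs) =
      conjugate_product (map (\<lambda>(g, s, r, n). (map lt g, s, map lt r)) cs) \<and>
    set (conjugate_product_index flip_index cs) \<subseteq> {..<k}"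
    by simp
  with inverse_index[OF gr(1)] inverse_index[OF gr(2)] gr show ?case
    by (simp add: c conjugate_product_index_def)
qed (simp add: conjugate_product_index_def)

text \<open>
  Being trivial in a recursively presented group is semidecidable: the number \<open>m\<close> codes a list of
  conjugates of relators together with witnesses for the relators, and \<open>Q\<close> compares the reduced
  form of their product with that of the word.
\<close>

theorem trivial_words_semidecidable:
  assumes R: "recursively_enumerable (letters X) R"
  shows "\<exists>Q :: nat list \<times> nat \<Rightarrow> bool. decidable_pr Q \<and> (\<forall>u. set u \<subseteq> {..<k} \<longrightarrow>
    (free_reduce (map lt u) \<in> normal_closure (free_group X) (free_reduce ` R) \<longleftrightarrow> (\<exists>m. Q (u, m))))"
proof -
  have R_lists: "R \<subseteq> lists (letters X)"
    using R by (simp add: recursively_enumerable_def)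
  have lt_image: "lt ` {..<k} \<subseteq> letters X"
    using lt by (simp add: bij_betw_def)
  obtain E :: "nat list \<times> nat \<Rightarrow> bool" where E: "decidable_pr E"
    "\<And>xs. set xs \<subseteq> {..<k} \<Longrightarrow> map lt xs \<in> R \<longleftrightarrow> (\<exists>n. E (xs, n))"
    using recursively_enumerable_imp_pr[OF R lt_image] by (elim exE conjE) (rule that, simp_all)
  define ok where "ok c \<longleftrightarrow> (\<forall>x\<in>set (fst c). x < k) \<and> (\<forall>x\<in>set (fst (snd (snd c))). x < k) \<and>
    E (snd (snd c))" for c :: "nat list \<times> nat \<times> nat list \<times> nat"
  define Q where "Q p \<longleftrightarrow> (\<forall>c\<in>set (decode (snd p)). ok c) \<and>
    reduce_index flip_index (fst p) = reduce_index flip_index (conjugate_product_index flip_index (decode (snd p)))"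
    for p :: "nat list \<times> nat"
  show ?thesis
  proof (intro exI[of _ Q] conjI allI impI)
    have "decidable_pr (\<lambda>p :: (nat list \<times> nat) \<times> (nat list \<times> nat \<times> nat list \<times> nat). ok (snd p))"
      unfolding ok_def by (intro pr_intros decidable_pr_comp[OF E(1)])
    then show "decidable_pr Q"
      unfolding Q_def[abs_def] by (intro pr_intros pr_flip_index)
  next
    fix u
    assume u: "set u \<subseteq> {..<k}"
    let ?code = "map (\<lambda>(g, s, r, n). (map lt g, s, map lt r))"
    have ok_conj: "(map lt g, s, map lt r) \<in> conjugates X R" "set g \<subseteq> {..<k}" "set r \<subseteq> {..<k}"
      if "ok (g, s, r, n)" for g s r n
      using that E(2)[of r] word_in[of g] by (auto simp: ok_def conjugates_def)
    have key: "reduce_index flip_index u = reduce_index flip_index (conjugate_product_index flip_index cs) \<longleftrightarrow>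
        free_reduce (map lt u) = free_reduce (conjugate_product (?code cs))"
      and conj: "?code cs \<in> lists (conjugates X R)" if "\<forall>c\<in>set cs. ok c" for cs
    proof -
      have "set g \<subseteq> {..<k} \<and> set r \<subseteq> {..<k}" if "(g, s, r, n) \<in> set cs" for g s r n
        using ok_conj that \<open>\<forall>c\<in>set cs. ok c\<close> by blast
      then have "map lt (conjugate_product_index flip_index cs) = conjugate_product (?code cs)"
        "set (conjugate_product_index flip_index cs) \<subseteq> {..<k}"
        using conjugate_product_index[of cs] by auto
      then show "reduce_index flip_index u = reduce_index flip_index (conjugate_product_index flip_index cs) \<longleftrightarrow>
          free_reduce (map lt u) = free_reduce (conjugate_product (?code cs))"
        using reduce_index[OF u] reduce_index[of "conjugate_product_index flip_index cs"]
          map_eq_iff[of "reduce_index flip_index u" "reduce_index flip_index (conjugate_product_index flip_index cs)"]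
        by simp
      show "?code cs \<in> lists (conjugates X R)"
        using that ok_conj(1) by (fastforce simp: lists_eq_set)
    qed
    have lift: "\<exists>cs. (\<forall>c\<in>set cs. ok c) \<and> ?code cs = ds" if "ds \<in> lists (conjugates X R)" for ds
      using that
    proof (induction ds rule: list.induct)
      case (Cons d ds)
      then obtain cs where cs: "\<forall>c\<in>set cs. ok c" "?code cs = ds" by auto
      obtain g s r where d: "d = (g, s, r)" by (cases d)
      have "(g, s, r) \<in> conjugates X R" using Cons.prems by (simp add: d)
      then have g: "g \<in> lists (letters X)" and r: "r \<in> R" by (auto simp: conjugates_def)
      obtain g' where g': "set g' \<subseteq> {..<k}" "map lt g' = g" using ex_index_word[OF g] by blast
      obtain r' where r': "set r' \<subseteq> {..<k}" "map lt r' = r" using ex_index_word r R_lists by blast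
      obtain n where "E (r', n)" using E(2)[OF r'(1)] r r'(2) by blast
      then have "ok (g', s, r', n)" using g'(1) r'(1) by (auto simp: ok_def)
      with cs g' r' show ?case
        by (intro exI[of _ "(g', s, r', n) # cs"]) (simp add: d)
    qed (intro exI[of _ "[]"], simp)
    show "free_reduce (map lt u) \<in> normal_closure (free_group X) (free_reduce ` R) \<longleftrightarrow> (\<exists>m. Q (u, m))"
      unfolding normal_closure_free_group[OF R_lists]
    proof
      assume "free_reduce (map lt u) \<in> (\<lambda>cs. free_reduce (conjugate_product cs)) ` lists (conjugates X R)"
      then obtain ds where ds: "ds \<in> lists (conjugates X R)"
        "free_reduce (map lt u) = free_reduce (conjugate_product ds)" by blast
      obtain cs where cs: "\<forall>c\<in>set cs. ok c" "?code cs = ds" using lift[OF ds(1)] by blast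
      then have "Q (u, encode cs)"
        using key[OF cs(1)] ds(2) by (simp add: Q_def)
      then show "\<exists>m. Q (u, m)" ..
    next
      assume "\<exists>m. Q (u, m)"
      then obtain m where "Q (u, m)" ..
      then have "\<forall>c\<in>set (decode m). ok c"
        "reduce_index flip_index u = reduce_index flip_index (conjugate_product_index flip_index (decode m))"
        by (simp_all add: Q_def)
      then show "free_reduce (map lt u) \<in> (\<lambda>cs. free_reduce (conjugate_product cs)) ` lists (conjugates X R)"
        using key conj by blast
    qed
  qed
qed

end

lemma ex_letter_index:
  assumes "finite X"
  shows "\<exists>lt k. letter_index X lt k"
proof -
  have "finite (letters X)" using assms by (simp add: letters_def)
  then show ?thesis
    using ex_bij_betw_nat_finite[of "letters X"] by (auto simp: letter_index_def atLeast0LessThan)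
qed

section \<open>The word problem\<close>

lemma solvable_word_problem_eval:
  "solvable_word_problem G X \<longleftrightarrow>
    decidable_language (letters X) {w \<in> lists (letters X). eval_word G w = \<one>\<^bsub>G\<^esub>}"
  by (simp add: solvable_word_problem_def eval_word_def)

context group
begin

lemma solvable_imp_has_re_presentation:
  assumes X: "finite X" "X \<subseteq> carrier G" "generate G X = carrier G"
    and solvable: "solvable_word_problem G X"
  shows "has_re_presentation G X"
proof -
  let ?R = "{w \<in> lists (letters X). eval_word G w = \<one>}"
  obtain lt k where "letter_index X lt k" using ex_letter_index[OF X(1)] by blast
  then interpret letter_index X lt k .
  have lt_image: "lt ` {..<k} = letters X" using lt by (simp add: bij_betw_def)
  show ?thesis
  proof (rule decidable_language_imp_pr[OF solvable[unfolded solvable_word_problem_eval] eq_refl[OF lt_image]])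
    fix P :: "nat list \<times> nat \<Rightarrow> bool"
    assume P: "decidable_pr P" "\<And>xs. set xs \<subseteq> {..<k} \<Longrightarrow> map lt xs \<in> ?R \<longleftrightarrow> (\<exists>n. P (xs, n))"
    have "map lt ` {xs. set xs \<subseteq> {..<k} \<and> (\<exists>n. P (xs, n))} = ?R"
    proof (intro equalityI subsetI)
      fix w
      assume "w \<in> ?R"
      then have "w \<in> lists (letters X)" by simp
      then obtain u where u: "set u \<subseteq> {..<k}" "map lt u = w" by (rule ex_index_word)
      with \<open>w \<in> ?R\<close> P(2)[OF u(1)] show "w \<in> map lt ` {xs. set xs \<subseteq> {..<k} \<and> (\<exists>n. P (xs, n))}"
        by blast
    qed (use P(2) in blast)
    then have "recursively_enumerable (letters X) ?R"
      using pr_imp_recursively_enumerable[OF lt_image P(1)] by (simp only:)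
    with trivial_words_presentation[OF X(2,3)] show "has_re_presentation G X"
      unfolding has_re_presentation_def by (intro exI[of _ ?R] conjI) simp_all
  qed
qed

text \<open>
  The set \<open>Y\<close> consists of the values of all letters. Two letters may have the same value, but words of
  letters and words over \<open>Y\<close> can share their indices, so that nothing has to be
  chosen.
\<close>

lemma solvable_imp_epiRE:
  assumes X: "finite X" "X \<subseteq> carrier G" "generate G X = carrier G"
    and solvable: "solvable_word_problem G X"
  shows "epiRE G"
proof -
  let ?R = "{w \<in> lists (letters X). eval_word G w = \<one>}"
  obtain lt k where "letter_index X lt k" using ex_letter_index[OF X(1)] by blast
  then interpret letter_index X lt k .
  have lt_image: "lt ` {..<k} = letters X" using lt by (simp add: bij_betw_def)
  show ?thesis
  proof (rule decidable_language_imp_pr[OF solvable[unfolded solvable_word_problem_eval] eq_refl[OF lt_image]])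
    fix Q :: "nat list \<times> nat \<Rightarrow> bool"
    assume Q: "decidable_pr Q" "\<And>xs. set xs \<subseteq> {..<k} \<Longrightarrow> map lt xs \<notin> ?R \<longleftrightarrow> (\<exists>n. Q (xs, n))"
    define ly where "ly i = letter_value G (lt i)" for i
    let ?Y = "ly ` {..<k}"
    let ?L = "map ly ` {xs. set xs \<subseteq> {..<k} \<and> (\<exists>n. Q (xs, n))}"
    have "map ly xs = map (letter_value G) (map lt xs)" for xs
      by (simp add: ly_def)
    then have value_ly: "word_value G (map ly xs) = eval_word G (map lt xs)" for xs
      by (simp only: eval_word_def)
    have Y: "?Y \<subseteq> carrier G"
      using letter_value_closed[OF X(2)] lt_in by (auto simp: ly_def)
    have surj: "\<exists>xs. set xs \<subseteq> {..<k} \<and> word_value G (map ly xs) = h" if "h \<in> carrier G" for h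
    proof -
      obtain w where w: "w \<in> lists (letters X)" "h = eval_word G w"
        using \<open>h \<in> carrier G\<close> generate_eval_word[OF X(2)] X(3) by auto
      obtain u where "set u \<subseteq> {..<k}" "map lt u = w" using ex_index_word[OF w(1)] .
      with w(2) show ?thesis by (auto simp: value_ly)
    qed
    have "word_value G ` lists ?Y = carrier G"
    proof (intro equalityI subsetI)
      fix h
      assume "h \<in> word_value G ` lists ?Y"
      then show "h \<in> carrier G" using Y by (auto simp: lists_eq_set intro!: word_value_closed)
    next
      fix h
      assume "h \<in> carrier G"
      then obtain xs where "set xs \<subseteq> {..<k}" "word_value G (map ly xs) = h" using surj by blast
      then show "h \<in> word_value G ` lists ?Y"
        by (intro image_eqI[of _ _ "map ly xs"]) (auto simp: lists_eq_set)
    qed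
    moreover have "recursively_enumerable ?Y ?L"
      by (rule pr_imp_recursively_enumerable[OF refl Q(1)])
    moreover from this have "?L \<subseteq> lists ?Y"
      by (simp add: recursively_enumerable_def)
    moreover have "word_value G w \<noteq> \<one>" if "w \<in> ?L" for w
    proof -
      obtain xs where xs: "set xs \<subseteq> {..<k}" "\<exists>n. Q (xs, n)" "w = map ly xs"
        using \<open>w \<in> ?L\<close> by blast
      with Q(2)[OF xs(1)] word_in[OF xs(1)] show ?thesis by (simp add: value_ly)
    qed
    moreover have "\<exists>w\<in>?L. word_value G w = h" if h: "h \<in> carrier G - {\<one>}" for h
    proof -
      obtain xs where xs: "set xs \<subseteq> {..<k}" "word_value G (map ly xs) = h" using surj h by blast
      then have "map lt xs \<notin> ?R" using h by (simp add: value_ly)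
      then have "\<exists>n. Q (xs, n)" using Q(2)[OF xs(1)] by simp
      with xs show ?thesis by blast
    qed
    ultimately show "epiRE G"
      unfolding epiRE_def using Y by (intro exI[of _ ?Y] exI[of _ ?L]) auto
  qed
qed

text \<open>
  A number searched for codes a triple \<open>(v, n, m)\<close>. Either \<open>m\<close> certifies that the translation of the input
  is trivial, or \<open>n\<close> certifies \<open>v \<in> L\<close> and \<open>m\<close> certifies that input and \<open>v\<close> are equal in the
  group.
\<close>

lemma has_re_presentation_epiRE_imp_solvable:
  assumes X: "finite X" "X \<subseteq> carrier G"
    and pres: "has_re_presentation G X" and epi: "epiRE G"
  shows "solvable_word_problem G X"
proof -
  let ?W = "{w \<in> lists (letters X). eval_word G w = \<one>}"
  obtain R where R: "R \<subseteq> lists (letters X)" "recursively_enumerable (letters X) R"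
    and iso: "G \<cong> presented_group X R"
    using pres unfolding has_re_presentation_def by (elim exE conjE)
  obtain Y L where Y: "finite Y" "Y \<subseteq> carrier G" and L: "L \<subseteq> lists Y" "recursively_enumerable Y L"
    and L_nontrivial: "\<forall>w\<in>L. word_value G w \<noteq> \<one>"
    and L_hits: "\<forall>h\<in>carrier G - {\<one>}. \<exists>w\<in>L. word_value G w = h"
    using epi unfolding epiRE_def by (elim exE conjE)
  interpret presentation X R by unfold_locales (rule R(1))
  obtain h where h: "h \<in> iso G P" using iso unfolding is_iso_def by blast
  then have h_hom: "h \<in> hom G P" and h_inj: "inj_on h (carrier G)"
    by (simp_all add: iso_def bij_betw_def)
  obtain lt k where "letter_index X lt k" using ex_letter_index[OF X(1)] by blast
  then interpret letter_index X lt k .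
  obtain ly :: "nat \<Rightarrow> 'a" and l where ly: "bij_betw ly {..<l} Y"
    using ex_bij_betw_nat_finite[OF Y(1)] unfolding atLeast0LessThan by (elim exE)
  obtain E :: "nat list \<times> nat \<Rightarrow> bool" where E: "decidable_pr E"
    "\<And>xs. set xs \<subseteq> {..<l} \<Longrightarrow> map ly xs \<in> L \<longleftrightarrow> (\<exists>n. E (xs, n))"
    using recursively_enumerable_imp_pr[OF L(2) eq_refl[OF bij_betw_imp_surj_on[OF ly]]]
    by (elim exE conjE) (rule that, simp_all)
  obtain T :: "nat list \<times> nat \<Rightarrow> bool" where T: "decidable_pr T"
    "\<And>u. set u \<subseteq> {..<k} \<Longrightarrow> free_reduce (map lt u) \<in> N \<longleftrightarrow> (\<exists>m. T (u, m))"
    using trivial_words_semidecidable[OF R(2)] by (elim exE conjE) (rule that, simp_all)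

  have rep: "\<exists>u. set u \<subseteq> {..<k} \<and> word_class X R (map lt u) = h g" if "g \<in> carrier G" for g
  proof -
    have "h g \<in> carrier P" using h_hom that by (auto simp: hom_def)
    then obtain w where w: "w \<in> lists (letters X)" "word_class X R w = h g" by (rule word_class_surj)
    obtain u where "set u \<subseteq> {..<k}" "map lt u = w" using ex_index_word[OF w(1)] .
    with w(2) show ?thesis by blast
  qed
  \<comment> \<open>The translation: a word that represents the image of an element under the isomorphism. It
      is used only for the finitely many letters and elements of Y, and there it is a finite table.\<close>
  define rep_word where "rep_word g = (SOME u. set u \<subseteq> {..<k} \<and> word_class X R (map lt u) = h g)" for g
  have rep_word: "set (rep_word g) \<subseteq> {..<k}" "word_class X R (map lt (rep_word g)) = h g" if "g \<in> carrier G" for g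
    using someI_ex[OF rep[OF that]] unfolding rep_word_def by simp_all
  define sx where "sx i = (if i \<in> {..<k} then rep_word (letter_value G (lt i)) else [])" for i
  define sy where "sy i = (if i \<in> {..<l} then rep_word (ly i) else [])" for i
  have pr_s: "pr sx" "pr sy"
    unfolding sx_def[abs_def] sy_def[abs_def] by (rule pr_finite_table, simp)+
  let ?sx = "\<lambda>u. concat (map sx u)" and ?sy = "\<lambda>v. concat (map sy v)"
  have subst: "set (concat (map s u)) \<subseteq> {..<k} \<and>
      h (word_value G (map f u)) = word_class X R (map lt (concat (map s u)))"
    if "set u \<subseteq> {..<n}" and f: "\<And>i. i < n \<Longrightarrow> f i \<in> carrier G \<and> s i = rep_word (f i)"
    for s u f and n :: nat
  proof -
    have u: "f i \<in> carrier G" "s i = rep_word (f i)" if "i \<in> set u" for i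
      using that \<open>set u \<subseteq> {..<n}\<close> f by auto
    have s: "map lt (concat (map s u)) = concat (map (\<lambda>g. map lt (rep_word g)) (map f u))"
      unfolding map_concat map_map by (rule arg_cong[of _ _ concat], rule map_cong) (simp_all add: u)
    have "map f u \<in> lists (carrier G)"
      using u(1) by (simp add: lists_eq_set image_subset_iff)
    then have "h (word_value G (map f u)) = word_class X R (concat (map (\<lambda>g. map lt (rep_word g)) (map f u)))"
      by (intro hom_word_value[OF h_hom is_group, THEN conjunct1]) (simp_all add: rep_word word_in)
    moreover have "set (concat (map s u)) \<subseteq> {..<k}"
    proof -
      have "set (s i) \<subseteq> {..<k}" if "i \<in> set u" for i
        unfolding u(2)[OF that] by (rule rep_word(1)[OF u(1)[OF that]])
      then show ?thesis by (simp add: UN_subset_iff)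
    qed
    ultimately show ?thesis using s by simp
  qed
  have sx: "set (?sx u) \<subseteq> {..<k}" "h (eval_word G (map lt u)) = word_class X R (map lt (?sx u))"
    if "set u \<subseteq> {..<k}" for u
    using subst[OF that, of "\<lambda>i. letter_value G (lt i)" sx] letter_value_closed[OF X(2) lt_in]
    by (simp_all add: sx_def eval_word_def comp_def)
  have sy: "set (?sy v) \<subseteq> {..<k}" "h (word_value G (map ly v)) = word_class X R (map lt (?sy v))"
    if "set v \<subseteq> {..<l}" for v
    using subst[OF that, of ly sy] ly Y(2) by (auto simp: sy_def bij_betw_def)
  have eval_in: "eval_word G (map lt u) \<in> carrier G" if "set u \<subseteq> {..<k}" for u
    using eval_word_closed[OF X(2) word_in[OF that]] .
  have value_in: "word_value G (map ly v) \<in> carrier G" if "set v \<subseteq> {..<l}" for v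
    using that ly Y(2) by (intro word_value_closed) (auto simp: bij_betw_def)
  interpret h: group_hom G P h
    using h_hom group_P is_group by (simp add: group_hom_def group_hom_axioms_def)
  have trivial_iff: "eval_word G (map lt u) = \<one> \<longleftrightarrow> (\<exists>m. T (?sx u, m))" if u: "set u \<subseteq> {..<k}" for u
  proof -
    have "eval_word G (map lt u) = \<one> \<longleftrightarrow> h (eval_word G (map lt u)) = \<one>\<^bsub>P\<^esub>"
      using inj_on_eq_iff[OF h_inj eval_in[OF u] one_closed] by simp
    also have "\<dots> \<longleftrightarrow> (\<exists>m. T (?sx u, m))"
      unfolding sx(2)[OF u] word_class_eq_one[OF word_in[OF sx(1)[OF u]]] T(2)[OF sx(1)[OF u]] ..
    finally show ?thesis .
  qed
  have equal_iff: "eval_word G (map lt u) = word_value G (map ly v) \<longleftrightarrow>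
      (\<exists>m. T (?sx u @ inverse_index flip_index (?sy v), m))"
    if u: "set u \<subseteq> {..<k}" and v: "set v \<subseteq> {..<l}" for u v
  proof -
    have "eval_word G (map lt u) = word_value G (map ly v) \<longleftrightarrow>
        word_class X R (map lt (?sx u)) = word_class X R (map lt (?sy v))"
      using inj_on_eq_iff[OF h_inj eval_in[OF u] value_in[OF v]] sx(2)[OF u] sy(2)[OF v] by simp
    also have "\<dots> \<longleftrightarrow> free_reduce (map lt (?sx u @ inverse_index flip_index (?sy v))) \<in> N"
      using word_class_eq_iff[OF word_in[OF sx(1)[OF u]] word_in[OF sy(1)[OF v]]]
        inverse_index(1)[OF sy(1)[OF v]] by simp
    also have "\<dots> \<longleftrightarrow> (\<exists>m. T (?sx u @ inverse_index flip_index (?sy v), m))"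
      using sx(1)[OF u] inverse_index(2)[OF sy(1)[OF v]] by (intro T(2)) auto
    finally show ?thesis .
  qed

  \<comment> \<open>The three outcomes expected by the search: 1 for a certificate of triviality, 2 for a certificate
      of equality with a word in L, 0 for no valid certificate.\<close>
  define D where "D p = (let c = decode (snd p) :: nat list \<times> nat \<times> nat in
      if T (?sx (fst p), snd (snd c)) then 1
      else if (\<forall>i\<in>set (fst c). i < l) \<and> E (fst c, fst (snd c)) \<and>
        T (?sx (fst p) @ inverse_index flip_index (?sy (fst c)), snd (snd c)) then 2
      else 0 :: nat)" for p :: "nat list \<times> nat"
  have D: "D (u, encode (v, n, m)) = (if T (?sx u, m) then 1
      else if (\<forall>i\<in>set v. i < l) \<and> E (v, n) \<and> T (?sx u @ inverse_index flip_index (?sy v), m) then 2 else 0)"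
    for u v n m
    unfolding D_def Let_def fst_conv snd_conv decode_encode ..
  show ?thesis
    unfolding solvable_word_problem_eval
  proof (rule decidable_language_search[OF _ lt])
    show "finite (letters X)" using X(1) by (simp add: letters_def)
    show "pr D"
      unfolding D_def[abs_def] Let_def
      by (intro pr_intros decidable_pr_comp[OF T(1)] decidable_pr_comp[OF E(1)]
          pr_comp[OF pr_s(1)] pr_comp[OF pr_s(2)] pr_flip_index)
    show "?W \<subseteq> lists (letters X)" by blast
  next
    fix u
    assume u: "set u \<subseteq> {..<k}"
    show "\<exists>n. D (u, n) \<noteq> 0"
    proof (cases "eval_word G (map lt u) = \<one>")
      case True
      then obtain m where "T (?sx u, m)" using trivial_iff[OF u] by blast
      then have "D (u, encode ([] :: nat list, 0 :: nat, m)) \<noteq> 0" unfolding D by simp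
      then show ?thesis ..
    next
      case False
      then obtain w where w: "w \<in> L" "word_value G w = eval_word G (map lt u)"
        using L_hits eval_in[OF u] by auto
      have "w \<in> map ly ` lists {..<l}"
        using w(1) L(1) ly by (auto simp: lists_image[symmetric] bij_betw_def)
      then obtain v where v: "set v \<subseteq> {..<l}" "w = map ly v" by (auto simp: lists_eq_set)
      obtain n where n: "E (v, n)" using E(2)[OF v(1)] w(1) v(2) by blast
      obtain m where "T (?sx u @ inverse_index flip_index (?sy v), m)"
        using equal_iff[OF u v(1)] w(2) v(2) by auto
      with n v(1) have "D (u, encode (v, n, m)) \<noteq> 0" unfolding D by auto
      then show ?thesis ..
    qed
  next
    fix u n
    assume u: "set u \<subseteq> {..<k}" and D1: "D (u, n) = 1"
    obtain v i m where n: "n = encode (v :: nat list, i :: nat, m :: nat)"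
      by (metis encode_decode prod_cases3)
    have "T (?sx u, m)" using D1 unfolding n D by (simp split: if_splits)
    then show "map lt u \<in> ?W" using trivial_iff[OF u] word_in[OF u] by blast
  next
    fix u n
    assume u: "set u \<subseteq> {..<k}" and D2: "D (u, n) > 1"
    obtain v i m where n: "n = encode (v :: nat list, i :: nat, m :: nat)"
      by (metis encode_decode prod_cases3)
    have v: "set v \<subseteq> {..<l}" and "E (v, i)" "T (?sx u @ inverse_index flip_index (?sy v), m)"
      using D2 unfolding n D by (auto split: if_splits)
    then have "map ly v \<in> L" "eval_word G (map lt u) = word_value G (map ly v)"
      using E(2)[OF v] equal_iff[OF u v] by blast+
    with L_nontrivial show "map lt u \<notin> ?W" by auto
  qed
qed

end

theorem theoremE:
  fixes G :: "('a, 'm) monoid_scheme" and X :: "'a set"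
  assumes "group G"
    and "finite X" and "X \<subseteq> carrier G" and "generate G X = carrier G"
  shows "solvable_word_problem G X \<longleftrightarrow> has_re_presentation G X \<and> epiRE G"
  using group.solvable_imp_has_re_presentation[OF assms] group.solvable_imp_epiRE[OF assms]
    group.has_re_presentation_epiRE_imp_solvable[OF assms(1-3)]
  by blast

end
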